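(* Let $k>0$ and let $E_k$ be the Dunkl kernel of the root system $A_2$ with multiplicity $k$. For $\lambda\in C^+$ and $X\in\mathfrak a$ the following estimates hold, with implied constants depending only on $k$ (uniform in $\lambda\in C^+$ and in $X$ in the indicated region): (i) If $x_1\ge x_2\ge x_3$: $E_k(X,\lambda)\asymp \dfrac{e^{\langle\lambda,X\rangle}}{(1+\alpha_\lambda\alpha_X)^k(1+\beta_\lambda\beta_X)^k(1+\gamma_\lambda\gamma_X)^k}$. (ii) If $x_2\ge x_1\ge x_3$: $E_k(X,\lambda)\asymp \dfrac{e^{\langle\lambda,X^+\rangle}}{(1+\alpha_\lambda\alpha_{X^+})^{k+1}(1+\beta_\lambda\beta_{X^+})^k(1+\gamma_\lambda\gamma_{X^+})^k}$. If $x_1\ge x_3\ge x_2$: $E_k(X,\lambda)\asymp \dfrac{e^{\langle\lambda,X^+\rangle}}{(1+\alpha_\lambda\alpha_{X^+})^{k}(1+\beta_\lambda\beta_{X^+})^{k+1}(1+\gamma_\lambda\gamma_{X^+})^k}$. (iii) If $x_2\ge x_3\ge x_1$: $E_k(X,\lambda)\asymp \dfrac{e^{\langle\lambda,X^+\rangle}}{(1+\alpha_\lambda\alpha_{X^+})^{k+1}(1+\beta_\lambda\beta_{X^+})^{k+1}(1+\gamma_\lambda\gamma_{X^+})^k}$ if $\alpha_\lambda\le\beta_\lambda$; $E_k(X,\lambda)\asymp \dfrac{e^{\langle\lambda,X^+\rangle}}{(1+\alpha_\lambda\alpha_{X^+})^{k}(1+\beta_\lambda\beta_{X^+})^{k+1}(1+\gamma_\lambda\gamma_{X^+})^{k+1}}$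 if $\alpha_\lambda\ge\beta_\lambda$ and $\alpha_\lambda\alpha_{X^+}\ge\beta_\lambda\beta_{X^+}$; $E_k(X,\lambda)\asymp \dfrac{e^{\langle\lambda,X^+\rangle}}{(1+\alpha_\lambda\alpha_{X^+})^{k+1}(1+\beta_\lambda\beta_{X^+})^{k}(1+\gamma_\lambda\gamma_{X^+})^{k+1}}$ if $\alpha_\lambda\ge\beta_\lambda$ and $\alpha_\lambda\alpha_{X^+}\le\beta_\lambda\beta_{X^+}$. (iv) If $x_3\ge x_1\ge x_2$: $E_k(X,\lambda)\asymp \dfrac{e^{\langle\lambda,X^+\rangle}}{(1+\alpha_\lambda\alpha_{X^+})^{k+1}(1+\beta_\lambda\beta_{X^+})^{k+1}(1+\gamma_\lambda\gamma_{X^+})^k}$ if $\beta_\lambda\le\alpha_\lambda$; $E_k(X,\lambda)\asymp \dfrac{e^{\langle\lambda,X^+\rangle}}{(1+\alpha_\lambda\alpha_{X^+})^{k}(1+\beta_\lambda\beta_{X^+})^{k+1}(1+\gamma_\lambda\gamma_{X^+})^{k+1}}$ if $\beta_\lambda\ge\alpha_\lambda$ and $\alpha_\lambda\alpha_{X^+}\ge\beta_\lambda\beta_{X^+}$; $E_k(X,\lambda)\asymp \dfrac{e^{\langle\lambda,X^+\rangle}}{(1+\alpha_\lambda\alpha_{X^+})^{k+1}(1+\beta_\lambda\beta_{X^+})^{k}(1+\gamma_\lambda\gamma_{X^+})^{k+1}}$ if $\beta_\lambda\ge\alpha_\lambda$ and $\alpha_\lambda\alpha_{X^+}\le\beta_\lambda\beta_{X^+}$.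 (v) If $x_3\ge x_2\ge x_1$: $E_k(X,\lambda)\asymp \dfrac{e^{\langle\lambda,X^+\rangle}}{(1+\alpha_\lambda\alpha_{X^+})^{k}(1+\beta_\lambda\beta_{X^+})^{k}(1+\gamma_\lambda\gamma_{X^+})^{k+1}}$.
   Context: $\mathfrak a=\{X=(x_1,x_2,x_3)\in\mathbb R^3: x_1+x_2+x_3=0\}$ with the standard inner product $\langle\cdot,\cdot\rangle$; root system $A_2$ with positive roots $\alpha=e_1-e_2$, $\beta=e_2-e_3$, $\gamma=\alpha+\beta=e_1-e_3$, Weyl group $S_3$ acting by permuting coordinates, $\sigma_\alpha$ the reflection in $\alpha$; $C^+=\{X\in\mathfrak a: x_1>x_2>x_3\}$. For constant multiplicity $k>0$, the Dunkl operators are $T_\xi f(X)=\partial_\xi f(X)+\sum_{\alpha>0}k\langle\alpha,\xi\rangle\frac{f(X)-f(\sigma_\alpha X)}{\langle\alpha,X\rangle}$, and the Dunkl kernel $E_k(X,Y)$ is the unique real-analytic solution in $X$ of $T_\xi E_k(\cdot,Y)=\langle\xi,Y\rangle E_k(\cdot,Y)$ ($\xi\in\mathfrak a$) with $E_k(0,Y)=1$. For $Z=(z_1,z_2,z_3)$ write $\alpha_Z=z_1-z_2$, $\beta_Z=z_2-z_3$, $\gamma_Z=z_1-z_3$. $X^+$ denotes the rearrangement of the entries of $X$ in decreasing order. $f\asymp g$ means $C^{-1}g\le f\le Cg$ for some constant $C>0$ uniform over the indicated domain. *)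

theory Defs
  imports "HOL-Analysis.Analysis"
begin

definition aa :: "(real^3) set" where
  "aa = {X. X$1 + X$2 + X$3 = 0}"

definition root_alpha :: "real^3" where "root_alpha = vector [1, -1, 0]"
definition root_beta  :: "real^3" where "root_beta  = vector [0, 1, -1]"
definition root_gamma :: "real^3" where "root_gamma = vector [1, 0, -1]"

definition posroots :: "(real^3) set" where
  "posroots = {root_alpha, root_beta, root_gamma}"

definition refl_root :: "real^3 \<Rightarrow> real^3 \<Rightarrow> real^3" where
  "refl_root a X = X - (2 * (a \<bullet> X) / (a \<bullet> a)) *\<^sub>R a"

definition dunkl_op :: "real \<Rightarrow> real^3 \<Rightarrow> (real^3 \<Rightarrow> real) \<Rightarrow> real^3 \<Rightarrow> real" where
  "dunkl_op k \<xi> f X = deriv (\<lambda>t. f (X + t *\<^sub>R \<xi>)) 0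
     + (\<Sum>a\<in>posroots. k * (a \<bullet> \<xi>) * (f X - f (refl_root a X)) / (a \<bullet> X))"

definition real_analytic_aa :: "(real^3 \<Rightarrow> real) \<Rightarrow> bool" where
  "real_analytic_aa f \<longleftrightarrow> (\<forall>P\<in>aa. \<exists>r>0. \<exists>c :: nat \<Rightarrow> nat \<Rightarrow> real.
      \<forall>s t. \<bar>s\<bar> < r \<and> \<bar>t\<bar> < r \<longrightarrow>
        ((\<lambda>(i,j). c i j * s ^ i * t ^ j) has_sum
           f (P + s *\<^sub>R root_alpha + t *\<^sub>R root_beta)) UNIV)"

text \<open>f is the Dunkl kernel E_k(., Y), as a function on a (extended by 0 off a).
  The eigen-equation is imposed on the regular points of a; by analyticity it then
  extends to all of a by continuity.\<close>
definition is_dunkl_kernel :: "real \<Rightarrow> real^3 \<Rightarrow> (real^3 \<Rightarrow> real) \<Rightarrow> bool" where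
  "is_dunkl_kernel k Y f \<longleftrightarrow>
     real_analytic_aa f \<and> (\<forall>X. X \<notin> aa \<longrightarrow> f X = 0) \<and> f 0 = 1 \<and>
     (\<forall>\<xi>\<in>aa. \<forall>X\<in>aa. (\<forall>a\<in>posroots. a \<bullet> X \<noteq> 0) \<longrightarrow>
        dunkl_op k \<xi> f X = (\<xi> \<bullet> Y) * f X)"

definition dunkl_kernel :: "real \<Rightarrow> real^3 \<Rightarrow> real^3 \<Rightarrow> real" where
  "dunkl_kernel k X Y = (THE f. is_dunkl_kernel k Y f) X"

definition Cplus :: "(real^3) set" where
  "Cplus = {X \<in> aa. X$1 > X$2 \<and> X$2 > X$3}"

definition alph :: "real^3 \<Rightarrow> real" where "alph Z = Z$1 - Z$2"
definition bet  :: "real^3 \<Rightarrow> real" where "bet Z = Z$2 - Z$3"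
definition gam  :: "real^3 \<Rightarrow> real" where "gam Z = Z$1 - Z$3"

definition xplus :: "real^3 \<Rightarrow> real^3" where
  "xplus X = (let M = max (X$1) (max (X$2) (X$3)); m = min (X$1) (min (X$2) (X$3))
              in vector [M, X$1 + X$2 + X$3 - M - m, m])"

definition bnd :: "real \<Rightarrow> real \<Rightarrow> real \<Rightarrow> real^3 \<Rightarrow> real^3 \<Rightarrow> real" where
  "bnd p q r l Z = exp (l \<bullet> Z) /
     ((1 + alph l * alph Z) powr p * (1 + bet l * bet Z) powr q * (1 + gam l * gam Z) powr r)"

definition asymp_on :: "('a \<Rightarrow> bool) \<Rightarrow> ('a \<Rightarrow> real) \<Rightarrow> ('a \<Rightarrow> real) \<Rightarrow> bool" where
  "asymp_on S f g \<longleftrightarrow> (\<exists>C>0. \<forall>x. S x \<longrightarrow> g x / C \<le> f x \<and> f x \<le> C * g x)"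

end

theory Submission
  imports Defs
begin

text \<open>For X in the closed chamber put psi_w(t) = exp(- t <X, l>) E(t w X, l). Along the ray the
  eigen-equations become a linear system in t d/dt on the Weyl group: the component at w decays
  with rate t <X, l - w^{-1} l> and exchanges mass with each of its three neighbours at rate k.
  With A = alph l * alph X, B = bet l * bet X, P = alph l * bet X, Q = bet l * alph X, the decay rates
  are 0 for the identity; A, B and A + B + P + Q for the reflections; A + B + P and A + B + Q for the
  rotations. The system is cooperative, so barrier arguments bound all components by the
  identity component e: a reflection with rate L is comparable to e / (1 + L t), and a rotation with
  rate R to e (1 / (1 + A t) + 1 / (1 + B t) + 1 / (1 + C t)) / (1 + R t). The size of e itself
  follows by integrating its equation once e - psi_w = O(sqrt (L t)) e is known for small L t,
  because the remaining error is then integrable with respect to dt / t, uniformly in all parameters.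

  The kernel is the sum of homogeneous polynomials E_n determined by the Euler
  equation (n + 3 k - k N) E_n = <X, Y> E_{n-1}, where N is the sum of the three reflections.
  Differentiating this recursion shows that grad E_n and the gradient prescribed by the
  eigen-equation satisfy the same nonsingular linear system, hence agree.\<close>

section \<open>Barrier principles\<close>

text \<open>The obstacle is uniformity. The rates range over all nonnegative values, walls included,
  and P may be arbitrarily large compared with A and B, so no expansion at small or large t covers
  every regime. Moreover the system is singular at t = 0, where Lipschitz arguments fail. Sign
  arguments at a minimum survive both, since they rest only on the exchange rates being nonnegative.
  They give positivity, all ratio bounds and the uniqueness of the kernel, on which the definite
  description in \<open>dunkl_kernel\<close> depends. The square root serves two ends. The forcing
  terms have the form N t y with y at most of order e / (1 + N t), or contain the mixed rate Q,
  bounded by a geometric mean; a square root accommodates both. And sqrt (N t) / (1 + N t) is twice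
  the t d/dt derivative of arctan (sqrt (N t)), which is bounded independently of N. The case
  distinction of the theorem is absent from the analysis: the rotations obey one estimate, and the
  cases only record which of its terms dominate.\<close>

definition euler_deriv :: "(real \<Rightarrow> real) \<Rightarrow> real \<Rightarrow> real \<Rightarrow> bool" where
  "euler_deriv f D t \<longleftrightarrow> t > 0 \<and> (f has_real_derivative D / t) (at t)"

section \<open>Calculus of the operator t d/dt\<close>

lemma euler_deriv_cong: "euler_deriv f D t \<Longrightarrow> D = D' \<Longrightarrow> euler_deriv f D' t"
  by simp

lemma euler_deriv_const: "t > 0 \<Longrightarrow> euler_deriv (\<lambda>t. c) 0 t"
  by (simp add: euler_deriv_def)

lemma euler_deriv_cmult: "euler_deriv f D t \<Longrightarrow> euler_deriv (\<lambda>t. c * f t) (c * D) t"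
  unfolding euler_deriv_def by (auto intro!: derivative_eq_intros)

lemma euler_deriv_add:
  "euler_deriv f D t \<Longrightarrow> euler_deriv g D' t \<Longrightarrow> euler_deriv (\<lambda>t. f t + g t) (D + D') t"
  unfolding euler_deriv_def by (auto intro!: derivative_eq_intros simp: add_divide_distrib)

lemma euler_deriv_diff:
  "euler_deriv f D t \<Longrightarrow> euler_deriv g D' t \<Longrightarrow> euler_deriv (\<lambda>t. f t - g t) (D - D') t"
  unfolding euler_deriv_def by (auto intro!: derivative_eq_intros simp: diff_divide_distrib)

lemma euler_deriv_mult:
  "euler_deriv f D t \<Longrightarrow> euler_deriv g D' t \<Longrightarrow> euler_deriv (\<lambda>t. f t * g t) (D * g t + D' * f t) t"
  unfolding euler_deriv_def by (auto intro!: derivative_eq_intros simp: field_simps)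

lemma euler_deriv_affine: "t > 0 \<Longrightarrow> euler_deriv (\<lambda>t. 1 + L * t) (L * t) t"
  unfolding euler_deriv_def by (auto intro!: derivative_eq_intros)

lemma euler_deriv_exp: "t > 0 \<Longrightarrow> euler_deriv (\<lambda>t. exp (- (c * t))) (- c * t * exp (- (c * t))) t"
  unfolding euler_deriv_def by (auto intro!: derivative_eq_intros)

lemma euler_deriv_sqrt: "t > 0 \<Longrightarrow> N \<ge> 0 \<Longrightarrow> euler_deriv (\<lambda>t. sqrt (N * t)) (sqrt (N * t) / 2) t"
  unfolding euler_deriv_def real_sqrt_mult
  by (auto intro!: derivative_eq_intros simp: field_simps)

lemma euler_deriv_recip:
  assumes "t > 0" "L \<ge> 0"
  shows "euler_deriv (\<lambda>t. 1 / (1 + L * t)) (- (L * t) / (1 + L * t)\<^sup>2) t"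
proof -
  have "1 + L * t > 0" using assms by (simp add: add_pos_nonneg)
  then have "((\<lambda>t. 1 / (1 + L * t)) has_real_derivative - L / (1 + L * t)\<^sup>2) (at t)"
    by (auto intro!: derivative_eq_intros simp: power2_eq_square)
  moreover have "- (L * t) / (1 + L * t)\<^sup>2 / t = - L / (1 + L * t)\<^sup>2"
    using assms by simp
  ultimately show ?thesis
    using assms unfolding euler_deriv_def by simp
qed

lemma euler_deriv_ln:
  assumes "euler_deriv f D t" "f t > 0"
  shows "euler_deriv (\<lambda>t. ln (f t)) (D / f t) t"
  using assms unfolding euler_deriv_def by (auto intro!: derivative_eq_intros)

text \<open>The primitive that makes the final error integrable: it stays below pi / 2 whatever N
  is.\<close>

lemma euler_deriv_arctan_sqrt:
  assumes "t > 0" "N \<ge> 0"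
  shows "euler_deriv (\<lambda>t. arctan (sqrt (N * t))) (sqrt (N * t) / (2 * (1 + N * t))) t"
proof -
  have "((\<lambda>t. sqrt (N * t)) has_real_derivative (sqrt (N * t) / 2) / t) (at t)"
    using euler_deriv_sqrt[OF assms] by (simp add: euler_deriv_def)
  from DERIV_chain2[OF DERIV_arctan this]
  show ?thesis using assms unfolding euler_deriv_def by (simp add: field_simps)
qed

lemma euler_deriv_powr:
  assumes "t > 0"
  shows "euler_deriv (\<lambda>t. t powr c) (c * t powr c) t"
  using assms unfolding euler_deriv_def
  by (auto intro!: derivative_eq_intros simp: powr_diff)

text \<open>After the last point where g is nonnegative, g would be negative and nondecreasing, so
  it cannot end below zero. The derivative is examined only where the inequality already fails, so
  the failure itself is available for estimating it.\<close>

lemma barrier: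
  fixes g :: "real \<Rightarrow> real"
  assumes ab: "0 \<le> a" "a \<le> b" and cont: "continuous_on {a..b} g" and ga: "g a \<ge> 0"
    and der: "\<And>t. a < t \<Longrightarrow> t < b \<Longrightarrow> g t < 0 \<Longrightarrow> \<exists>D\<ge>0. euler_deriv g D t"
  shows "g b \<ge> 0"
proof (rule ccontr)
  assume neg: "\<not> g b \<ge> 0"
  let ?S = "{t\<in>{a..b}. 0 \<le> g t}"
  have "closed ?S" using cont by (intro continuous_on_closed_Collect_le) auto
  moreover have "bounded ?S" by (rule bounded_subset[of "{a..b}"]) auto
  moreover have "?S \<noteq> {}" using ab ga by auto
  ultimately obtain c where c: "c \<in> ?S" "\<And>t. t \<in> ?S \<Longrightarrow> t \<le> c"
    using compact_attains_sup[of ?S] compact_eq_bounded_closed by blast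
  have "g c \<le> g b"
  proof (rule DERIV_nonneg_imp_increasing_open[where f = g])
    show "c \<le> b" using c by auto
    show "continuous_on {c..b} g" using c by (intro continuous_on_subset[OF cont]) auto
    fix t assume t: "c < t" "t < b"
    have "g t < 0" using c(2)[of t] t c(1) by force
    then obtain D where "D \<ge> 0" "euler_deriv g D t" using der t c(1) by force
    then show "\<exists>y. (g has_real_derivative y) (at t) \<and> 0 \<le> y"
      unfolding euler_deriv_def by (intro exI[of _ "D / t"]) auto
  qed
  then show False using c(1) neg by auto
qed

text \<open>At a joint minimum over the family and the interval the derivative cannot be positive,
  because earlier values would be smaller. Since the derivative is known only at that one point,
  \<open>D\<close> has to be strictly positive; in exchange the minimal component may be compared
  there with all the others.\<close>

lemma finite_barrier:
  fixes I :: "(real \<Rightarrow> real) set"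
  assumes fin: "finite I"
    and cont: "\<And>u. u \<in> I \<Longrightarrow> continuous_on {0..T} u" and init: "\<And>u. u \<in> I \<Longrightarrow> u 0 \<ge> 0"
    and der: "\<And>u t. u \<in> I \<Longrightarrow> 0 < t \<Longrightarrow> t \<le> T \<Longrightarrow> u t < 0 \<Longrightarrow> (\<And>v. v \<in> I \<Longrightarrow> u t \<le> v t)
      \<Longrightarrow> \<exists>D>0. euler_deriv u D t"
    and u: "u \<in> I" and t: "0 \<le> t" "t \<le> T"
  shows "u t \<ge> 0"
proof -
  have "\<exists>s. 0 \<le> s \<and> s \<le> T \<and> (\<forall>r. 0 \<le> r \<and> r \<le> T \<longrightarrow> v s \<le> v r)" if "v \<in> I" for v
    using continuous_attains_inf[OF _ _ cont[OF that]] t by fastforce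
  then obtain s where s: "\<And>v. v \<in> I \<Longrightarrow> 0 \<le> s v \<and> s v \<le> T \<and> (\<forall>r. 0 \<le> r \<and> r \<le> T \<longrightarrow> v (s v) \<le> v r)"
    by metis
  define v where "v = arg_min_on (\<lambda>v. v (s v)) I"
  have v: "v \<in> I" "\<And>w. w \<in> I \<Longrightarrow> v (s v) \<le> w (s w)"
    using arg_min_if_finite[OF fin, of "\<lambda>v. v (s v)"] u unfolding v_def
    by (auto simp: not_less)
  have "v (s v) \<ge> 0"
  proof (rule ccontr)
    assume neg: "\<not> v (s v) \<ge> 0"
    have sv: "0 < s v" "s v \<le> T" using s[OF v(1)] init[OF v(1)] neg by (auto simp: order_le_less)
    have "v (s v) \<le> w (s v)" if "w \<in> I" for w
      by (rule order_trans[OF v(2)[OF that]]) (use s[OF that] sv in auto)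
    then obtain D where D: "D > 0" "euler_deriv v D (s v)"
      using der[OF v(1) sv] neg by auto
    then have "(v has_real_derivative D / s v) (at (s v))" "D / s v > 0"
      unfolding euler_deriv_def by auto
    from DERIV_pos_inc_left[OF this] obtain d where
      d: "d > 0" "\<And>h. h > 0 \<Longrightarrow> h < d \<Longrightarrow> v (s v - h) < v (s v)" by blast
    define h where "h = min (d / 2) (s v)"
    have "v (s v - h) < v (s v)" using d sv by (intro d(2)) (auto simp: h_def)
    moreover have "v (s v) \<le> v (s v - h)" using s[OF v(1)] sv d(1) by (auto simp: h_def)
    ultimately show False by simp
  qed
  then show ?thesis using v(2)[OF u] s[OF u] t by force
qed

section \<open>The system along a ray\<close>

text \<open>The value 3 * 2 + 9 * k * 6 produced by \<open>upper_aux\<close> when a component is at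
  most 2 e and its three inflows add up to at most 6 k e.\<close>

definition ratio_const :: "real \<Rightarrow> real" where
  "ratio_const k = 6 + 54 * k"

text \<open>Assembled in \<open>dev_aux\<close>. With c for \<open>ratio_const k\<close>, the first
  summand covers the times at which \<open>s_small\<close> applies and the second the remaining
  ones, where sqrt (N t) exceeds the reciprocal of 8 c (1 + 8 k).\<close>

definition dev_const :: "real \<Rightarrow> real" where
  "dev_const k = 2 * (8 * ratio_const k + 1)
     + (ratio_const k + 1) * (8 * ratio_const k * (1 + 8 * k))"

text \<open>e is the identity component, sa, sb, sg are the reflections and r1, r2 the rotations. The two
  rotations are ordered so that Q <= P; with P * Q = A * B this gives Q <= sqrt (A * B).\<close>

locale dunkl_ray =
  fixes k A B P Q :: real and e sa sb sg r1 r2 :: "real \<Rightarrow> real"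
  assumes k: "k > 0" and A: "A \<ge> 0" and B: "B \<ge> 0" and Q: "Q \<ge> 0" and QP: "Q \<le> P"
    and PQ: "P * Q = A * B"
    and init: "e 0 = 1" "sa 0 = 1" "sb 0 = 1" "sg 0 = 1" "r1 0 = 1" "r2 0 = 1"
    and cont: "continuous_on UNIV e" "continuous_on UNIV sa" "continuous_on UNIV sb"
      "continuous_on UNIV sg" "continuous_on UNIV r1" "continuous_on UNIV r2"
    and de: "\<And>t. t > 0 \<Longrightarrow> euler_deriv e (k * (sa t + sb t + sg t) - 3 * k * e t) t"
    and dsa: "\<And>t. t > 0 \<Longrightarrow> euler_deriv sa (k * (e t + r1 t + r2 t) - (3 * k + A * t) * sa t) t"
    and dsb: "\<And>t. t > 0 \<Longrightarrow> euler_deriv sb (k * (e t + r1 t + r2 t) - (3 * k + B * t) * sb t) t"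
    and dsg: "\<And>t. t > 0 \<Longrightarrow>
      euler_deriv sg (k * (e t + r1 t + r2 t) - (3 * k + (A + B + P + Q) * t) * sg t) t"
    and dr1: "\<And>t. t > 0 \<Longrightarrow>
      euler_deriv r1 (k * (sa t + sb t + sg t) - (3 * k + (A + B + P) * t) * r1 t) t"
    and dr2: "\<And>t. t > 0 \<Longrightarrow>
      euler_deriv r2 (k * (sa t + sb t + sg t) - (3 * k + (A + B + Q) * t) * r2 t) t"
begin

section \<open>Positivity and crude comparison with the identity component\<close>

lemma P: "P \<ge> 0" using Q QP by simp

lemma continuous_on_funs [continuous_intros]:
  "continuous_on S e" "continuous_on S sa" "continuous_on S sb"
  "continuous_on S sg" "continuous_on S r1" "continuous_on S r2"
  using cont continuous_on_subset by blast+

text \<open>At the least of the six values the exchange terms are nonnegative, and the decay of a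
  negative value pushes it up. This yields only a weak inequality; the factor exp (- t) supplies the
  strictness that \<open>finite_barrier\<close> asks for.\<close>

lemma nonneg_aux:
  assumes f: "f \<in> {e, sa, sb, sg, r1, r2}" and t: "t \<ge> 0"
  shows "f t \<ge> 0"
proof -
  let ?S = "{e, sa, sb, sg, r1, r2}"
  have "(\<lambda>t. exp (- (1 * t)) * f t) t \<ge> 0"
  proof (rule finite_barrier[where I = "(\<lambda>f t. exp (- (1 * t)) * f t) ` ?S" and T = t and u = "\<lambda>t. exp (- (1 * t)) * f t"])
    show "finite ((\<lambda>f t. exp (- (1 * t)) * f t) ` ?S)" by simp
    show "(\<lambda>t. exp (- (1 * t)) * f t) \<in> (\<lambda>f t. exp (- (1 * t)) * f t) ` ?S" using f by blast
    show "continuous_on {0..t} u" if "u \<in> (\<lambda>f t. exp (- (1 * t)) * f t) ` ?S" for u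
      using that by (auto intro!: continuous_intros)
    show "u 0 \<ge> 0" if "u \<in> (\<lambda>f t. exp (- (1 * t)) * f t) ` ?S" for u
      using that init by auto
    fix u s assume u: "u \<in> (\<lambda>f t. exp (- (1 * t)) * f t) ` ?S" and s: "0 < s" and neg: "u s < 0"
      and le: "\<And>v. v \<in> (\<lambda>f t. exp (- (1 * t)) * f t) ` ?S \<Longrightarrow> u s \<le> v s"
    from u obtain f where f: "f \<in> ?S" "u = (\<lambda>t. exp (- (1 * t)) * f t)" by auto
    have fneg: "f s < 0" using neg f(2) by (simp add: mult_less_0_iff)
    have fle: "f s \<le> g s" if "g \<in> ?S" for g
      using le[of "\<lambda>t. exp (- (1 * t)) * g t"] that f(2) by auto
    have key: "k * (g1 + g2 + g3) - (3 * k + L * s) * f s \<ge> 0"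
      if "f s \<le> g1" "f s \<le> g2" "f s \<le> g3" "L \<ge> 0" for g1 g2 g3 L
    proof -
      have "k * (3 * f s) \<le> k * (g1 + g2 + g3)" using that k by (intro mult_left_mono) auto
      moreover have "L * s * f s \<le> 0" using that s fneg by (intro mult_nonneg_nonpos) auto
      ultimately show ?thesis by (simp add: algebra_simps)
    qed
    have fle': "f s \<le> e s" "f s \<le> sa s" "f s \<le> sb s" "f s \<le> sg s" "f s \<le> r1 s" "f s \<le> r2 s"
      by (rule fle, simp)+
    have witness: "0 \<le> D \<Longrightarrow> euler_deriv g D s \<Longrightarrow> \<exists>D\<ge>0. euler_deriv g D s" for g D by blast
    have "\<exists>D\<ge>0. euler_deriv f D s"
    proof -
      consider "f = e" | "f = sa" | "f = sb" | "f = sg" | "f = r1" | "f = r2" using f(1) by auto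
      then show ?thesis
      proof cases
        case 1
        show ?thesis
          unfolding 1 by (rule witness[OF _ de[OF s]])
            (use key[of "sa s" "sb s" "sg s" 0] fle' in \<open>simp add: 1\<close>)
      next
        case 2
        show ?thesis
          unfolding 2 by (rule witness[OF _ dsa[OF s]])
            (use key[of "e s" "r1 s" "r2 s" A] fle' A in \<open>simp add: 2\<close>)
      next
        case 3
        show ?thesis
          unfolding 3 by (rule witness[OF _ dsb[OF s]])
            (use key[of "e s" "r1 s" "r2 s" B] fle' B in \<open>simp add: 3\<close>)
      next
        case 4
        show ?thesis
          unfolding 4 by (rule witness[OF _ dsg[OF s]])
            (use key[of "e s" "r1 s" "r2 s" "A+B+P+Q"] fle' A B P Q in \<open>simp add: 4\<close>)
      next
        case 5
        show ?thesis
          unfolding 5 by (rule witness[OF _ dr1[OF s]])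
            (use key[of "sa s" "sb s" "sg s" "A+B+P"] fle' A B P in \<open>simp add: 5\<close>)
      next
        case 6
        show ?thesis
          unfolding 6 by (rule witness[OF _ dr2[OF s]])
            (use key[of "sa s" "sb s" "sg s" "A+B+Q"] fle' A B Q in \<open>simp add: 6\<close>)
      qed
    qed
    then obtain D where D: "D \<ge> 0" "euler_deriv f D s" by blast
    have "euler_deriv u (- 1 * s * exp (- (1 * s)) * f s + D * exp (- (1 * s))) s"
      unfolding f(2) by (rule euler_deriv_mult[OF euler_deriv_exp[OF s] D(2)])
    moreover have "- 1 * s * exp (- (1 * s)) * f s + D * exp (- (1 * s)) > 0"
    proof -
      have "s * f s < 0" using s fneg by (simp add: mult_pos_neg)
      then show ?thesis using D(1) by simp
    qed
    ultimately show "\<exists>D>0. euler_deriv u D s" by blast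
  qed (use t in auto)
  then show ?thesis by (simp add: zero_le_mult_iff)
qed

lemma nonneg:
  assumes "t \<ge> 0"
  shows "e t \<ge> 0" "sa t \<ge> 0" "sb t \<ge> 0" "sg t \<ge> 0" "r1 t \<ge> 0" "r2 t \<ge> 0"
  using nonneg_aux[OF _ assms] by auto

text \<open>The integrating factor t powr (3 * k) removes the loss term and leaves a nonnegative
  derivative, so positivity propagates forward. The factor vanishes at 0, hence the start at a small
  positive time, where continuity gives e > 0.\<close>

lemma e_pos:
  assumes "t \<ge> 0"
  shows "e t > 0"
proof (cases "t = 0")
  case False
  have "isCont e 0" using cont(1) continuous_on_eq_continuous_at by blast
  then have "e \<midarrow>0\<rightarrow> 1" using init(1) by (simp add: isCont_def)
  from LIM_D[OF this, of 1] obtain d where d: "d > 0"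
    "\<And>x. x \<noteq> 0 \<Longrightarrow> norm (x - 0) < d \<Longrightarrow> norm (e x - 1) < 1" by auto
  define s where "s = min (d / 2) (t / 2)"
  have s0: "0 < s" "s < t" "s < d" using d(1) False assms by (auto simp: s_def)
  then have "\<bar>e s - 1\<bar> < 1" using d(2)[of s] by simp
  then have s: "0 < s" "s < t" "e s > 0" using s0 by auto
  have "s powr (3 * k) * e s \<le> t powr (3 * k) * e t"
  proof (rule DERIV_nonneg_imp_nondecreasing[where f = "\<lambda>t. t powr (3 * k) * e t"])
    fix x assume x: "s \<le> x" "x \<le> t"
    then have x0: "x > 0" using s by auto
    have "3 * k * x powr (3 * k) * e x + (k * (sa x + sb x + sg x) - 3 * k * e x) * x powr (3 * k)
       = k * (sa x + sb x + sg x) * x powr (3 * k)" by (simp add: algebra_simps)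
    also have "\<dots> \<ge> 0" using nonneg[of x] x0 k by auto
    finally show "\<exists>y. ((\<lambda>t. t powr (3 * k) * e t) has_real_derivative y) (at x) \<and> 0 \<le> y"
      using euler_deriv_mult[OF euler_deriv_powr[OF x0, of "3*k"] de[OF x0]] x0
      unfolding euler_deriv_def by (meson divide_nonneg_pos)
  qed (use s in auto)
  moreover have "s powr (3 * k) * e s > 0" using s by simp
  ultimately have "t powr (3 * k) * e t > 0" by linarith
  then show ?thesis by (simp add: zero_less_mult_iff)
qed (simp add: init)

text \<open>Both functions receive the same inflow, so only the losses differ: where r exceeds e, it
  also loses more.\<close>

lemma r_le_aux:
  assumes t: "t \<ge> 0" and L: "L \<ge> 0" and r: "\<And>t. t \<ge> 0 \<Longrightarrow> r t \<ge> 0" "r 0 = 1" "continuous_on UNIV r"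
    and dr: "\<And>t. t > 0 \<Longrightarrow> euler_deriv r (k * (sa t + sb t + sg t) - (3 * k + L * t) * r t) t"
  shows "r t \<le> e t"
proof -
  have "e t - r t \<ge> 0"
  proof (rule barrier[where g = "\<lambda>t. e t - r t"])
    fix s assume s: "0 < s" "e s - r s < 0"
    have "k * (sa s + sb s + sg s) - 3 * k * e s - (k * (sa s + sb s + sg s) - (3 * k + L * s) * r s)
      = 3 * k * (r s - e s) + L * s * r s" by (simp add: algebra_simps)
    also have "\<dots> \<ge> 0" using s L k r(1)[of s] by auto
    finally show "\<exists>D\<ge>0. euler_deriv (\<lambda>t. e t - r t) D s"
      using euler_deriv_diff[OF de[OF s(1)] dr[OF s(1)]] by blast
  next
    show "continuous_on {0..t} (\<lambda>t. e t - r t)"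
      by (intro continuous_intros continuous_on_subset[OF r(3)]) auto
  qed (use t r init in auto)
  then show ?thesis by simp
qed

lemma r_le:
  assumes "t \<ge> 0"
  shows "r1 t \<le> e t" "r2 t \<le> e t"
  using r_le_aux[OF assms _ nonneg(5) init(5) cont(5) dr1] A B P
    r_le_aux[OF assms _ nonneg(6) init(6) cont(6) dr2] Q by auto

text \<open>The odd components do not share the inflow of e. The argument closes because s itself
  feeds e, while the inflow of s is at most 3 k e by \<open>r_le\<close>. This makes c e - s a
  barrier as soon as c^2 >= 3, and 2 is a convenient value.\<close>

lemma s_le_aux:
  assumes t: "t \<ge> 0" and L: "L \<ge> 0" and s: "\<And>t. t \<ge> 0 \<Longrightarrow> s t \<ge> 0" "s 0 = 1" "continuous_on UNIV s"
    and sle: "\<And>t. t \<ge> 0 \<Longrightarrow> s t \<le> sa t + sb t + sg t"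
    and ds: "\<And>t. t > 0 \<Longrightarrow> euler_deriv s (k * (e t + r1 t + r2 t) - (3 * k + L * t) * s t) t"
  shows "s t \<le> 2 * e t"
proof -
  have "2 * e t - s t \<ge> 0"
  proof (rule barrier[where g = "\<lambda>t. 2 * e t - s t"])
    fix x assume x: "0 < x" "2 * e x - s x < 0"
    have 1: "k * s x \<le> k * (sa x + sb x + sg x)" using sle[of x] x k by (intro mult_left_mono) auto
    have 2: "k * (e x + r1 x + r2 x) \<le> k * (3 * e x)" using r_le[of x] x k by (intro mult_left_mono) auto
    have 3: "L * x * s x \<ge> 0" using x L s(1)[of x] by auto
    have 4: "k * (s x - 2 * e x) \<ge> 0" using x k by auto
    have 5: "k * e x \<ge> 0" using k nonneg[of x] x by auto
    have "2 * (k * (sa x + sb x + sg x) - 3 * k * e x)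
        - (k * (e x + r1 x + r2 x) - (3 * k + L * x) * s x) \<ge>
        2 * (k * s x) - 6 * k * e x - 3 * k * e x + 3 * k * s x"
      using 1 2 3 by (simp add: algebra_simps)
    moreover have "2 * (k * s x) - 6 * k * e x - 3 * k * e x + 3 * k * s x \<ge> 0"
      using 4 5 by (simp add: algebra_simps)
    ultimately have "2 * (k * (sa x + sb x + sg x) - 3 * k * e x)
        - (k * (e x + r1 x + r2 x) - (3 * k + L * x) * s x) \<ge> 0" by linarith
    then show "\<exists>D\<ge>0. euler_deriv (\<lambda>t. 2 * e t - s t) D x"
      using euler_deriv_diff[OF euler_deriv_cmult[OF de[OF x(1)]] ds[OF x(1)]] by blast
  next
    show "continuous_on {0..t} (\<lambda>t. 2 * e t - s t)"
      by (intro continuous_intros continuous_on_subset[OF s(3)]) auto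
  qed (use t s init in auto)
  then show ?thesis by simp
qed

lemma s_le:
  assumes "t \<ge> 0"
  shows "sa t \<le> 2 * e t" "sb t \<le> 2 * e t" "sg t \<le> 2 * e t"
  using s_le_aux[OF assms A nonneg(2) init(2) cont(2) _ dsa]
    s_le_aux[OF assms B nonneg(3) init(3) cont(3) _ dsb]
    s_le_aux[OF assms _ nonneg(4) init(4) cont(4) _ dsg] nonneg A B P Q by auto

text \<open>The product e m measures the inflow, and y should relax to inflow / (1 + L t). The loss
  3 k is common to y and e and cancels; beyond it, e m falls at relative rate at most 1 by the bound
  on \<open>M\<close>, so the decay of y wins once L t is large. Up to L t = 2 the hypothesis
  \<open>small\<close> suffices.\<close>

lemma upper_aux:
  assumes t: "t \<ge> 0" and L: "L \<ge> 0" and K: "K0 \<ge> 0" "K1 \<ge> 0"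
    and y: "\<And>t. t \<ge> 0 \<Longrightarrow> y t \<ge> 0" "continuous_on UNIV y"
    and m: "continuous_on {0..} m" "\<And>t. t \<ge> 0 \<Longrightarrow> m t > 0"
    and dm: "\<And>t. t > 0 \<Longrightarrow> \<exists>M. - m t \<le> M \<and> euler_deriv m M t"
    and dy: "\<And>t. t > 0 \<Longrightarrow> euler_deriv y (src t - (3 * k + L * t) * y t) t"
    and src: "\<And>t. t > 0 \<Longrightarrow> src t \<le> K0 * k * e t * m t"
    and small: "\<And>t. t \<ge> 0 \<Longrightarrow> L * t \<le> 2 \<Longrightarrow> y t \<le> K1 * e t * m t"
  shows "(1 + L * t) * y t \<le> (3 * K1 + 9 * k * K0) * e t * m t"
proof -
  define K where "K = 3 * K1 + 9 * k * K0"
  have K1: "3 * K1 \<le> K" "9 * k * K0 \<le> K" "K \<ge> 0" using K k by (auto simp: K_def)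
  have em: "e s * m s > 0" if "s \<ge> 0" for s using e_pos m(2) that by simp
  have base: "(1 + L * s) * y s \<le> K * e s * m s" if s: "s \<ge> 0" "L * s \<le> 2" for s
  proof -
    have "(1 + L * s) * y s \<le> 3 * y s" using s y(1)[of s] by (intro mult_right_mono) auto
    also have "\<dots> \<le> 3 * (K1 * e s * m s)" using small[OF s] by simp
    also have "\<dots> \<le> K * (e s * m s)"
      using mult_right_mono[OF K1(1), of "e s * m s"] em[OF s(1)] by (simp add: mult_ac)
    finally show ?thesis by (simp add: mult_ac)
  qed
  show ?thesis
  proof (cases "L * t \<le> 2")
    case False
    then have Lp: "L > 0" using L by (cases "L = 0") auto
    define a where "a = 2 / L"
    have a: "a > 0" "L * a = 2" "a \<le> t" using Lp False by (auto simp: a_def field_simps)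
    have "K * (e t * m t) - (1 + L * t) * y t \<ge> 0"
    proof (rule barrier[where g = "\<lambda>t. K * (e t * m t) - (1 + L * t) * y t" and a = a])
      show "continuous_on {a..t} (\<lambda>t. K * (e t * m t) - (1 + L * t) * y t)"
        using a by (intro continuous_intros continuous_on_subset[OF y(2)] continuous_on_subset[OF m(1)]) auto
      show "K * (e a * m a) - (1 + L * a) * y a \<ge> 0"
        using base[of a] a by (simp add: mult_ac)
      fix s assume s: "a < s" and neg: "K * (e s * m s) - (1 + L * s) * y s < 0"
      have s0: "s > 0" using s a by simp
      obtain M where M: "- m s \<le> M" "euler_deriv m M s" using dm[OF s0] by blast
      define T where "T = L * s"
      have T: "T \<ge> 2" using mult_strict_left_mono[OF s Lp] a(2) by (simp add: T_def)
      define W where "W = (1 + T) * y s"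
      have W: "K * (e s * m s) < W" using neg by (simp add: W_def T_def)
      let ?De = "k * (sa s + sb s + sg s) - 3 * k * e s"
      let ?D = "K * (?De * m s + M * e s) - (T * y s + (src s - (3 * k + T) * y s) * (1 + T))"
      have "euler_deriv (\<lambda>t. K * (e t * m t) - (1 + L * t) * y t) ?D s"
        using euler_deriv_diff[OF euler_deriv_cmult[OF euler_deriv_mult[OF de[OF s0] M(2)], of K]
            euler_deriv_mult[OF euler_deriv_affine[OF s0, of L] dy[OF s0]]]
        by (simp add: T_def)
      moreover have "?D \<ge> 0"
      proof -
        have ep: "e s > 0" "m s > 0" using e_pos m(2) s0 by auto
        have 1: "?De * m s + M * e s \<ge> - (3 * k + 1) * (e s * m s)"
        proof -
          have "?De \<ge> - 3 * k * e s" using nonneg[of s] s0 k by simp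
          then have "?De * m s \<ge> - 3 * k * e s * m s" using ep by (intro mult_right_mono) auto
          moreover have "M * e s \<ge> - m s * e s" using M(1) ep by (intro mult_right_mono) auto
          ultimately show ?thesis by (simp add: algebra_simps)
        qed
        have "K * (- (3 * k + 1) * (e s * m s)) \<le> K * (?De * m s + M * e s)"
          by (rule mult_left_mono[OF 1 K1(3)])
        moreover have "K * (- (3 * k + 1) * (e s * m s)) = - ((3 * k + 1) * (K * (e s * m s)))"
          by (simp add: algebra_simps)
        ultimately have "K * (?De * m s + M * e s) \<ge> - ((3 * k + 1) * (K * (e s * m s)))" by linarith
        moreover have "(3 * k + 1) * (K * (e s * m s)) \<le> (3 * k + 1) * W"
          using W k by (intro mult_left_mono) auto
        ultimately have 2: "K * (?De * m s + M * e s) \<ge> - ((3 * k + 1) * W)" by linarith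
        have "9 * src s \<le> 9 * k * K0 * (e s * m s)" using src[OF s0] by (simp add: mult_ac)
        also have "\<dots> \<le> K * (e s * m s)" using K1(2) ep by (intro mult_right_mono) auto
        finally have "src s \<le> W / 9" using W by simp
        then have 3: "src s * (1 + T) \<le> W / 9 * (1 + T)" using T by (intro mult_right_mono) auto
        have "?D \<ge> - ((3 * k + 1) * W) - T * y s - W / 9 * (1 + T) + (3 * k + T) * W"
        proof -
          have "T * y s + (src s - (3 * k + T) * y s) * (1 + T)
            = T * y s + src s * (1 + T) - (3 * k + T) * W" by (simp add: W_def algebra_simps)
          then show ?thesis using 2 3 by linarith
        qed
        \<comment> \<open>The cut at L t = 2 and the share W / 9 of the inflow are matched: the
          remainder has its positive root exactly at T = 2. The term 9 k K0 of the constant is what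
          makes the inflow that small.\<close>
        moreover have "- ((3 * k + 1) * W) - T * y s - W / 9 * (1 + T) + (3 * k + T) * W
          = y s * ((T - 2) * (8 * T + 5)) / 9"
          by (simp add: W_def algebra_simps power2_eq_square)
        moreover have "\<dots> \<ge> 0" using T y(1)[of s] s0 by (intro divide_nonneg_pos mult_nonneg_nonneg add_nonneg_nonneg) auto
        ultimately show ?thesis by linarith
      qed
      ultimately show "\<exists>D\<ge>0. euler_deriv (\<lambda>t. K * (e t * m t) - (1 + L * t) * y t) D s" by blast
    qed (use a in auto)
    then show ?thesis by (simp add: K_def mult_ac)
  qed (use base[OF t] K_def in simp)
qed

text \<open>Where the claim fails, y loses little, and e m grows at relative rate at most 3 k,
  because e receives at most 6 k e by \<open>s_le\<close> and m does not increase. The inflow wins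
  if 6 K <= K0 and K <= K0 k, and K = K0 k / (1 + 6 k) meets both conditions.\<close>

lemma lower_aux:
  assumes t: "t \<ge> 0" and L: "L \<ge> 0" and K0: "K0 > 0" "K0 * k / (1 + 6 * k) * m 0 \<le> 1"
    and y: "\<And>t. t \<ge> 0 \<Longrightarrow> y t \<ge> 0" "continuous_on UNIV y" "y 0 = 1"
    and m: "continuous_on {0..} m" "\<And>t. t \<ge> 0 \<Longrightarrow> m t > 0"
    and dm: "\<And>t. t > 0 \<Longrightarrow> \<exists>M. M \<le> 0 \<and> euler_deriv m M t"
    and dy: "\<And>t. t > 0 \<Longrightarrow> euler_deriv y (src t - (3 * k + L * t) * y t) t"
    and src: "\<And>t. t > 0 \<Longrightarrow> src t \<ge> K0 * k * e t * m t"
  shows "(1 + L * t) * y t \<ge> K0 * k / (1 + 6 * k) * e t * m t"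
proof -
  define K where "K = K0 * k / (1 + 6 * k)"
  have K: "K > 0" "K \<le> K0 * k" "K * 6 \<le> K0"
    using K0 k by (auto simp: K_def field_simps)
  have "(1 + L * t) * y t - K * (e t * m t) \<ge> 0"
  proof (rule barrier[where g = "\<lambda>t. (1 + L * t) * y t - K * (e t * m t)" and a = 0])
    show "continuous_on {0..t} (\<lambda>t. (1 + L * t) * y t - K * (e t * m t))"
      by (intro continuous_intros continuous_on_subset[OF y(2)] continuous_on_subset[OF m(1)]) auto
    show "(1 + L * 0) * y 0 - K * (e 0 * m 0) \<ge> 0" using K0(2) y(3) init by (simp add: K_def)
    fix s assume s0: "0 < s" and neg: "(1 + L * s) * y s - K * (e s * m s) < 0"
    obtain M where M: "M \<le> 0" "euler_deriv m M s" using dm[OF s0] by blast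
    define T where "T = L * s"
    have T: "T \<ge> 0" using s0 L by (simp add: T_def)
    let ?De = "k * (sa s + sb s + sg s) - 3 * k * e s"
    let ?D = "(T * y s + (src s - (3 * k + T) * y s) * (1 + T)) - K * (?De * m s + M * e s)"
    have "euler_deriv (\<lambda>t. (1 + L * t) * y t - K * (e t * m t)) ?D s"
      using euler_deriv_diff[OF euler_deriv_mult[OF euler_deriv_affine[OF s0, of L] dy[OF s0]]
         euler_deriv_cmult[OF euler_deriv_mult[OF de[OF s0] M(2)], of K]]
      by (simp add: T_def)
    moreover have "?D \<ge> 0"
    proof -
      have ep: "e s > 0" "m s > 0" using e_pos m(2) s0 by auto
      define W where "W = e s * m s"
      have W0: "W > 0" using ep by (simp add: W_def)
      have "k * (sa s + sb s + sg s) \<le> k * (6 * e s)"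
        using s_le[of s] s0 k by (intro mult_left_mono) auto
      then have "?De \<le> 3 * k * e s" by simp
      then have "?De * m s \<le> 3 * k * e s * m s" using ep by (intro mult_right_mono) auto
      moreover have "M * e s \<le> 0" using M(1) ep by (simp add: mult_nonpos_nonneg)
      ultimately have "?De * m s + M * e s \<le> 3 * k * W" by (simp add: W_def mult_ac)
      then have 1: "K * (?De * m s + M * e s) \<le> K * (3 * k * W)" using K by (intro mult_left_mono) auto
      have 2: "src s * (1 + T) \<ge> K0 * k * W * (1 + T)"
        using src[OF s0] T by (intro mult_right_mono) (auto simp: W_def mult_ac)
      have "(1 + T) * y s \<le> K * W" using neg by (simp add: T_def W_def)
      then have 3: "(3 * k + T) * ((1 + T) * y s) \<le> (3 * k + T) * (K * W)"
        using T k by (intro mult_left_mono) auto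
      have 4: "T * y s \<ge> 0" using T y(1)[of s] s0 by auto
      have "?D \<ge> K0 * k * W * (1 + T) - (3 * k + T) * (K * W) - K * (3 * k * W)"
        using 1 2 3 4 by (simp add: algebra_simps)
      also have "K0 * k * W * (1 + T) - (3 * k + T) * (K * W) - K * (3 * k * W)
         = W * (k * (K0 - K * 6) + T * (K0 * k - K))" by (simp add: algebra_simps)
      also have "\<dots> \<ge> 0" using W0 K T k by (intro mult_nonneg_nonneg add_nonneg_nonneg) auto
      finally show ?thesis .
    qed
    ultimately show "\<exists>D\<ge>0. euler_deriv (\<lambda>t. (1 + L * t) * y t - K * (e t * m t)) D s" by blast
  qed (use t in auto)
  then show ?thesis by (simp add: K_def mult_ac)
qed


text \<open>For small N t the six components fall into three pairs of nearly equal ones: p, q, v are the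
  differences within these pairs, and they satisfy a closed system with small sources.\<close>

lemma small_aux:
  assumes t: "t \<ge> 0" and N: "N \<ge> 0" and L: "L1 \<ge> 0" "L2 \<ge> 0" and K: "K > 0"
    and s: "\<And>t. t \<ge> 0 \<Longrightarrow> s t \<le> sa t + sb t + sg t" "\<And>t. p t = e t - s t"
    and cont': "continuous_on UNIV p" "continuous_on UNIV q" "continuous_on UNIV v"
    and init': "p 0 = 0" "q 0 = 0" "v 0 = 0"
    and dp: "\<And>t. t > 0 \<Longrightarrow> euler_deriv p (k * (q t + v t) - 4 * k * p t + g1 t) t"
    and dq: "\<And>t. t > 0 \<Longrightarrow> euler_deriv q (k * (p t - v t) - (4 * k + L1 * t) * q t + g2 t) t"
    and dv: "\<And>t. t > 0 \<Longrightarrow> euler_deriv v (k * (p t - q t) - (4 * k + L2 * t) * v t + g3 t) t"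
    and g: "\<And>t. t > 0 \<Longrightarrow> \<bar>g1 t\<bar> \<le> K * e t * sqrt (N * t)"
      "\<And>t. t > 0 \<Longrightarrow> \<bar>g2 t\<bar> \<le> K * e t * sqrt (N * t)"
      "\<And>t. t > 0 \<Longrightarrow> \<bar>g3 t\<bar> \<le> K * e t * sqrt (N * t)"
    and small: "32 * K * k * sqrt (N * t) \<le> 1" "4 * K * sqrt (N * t) \<le> 1"
  shows "\<bar>e t - s t\<bar> \<le> 4 * K * e t * sqrt (N * t)"
proof -
  \<comment> \<open>The forcing is a quarter of H, while the square root makes H grow at relative
    rate 1 / 2. The surplus pays for the errors made in the derivative of e.\<close>
  define H where "H = (\<lambda>t. 4 * K * (e t * sqrt (N * t)))"
  have contH: "continuous_on S H" for S unfolding H_def by (intro continuous_intros)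
  note cont'' = continuous_on_subset[OF cont'(1) subset_UNIV]
    continuous_on_subset[OF cont'(2) subset_UNIV] continuous_on_subset[OF cont'(3) subset_UNIV]
  let ?I = "{\<lambda>t. H t - p t, \<lambda>t. H t + p t, \<lambda>t. H t - q t, \<lambda>t. H t + q t, \<lambda>t. H t - v t, \<lambda>t. H t + v t}"
  have main: "u t \<ge> 0" if "u \<in> ?I" for u
  proof (rule finite_barrier[where I = ?I and T = t and u = u])
    show "finite ?I" by simp
    show "u \<in> ?I" by fact
    show "continuous_on {0..t} u" if "u \<in> ?I" for u
      using that by (auto intro!: continuous_intros contH cont'')
    show "u 0 \<ge> 0" if "u \<in> ?I" for u using that init' by (auto simp: H_def)
    fix u x assume u: "u \<in> ?I" and x: "0 < x" "x \<le> t" and neg: "u x < 0"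
      and le: "\<And>w. w \<in> ?I \<Longrightarrow> u x \<le> w x"
    \<comment> \<open>At the minimizing barrier, Z is the absolute value of the extremal difference;
      it dominates the other two and exceeds H.\<close>
    define Z where "Z = H x - u x"
    have ZH: "Z > H x" using neg by (simp add: Z_def)
    have "u x \<le> H x - p x" "u x \<le> H x + p x" "u x \<le> H x - q x" "u x \<le> H x + q x"
      "u x \<le> H x - v x" "u x \<le> H x + v x"
      using le[of "\<lambda>t. H t - p t"] le[of "\<lambda>t. H t + p t"] le[of "\<lambda>t. H t - q t"]
        le[of "\<lambda>t. H t + q t"] le[of "\<lambda>t. H t - v t"] le[of "\<lambda>t. H t + v t"] by simp_all
    then have Z: "\<bar>p x\<bar> \<le> Z" "\<bar>q x\<bar> \<le> Z" "\<bar>v x\<bar> \<le> Z" by (auto simp: Z_def)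
    define R where "R = sqrt (N * x)"
    have R: "R \<ge> 0" "R \<le> sqrt (N * t)" using x N by (auto simp: R_def mult_left_mono)
    have ep: "e x > 0" using e_pos x by simp
    have Hx: "H x = 4 * K * (e x * R)" by (simp add: H_def R_def)
    have H0: "H x \<ge> 0" using R ep K by (simp add: Hx)
    have R1: "32 * K * k * R \<le> 1" "4 * K * R \<le> 1"
      using order_trans[OF mult_left_mono[OF R(2), of "32 * K * k"] small(1)]
        order_trans[OF mult_left_mono[OF R(2), of "4 * K"] small(2)] K k by simp_all
    let ?De = "k * (sa x + sb x + sg x) - 3 * k * e x"
    let ?DH = "4 * K * (?De * R + (R / 2) * e x)"
    have dH: "euler_deriv H ?DH x"
      using euler_deriv_cmult[OF euler_deriv_mult[OF de[OF x(1)] euler_deriv_sqrt[OF x(1) N]], of "4 * K"]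
      unfolding H_def R_def .
    have key: "?DH - D > 0" if D: "D \<le> K * e x * R - 2 * k * Z" for D
    proof -
      \<comment> \<open>By its losses alone e could fall at relative rate 3 k, faster than the net
        relaxation 2 k of the differences. Counting the inflow from s = e - p lowers this to 2 k, up
        to an error k Z.\<close>
      have "k * s x \<le> k * (sa x + sb x + sg x)" using s(1)[of x] x k by (intro mult_left_mono) auto
      moreover have "k * p x \<le> k * Z" using Z k by (intro mult_left_mono) auto
      ultimately have De: "?De \<ge> - 2 * k * e x - k * Z" using s(2)[of x] by (simp add: algebra_simps)
      have "?De * (4 * K * R) \<ge> (- 2 * k * e x - k * Z) * (4 * K * R)"
        using De R K by (intro mult_right_mono) auto
      then have 1: "?DH \<ge> H x / 2 - 2 * k * H x - (4 * K * R) * (k * Z)"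
        by (simp add: Hx algebra_simps)
      have "(4 * K * R) * (k * (Z - H x)) \<le> 1 * (k * (Z - H x))"
        using R1 k ZH by (intro mult_right_mono) auto
      moreover have "(32 * K * k * R) * H x \<le> 1 * H x" using R1 H0 by (intro mult_right_mono) auto
      ultimately have 2: "(4 * K * R) * (k * Z) \<le> k * (Z - H x) + H x / 8"
        by (simp add: algebra_simps)
      have 3: "D \<le> H x / 4 - 2 * k * Z" using D by (simp add: Hx)
      have "k * (Z - H x) > 0" using k ZH by simp
      then show ?thesis using 1 2 3 H0 by (simp add: algebra_simps)
    qed
    have bd: "k * (y + z) - (4 * k + L * x) * w + h \<le> K * e x * R - 2 * k * Z"
      if "y \<le> Z" "z \<le> Z" "w = Z" "\<bar>h\<bar> \<le> K * e x * sqrt (N * x)" "L \<ge> 0" for y z w h L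
    proof -
      have "k * (y + z) \<le> k * (Z + Z)" using that k by (intro mult_left_mono) auto
      moreover have "L * x * w \<ge> 0" using that x ZH H0 by auto
      ultimately show ?thesis using that by (simp add: algebra_simps R_def)
    qed
    have minus: "\<exists>D>0. euler_deriv u D x"
      if "euler_deriv f D x" "u = (\<lambda>t. H t - f t)" "D \<le> K * e x * R - 2 * k * Z" for f D
      using euler_deriv_diff[OF dH that(1)] key[OF that(3)] that(2) by blast
    have plus: "\<exists>D>0. euler_deriv u D x"
      if "euler_deriv f D x" "u = (\<lambda>t. H t + f t)" "- D \<le> K * e x * R - 2 * k * Z" for f D
      using euler_deriv_add[OF dH that(1)] key[OF that(3)] that(2) by (metis diff_minus_eq_add)
    note g' = g[OF x(1)]
    consider "u = (\<lambda>t. H t - p t)" | "u = (\<lambda>t. H t + p t)" | "u = (\<lambda>t. H t - q t)"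
      | "u = (\<lambda>t. H t + q t)" | "u = (\<lambda>t. H t - v t)" | "u = (\<lambda>t. H t + v t)"
      using u by auto
    then show "\<exists>D>0. euler_deriv u D x"
    proof cases
      case 1
      then have "p x = Z" by (simp add: Z_def)
      then show ?thesis
        using bd[of "q x" "v x" "p x" "g1 x" 0] Z g' by (intro minus[OF dp[OF x(1)] 1]) auto
    next
      case 2
      then have "- p x = Z" by (simp add: Z_def)
      then show ?thesis
        using bd[of "- q x" "- v x" "- p x" "- g1 x" 0] Z g'
        by (intro plus[OF dp[OF x(1)] 2]) (auto simp: algebra_simps)
    next
      case 3
      then have "q x = Z" by (simp add: Z_def)
      then show ?thesis
        using bd[of "p x" "- v x" "q x" "g2 x" L1] Z g' L by (intro minus[OF dq[OF x(1)] 3]) auto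
    next
      case 4
      then have "- q x = Z" by (simp add: Z_def)
      then show ?thesis
        using bd[of "- p x" "v x" "- q x" "- g2 x" L1] Z g' L
        by (intro plus[OF dq[OF x(1)] 4]) (auto simp: algebra_simps)
    next
      case 5
      then have "v x = Z" by (simp add: Z_def)
      then show ?thesis
        using bd[of "p x" "- q x" "v x" "g3 x" L2] Z g' L by (intro minus[OF dv[OF x(1)] 5]) auto
    next
      case 6
      then have "- v x = Z" by (simp add: Z_def)
      then show ?thesis
        using bd[of "- p x" "q x" "- v x" "- g3 x" L2] Z g' L
        by (intro plus[OF dv[OF x(1)] 6]) (auto simp: algebra_simps)
    qed
  qed (use t in auto)
  have "H t - p t \<ge> 0" "H t + p t \<ge> 0"
    using main[of "\<lambda>t. H t - p t"] main[of "\<lambda>t. H t + p t"] by auto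
  then show ?thesis using s(2)[of t] by (simp add: H_def mult_ac abs_le_iff)
qed


section \<open>Two-sided ratio bounds for reflections and rotations\<close>

abbreviation (input) "C \<equiv> A + B + P + Q"
abbreviation (input) "R1 \<equiv> A + B + P"
abbreviation (input) "R2 \<equiv> A + B + Q"
text \<open>Up to constants depending on k, the total of the three reflections relative to e, and
  hence the inflow of both rotations.\<close>

abbreviation (input) "mass t \<equiv> 1 / (1 + A * t) + 1 / (1 + B * t) + 1 / (1 + C * t)"

lemma ratio_const_pos: "ratio_const k \<ge> 6"
  using k by (simp add: ratio_const_def)

lemma costs_nonneg: "C \<ge> 0" "R1 \<ge> 0" "R2 \<ge> 0"
  using A B P Q by auto

lemma even_src_le:
  assumes "t > 0"
  shows "k * (e t + r1 t + r2 t) \<le> 6 * k * e t * 1"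
proof -
  have "k * (e t + r1 t + r2 t) \<le> k * (6 * e t)"
    using r_le[of t] nonneg[of t] assms k by (intro mult_left_mono) auto
  then show ?thesis by simp
qed

lemma odd_src_le:
  assumes "t > 0"
  shows "k * (sa t + sb t + sg t) \<le> 6 * k * e t * 1"
proof -
  have "k * (sa t + sb t + sg t) \<le> k * (6 * e t)"
    using s_le[of t] assms k by (intro mult_left_mono) auto
  then show ?thesis by simp
qed

lemma euler_deriv_one: "t > 0 \<Longrightarrow> \<exists>M. - 1 \<le> M \<and> euler_deriv (\<lambda>t. 1) M t"
  "t > 0 \<Longrightarrow> \<exists>M. M \<le> 0 \<and> euler_deriv (\<lambda>t. 1) M t"
  by (intro exI[of _ 0] conjI euler_deriv_const; simp)+

lemma s_upper:
  assumes "t \<ge> 0"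
  shows "(1 + A * t) * sa t \<le> ratio_const k * e t" "(1 + B * t) * sb t \<le> ratio_const k * e t"
    "(1 + C * t) * sg t \<le> ratio_const k * e t"
  using upper_aux[OF assms A, of 6 2 sa "\<lambda>_. 1", OF _ _ nonneg(2) cont(2) _ _ euler_deriv_one(1) dsa even_src_le]
    upper_aux[OF assms B, of 6 2 sb "\<lambda>_. 1", OF _ _ nonneg(3) cont(3) _ _ euler_deriv_one(1) dsb even_src_le]
    upper_aux[OF assms costs_nonneg(1), of 6 2 sg "\<lambda>_. 1", OF _ _ nonneg(4) cont(4) _ _ euler_deriv_one(1) dsg even_src_le]
    s_le by (simp_all add: ratio_const_def)

text \<open>With weight 1 only the rate of the rotation itself is gained. This is what bounds the
  forcing terms in \<open>s_small\<close>; the further gain from the decay of the reflections is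
  left to \<open>r_upper\<close>.\<close>

lemma r_upper_weak:
  assumes "t \<ge> 0"
  shows "(1 + R1 * t) * r1 t \<le> ratio_const k * e t" "(1 + R2 * t) * r2 t \<le> ratio_const k * e t"
proof -
  have "r1 t \<le> 2 * e t" "r2 t \<le> 2 * e t" if "t \<ge> 0" for t
    using r_le[OF that] nonneg(1)[OF that] by auto
  then show "(1 + R1 * t) * r1 t \<le> ratio_const k * e t" "(1 + R2 * t) * r2 t \<le> ratio_const k * e t"
    using upper_aux[OF assms costs_nonneg(2), of 6 2 r1 "\<lambda>_. 1", OF _ _ nonneg(5) cont(5) _ _ euler_deriv_one(1) dr1 odd_src_le]
      upper_aux[OF assms costs_nonneg(3), of 6 2 r2 "\<lambda>_. 1", OF _ _ nonneg(6) cont(6) _ _ euler_deriv_one(1) dr2 odd_src_le]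
    by (simp_all add: ratio_const_def)
qed

lemma s_lower:
  assumes "t \<ge> 0"
  shows "(1 + A * t) * sa t \<ge> k / (1 + 6 * k) * e t" "(1 + B * t) * sb t \<ge> k / (1 + 6 * k) * e t"
    "(1 + C * t) * sg t \<ge> k / (1 + 6 * k) * e t"
proof -
  have *: "1 * k / (1 + 6 * k) * 1 \<le> 1" using k by simp
  have src: "1 * k * e t * 1 \<le> k * (e t + r1 t + r2 t)" if "t > 0" for t
    using mult_left_mono[of "e t" "e t + r1 t + r2 t" k] k nonneg[of t] that by simp
  show "(1 + A * t) * sa t \<ge> k / (1 + 6 * k) * e t" "(1 + B * t) * sb t \<ge> k / (1 + 6 * k) * e t"
    "(1 + C * t) * sg t \<ge> k / (1 + 6 * k) * e t"
    using lower_aux[OF assms A, of 1 "\<lambda>_. 1" sa, OF _ * nonneg(2) cont(2) init(2) _ _ euler_deriv_one(2) dsa src]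
    lower_aux[OF assms B, of 1 "\<lambda>_. 1" sb, OF _ * nonneg(3) cont(3) init(3) _ _ euler_deriv_one(2) dsb src]
    lower_aux[OF assms costs_nonneg(1), of 1 "\<lambda>_. 1" sg, OF _ * nonneg(4) cont(4) init(4) _ _ euler_deriv_one(2) dsg src]
    by simp_all
qed

lemma one_plus_pos: "t \<ge> 0 \<Longrightarrow> L \<ge> 0 \<Longrightarrow> 1 + L * t > 0" for L t :: real
  by (simp add: add_pos_nonneg)

lemma mass_pos: "t \<ge> 0 \<Longrightarrow> mass t > 0"
  using A B costs_nonneg(1) by (intro add_pos_pos divide_pos_pos one_plus_pos) auto

lemma continuous_on_mass: "continuous_on {0..} (\<lambda>t. mass t)"
proof -
  have *: "1 + L * t \<noteq> 0" if "t \<ge> 0" "L \<ge> 0" for L t :: real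
    using one_plus_pos[OF that] by simp
  show ?thesis
    by (intro continuous_intros) (use * A B costs_nonneg(1) in auto)
qed

text \<open>Each summand 1 / (1 + L t) changes at relative rate - L t / (1 + L t), which lies
  between -1 and 0. These are the conditions on the weight in \<open>upper_aux\<close> and
  \<open>lower_aux\<close>.\<close>

lemma euler_deriv_mass:
  assumes t: "t > 0"
  shows "\<exists>M. - mass t \<le> M \<and> M \<le> 0 \<and> euler_deriv (\<lambda>t. mass t) M t"
proof -
  have bd: "- (1 / (1 + L * t)) \<le> - (L * t) / (1 + L * t)\<^sup>2" "- (L * t) / (1 + L * t)\<^sup>2 \<le> 0" if "L \<ge> 0" for L
  proof -
    have Lt: "L * t \<ge> 0" using that t by simp
    then show "- (1 / (1 + L * t)) \<le> - (L * t) / (1 + L * t)\<^sup>2"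
      by (simp add: power2_eq_square divide_simps)
    show "- (L * t) / (1 + L * t)\<^sup>2 \<le> 0" using Lt by (simp add: divide_nonpos_nonneg)
  qed
  define d where "d L = - (L * t) / (1 + L * t)\<^sup>2" for L
  have "euler_deriv (\<lambda>t. mass t) (d A + d B + d C) t"
    unfolding d_def using t A B costs_nonneg(1) by (intro euler_deriv_add euler_deriv_recip)
  moreover have "- mass t \<le> d A + d B + d C" "d A + d B + d C \<le> 0"
    using bd[OF A] bd[OF B] bd[OF costs_nonneg(1)] unfolding d_def by linarith+
  ultimately show ?thesis by blast
qed

lemma euler_deriv_mass':
  assumes t: "t > 0"
  shows "\<exists>M. - mass t \<le> M \<and> euler_deriv (\<lambda>t. mass t) M t" "\<exists>M. M \<le> 0 \<and> euler_deriv (\<lambda>t. mass t) M t"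
  using euler_deriv_mass[OF t] by blast+

lemma div_le_sum3: "x \<le> K * (a::real) \<Longrightarrow> y \<le> K * b \<Longrightarrow> z \<le> K * c \<Longrightarrow> x + y + z \<le> K * (a + b + c)"
  by (simp add: algebra_simps)

text \<open>A second pass through \<open>upper_aux\<close>, now with the decay of the reflections in
  the weight. While L t <= 2, the inequality A <= L keeps \<open>mass\<close> above 1 / 3, so the
  bound by e suffices there with K1 = 3.\<close>

lemma r_upper:
  assumes t: "t \<ge> 0"
  shows "(1 + R1 * t) * r1 t \<le> (9 + 9 * k * ratio_const k) * e t * mass t"
    "(1 + R2 * t) * r2 t \<le> (9 + 9 * k * ratio_const k) * e t * mass t"
proof -
  have src: "k * (sa t + sb t + sg t) \<le> ratio_const k * k * e t * mass t" if t: "t > 0" for t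
  proof -
    have "sa t + sb t + sg t \<le> ratio_const k * e t * mass t"
    proof (rule div_le_sum3)
      show "sa t \<le> ratio_const k * e t * (1 / (1 + A * t))"
        using s_upper(1)[of t] one_plus_pos[OF _ A, of t] t by (simp add: field_simps)
      show "sb t \<le> ratio_const k * e t * (1 / (1 + B * t))"
        using s_upper(2)[of t] one_plus_pos[OF _ B, of t] t by (simp add: field_simps)
      show "sg t \<le> ratio_const k * e t * (1 / (1 + C * t))"
        using s_upper(3)[of t] one_plus_pos[OF _ costs_nonneg(1), of t] t by (simp add: field_simps)
    qed
    then show ?thesis using mult_left_mono[of _ _ k] k by (simp add: mult_ac)
  qed
  have small: "r t \<le> 3 * e t * mass t" if "r t \<le> e t" "t \<ge> 0" "L * t \<le> 2" "A \<le> L" for r L t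
  proof -
    have "A * t \<le> 2" using mult_right_mono[OF that(4,2)] that(3) by linarith
    then have "1 / (1 + A * t) \<ge> 1 / 3" using one_plus_pos[OF that(2) A] by (simp add: field_simps)
    moreover have "1 / (1 + B * t) \<ge> 0" "1 / (1 + C * t) \<ge> 0"
      using one_plus_pos[OF that(2) B] one_plus_pos[OF that(2) costs_nonneg(1)] by auto
    ultimately have "mass t \<ge> 1 / 3" by linarith
    then have "e t * 1 \<le> e t * (3 * mass t)" using nonneg(1)[OF that(2)] by (intro mult_left_mono) auto
    then show ?thesis using that(1) by (simp add: mult_ac)
  qed
  have rc: "ratio_const k \<ge> 0" using ratio_const_pos by simp
  show "(1 + R1 * t) * r1 t \<le> (9 + 9 * k * ratio_const k) * e t * mass t"
    using upper_aux[OF t costs_nonneg(2) rc _ nonneg(5) cont(5) continuous_on_mass mass_pos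
        euler_deriv_mass'(1) dr1 src, of 3] small[where r = r1, OF r_le(1)] B P by simp
  show "(1 + R2 * t) * r2 t \<le> (9 + 9 * k * ratio_const k) * e t * mass t"
    using upper_aux[OF t costs_nonneg(3) rc _ nonneg(6) cont(6) continuous_on_mass mass_pos
        euler_deriv_mass'(1) dr2 src, of 3] small[where r = r2, OF r_le(2)] B Q by simp
qed

lemma r_lower:
  assumes t: "t \<ge> 0"
  shows "(1 + R1 * t) * r1 t \<ge> (k / (1 + 6 * k))\<^sup>2 * e t * mass t"
    "(1 + R2 * t) * r2 t \<ge> (k / (1 + 6 * k))\<^sup>2 * e t * mass t"
proof -
  define c where "c = k / (1 + 6 * k)"
  have c: "c > 0" "c \<le> 1 / 6" using k by (auto simp: c_def field_simps)
  have src: "k * (sa t + sb t + sg t) \<ge> c * k * e t * mass t" if t: "t > 0" for t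
  proof -
    have "- sa t + - sb t + - sg t \<le> (- c * e t) * mass t"
    proof (rule div_le_sum3)
      show "- sa t \<le> - c * e t * (1 / (1 + A * t))"
        using s_lower(1)[of t, folded c_def] one_plus_pos[OF _ A, of t] t by (simp add: field_simps)
      show "- sb t \<le> - c * e t * (1 / (1 + B * t))"
        using s_lower(2)[of t, folded c_def] one_plus_pos[OF _ B, of t] t by (simp add: field_simps)
      show "- sg t \<le> - c * e t * (1 / (1 + C * t))"
        using s_lower(3)[of t, folded c_def] one_plus_pos[OF _ costs_nonneg(1), of t] t by (simp add: field_simps)
    qed
    then have "c * e t * mass t \<le> sa t + sb t + sg t" by simp
    then show ?thesis using mult_left_mono[of _ _ k] k by (simp add: mult_ac)
  qed
  have "c * c \<le> 1 / 6 * (1 / 6)" using c by (intro mult_mono) auto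
  moreover have "c * k / (1 + 6 * k) * mass 0 = 3 * (c * c)" by (simp add: c_def)
  ultimately have init0: "c * k / (1 + 6 * k) * mass 0 \<le> 1" by linarith
  have sq: "c * k / (1 + 6 * k) = (k / (1 + 6 * k))\<^sup>2" by (simp add: c_def power2_eq_square)
  show "(1 + R1 * t) * r1 t \<ge> (k / (1 + 6 * k))\<^sup>2 * e t * mass t"
    using lower_aux[OF t costs_nonneg(2) c(1) init0 nonneg(5) cont(5) init(5) continuous_on_mass mass_pos
        euler_deriv_mass'(2) dr1 src] unfolding sq by simp
  show "(1 + R2 * t) * r2 t \<ge> (k / (1 + 6 * k))\<^sup>2 * e t * mass t"
    using lower_aux[OF t costs_nonneg(3) c(1) init0 nonneg(6) cont(6) init(6) continuous_on_mass mass_pos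
        euler_deriv_mass'(2) dr2 src] unfolding sq by simp
qed


end

section \<open>Reflection ratios at small times, and integration of the equation for e\<close>

context dunkl_ray begin

text \<open>Writing N t = x^2, one factor x is paid for by the decay of y through x <= 1 + x^2, and
  the other remains as the small factor.\<close>

lemma div_le_sqrt:
  fixes N L K y E t :: real
  assumes t: "t \<ge> 0" and N: "N \<ge> 0" and L: "N \<le> L" and y: "(1 + L * t) * y \<le> K * E" "y \<ge> 0"
  shows "N * t * y \<le> K * E * sqrt (N * t)"
proof -
  define x where "x = sqrt (N * t)"
  have x: "x \<ge> 0" "x\<^sup>2 = N * t" using t N by (auto simp: x_def)
  have "2 * x \<le> 1 + x\<^sup>2" using sum_squares_ge_zero[of "1 - x" 0] by (simp add: power2_eq_square algebra_simps)
  then have "x * y \<le> (1 + N * t) * y" using y(2) x by (intro mult_right_mono) auto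
  also have "\<dots> \<le> (1 + L * t) * y" using mult_right_mono[OF L t] y(2) by (intro mult_right_mono) auto
  also have "\<dots> \<le> K * E" by (rule y(1))
  finally have "x * (x * y) \<le> x * (K * E)" using x by (intro mult_left_mono) auto
  then show ?thesis using x by (simp add: x_def[symmetric] power2_eq_square mult_ac flip: x(2))
qed

text \<open>The single threshold is the sum of the two smallness conditions of
  \<open>small_aux\<close> at K = 2 * \<open>ratio_const k\<close>.\<close>

lemma small_sqrt:
  assumes "t \<ge> 0" "8 * ratio_const k * (1 + 8 * k) * sqrt (N * t) \<le> 1" "N \<ge> 0"
  shows "64 * ratio_const k * k * sqrt (N * t) \<le> 1" "8 * ratio_const k * sqrt (N * t) \<le> 1"
proof -
  have "ratio_const k * k * sqrt (N * t) \<ge> 0" "ratio_const k * sqrt (N * t) \<ge> 0"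
    using ratio_const_pos k assms by auto
  moreover have "8 * (ratio_const k * sqrt (N * t)) + 64 * (ratio_const k * k * sqrt (N * t)) \<le> 1"
    using assms(2) by (simp add: algebra_simps)
  ultimately show "64 * ratio_const k * k * sqrt (N * t) \<le> 1"
    "8 * ratio_const k * sqrt (N * t) \<le> 1" by (simp_all add: mult.assoc)
qed

lemma Q_le_sqrt: "Q \<le> sqrt A * sqrt B"
proof -
  have "Q\<^sup>2 \<le> A * B" using mult_right_mono[OF QP Q] PQ by (simp add: power2_eq_square)
  then show ?thesis using Q by (simp add: real_le_rsqrt flip: real_sqrt_mult)
qed

text \<open>Q t is at most sqrt (A t) * sqrt (B t). The factor containing N is kept as the small
  quantity, and the other rate, contained in L, is paid for by the decay of y.\<close>

lemma Q_src:
  assumes t: "t \<ge> 0" and L: "(1 + L * t) * y \<le> K * e t" "y \<ge> 0" and "N = A \<and> L \<ge> B \<or> N = B \<and> L \<ge> A"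
  shows "Q * t * y \<le> K * e t * sqrt (N * t)"
proof -
  obtain N' where N': "N' \<ge> 0" "N' \<le> L" "sqrt A * sqrt B = sqrt N * sqrt N'" "N \<ge> 0"
    using assms(4) A B by (auto simp: mult.commute)
  have "Q * t \<le> sqrt N * sqrt N' * t"
    using Q_le_sqrt N'(3) t by (intro mult_right_mono) auto
  also have "\<dots> = sqrt (N * t) * sqrt (N' * t)" using t by (simp add: real_sqrt_mult)
  finally have 1: "Q * t \<le> sqrt (N * t) * sqrt (N' * t)" .
  define x where "x = sqrt (N' * t)"
  have x: "x \<ge> 0" "x\<^sup>2 = N' * t" using t N' by (auto simp: x_def)
  have "2 * x \<le> 1 + x\<^sup>2" using sum_squares_ge_zero[of "1 - x" 0] by (simp add: power2_eq_square algebra_simps)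
  then have "x * y \<le> (1 + N' * t) * y" using L(2) x by (intro mult_right_mono) auto
  also have "\<dots> \<le> (1 + L * t) * y" using mult_right_mono[OF N'(2) t] L(2) by (intro mult_right_mono) auto
  also have "\<dots> \<le> K * e t" by (rule L(1))
  finally have 2: "x * y \<le> K * e t" .
  have "Q * t * y \<le> sqrt (N * t) * x * y" using 1 L(2) by (intro mult_right_mono) (auto simp: x_def)
  also have "\<dots> = sqrt (N * t) * (x * y)" by simp
  also have "\<dots> \<le> sqrt (N * t) * (K * e t)" using 2 N' t by (intro mult_left_mono) auto
  finally show ?thesis by (simp add: mult_ac)
qed

text \<open>Exchange runs along the complete bipartite graph between even and odd elements, and
  every perfect matching turns the differences of its pairs into a closed system. For sa and sb the
  matching is chosen so that the other two pairs have rates differing by A + Q or B + Q, and by Q: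
  the rate P, which may be huge compared with A and B, stays out of the forcing. For sg every rate
  is at most C, so P is harmless there.\<close>

lemma s_small:
  assumes t: "t \<ge> 0"
  shows "8 * ratio_const k * (1 + 8 * k) * sqrt (A * t) \<le> 1 \<Longrightarrow>
      \<bar>e t - sa t\<bar> \<le> 8 * ratio_const k * e t * sqrt (A * t)"
    "8 * ratio_const k * (1 + 8 * k) * sqrt (B * t) \<le> 1 \<Longrightarrow>
      \<bar>e t - sb t\<bar> \<le> 8 * ratio_const k * e t * sqrt (B * t)"
    "8 * ratio_const k * (1 + 8 * k) * sqrt (C * t) \<le> 1 \<Longrightarrow>
      \<bar>e t - sg t\<bar> \<le> 8 * ratio_const k * e t * sqrt (C * t)"
proof -
  have rc: "2 * ratio_const k > 0" using ratio_const_pos by simp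
  have rp: "ratio_const k * e t * sqrt (N * t) \<ge> 0" if "t \<ge> 0" "N \<ge> 0" for t N
    using rc nonneg(1)[OF that(1)] that by auto
  have double: "\<bar>x\<bar> \<le> 2 * ratio_const k * e t * sqrt (N * t)"
    if "0 \<le> x" "x \<le> ratio_const k * e t * sqrt (N * t)" for x t N
    using that by simp
  have double': "\<bar>x\<bar> \<le> 2 * ratio_const k * e t * sqrt (N * t)"
    if "x \<le> 0" "- x \<le> ratio_const k * e t * sqrt (N * t)" for x t N
    using that by simp
  let ?c = "2 * ratio_const k"
  show "\<bar>e t - sa t\<bar> \<le> 8 * ratio_const k * e t * sqrt (A * t)"
    if sm: "8 * ratio_const k * (1 + 8 * k) * sqrt (A * t) \<le> 1"
  proof -
    have "\<bar>e t - sa t\<bar> \<le> 4 * ?c * e t * sqrt (A * t)"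
    proof (rule small_aux[OF t A B costs_nonneg(1) rc, where p = "\<lambda>t. e t - sa t"
          and q = "\<lambda>t. sb t - r2 t" and v = "\<lambda>t. sg t - r1 t" and ?g1.0 = "\<lambda>t. A * t * sa t"
          and ?g2.0 = "\<lambda>t. A * t * r2 t + Q * t * r2 t" and ?g3.0 = "\<lambda>t. - (Q * t * r1 t)"])
      fix x :: real assume x: "x > 0"
      show "\<bar>A * x * sa x\<bar> \<le> ?c * e x * sqrt (A * x)"
        using x A nonneg(2)[of x] by (intro double div_le_sqrt[OF _ A order_refl] s_upper) auto
      have "A * x * r2 x \<le> ratio_const k * e x * sqrt (A * x)"
        using x A B Q nonneg(6)[of x] by (intro div_le_sqrt[OF _ A, of _ R2] r_upper_weak) auto
      moreover have "Q * x * r2 x \<le> ratio_const k * e x * sqrt (A * x)"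
        using x A B Q nonneg(6)[of x] by (intro Q_src[of _ R2] r_upper_weak) auto
      moreover have "A * x * r2 x \<ge> 0" "Q * x * r2 x \<ge> 0" using x A Q nonneg(6)[of x] by auto
      ultimately show "\<bar>A * x * r2 x + Q * x * r2 x\<bar> \<le> ?c * e x * sqrt (A * x)" by linarith
      show "\<bar>- (Q * x * r1 x)\<bar> \<le> ?c * e x * sqrt (A * x)"
        using x A B P Q nonneg(5)[of x] Q_src[of x R1 "r1 x" "ratio_const k" A] r_upper_weak(1)[of x]
        by (intro double') auto
    next
      fix x :: real assume x: "x > 0"
      show "euler_deriv (\<lambda>t. e t - sa t) (k * ((sb x - r2 x) + (sg x - r1 x)) - 4 * k * (e x - sa x) + A * x * sa x) x"
        by (rule euler_deriv_cong[OF euler_deriv_diff[OF de[OF x] dsa[OF x]]]) (simp add: algebra_simps)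
      show "euler_deriv (\<lambda>t. sb t - r2 t) (k * ((e x - sa x) - (sg x - r1 x)) - (4 * k + B * x) * (sb x - r2 x)
          + (A * x * r2 x + Q * x * r2 x)) x"
        by (rule euler_deriv_cong[OF euler_deriv_diff[OF dsb[OF x] dr2[OF x]]]) (simp add: algebra_simps)
      show "euler_deriv (\<lambda>t. sg t - r1 t) (k * ((e x - sa x) - (sb x - r2 x)) - (4 * k + C * x) * (sg x - r1 x)
          + - (Q * x * r1 x)) x"
        by (rule euler_deriv_cong[OF euler_deriv_diff[OF dsg[OF x] dr1[OF x]]]) (simp add: algebra_simps)
    qed (simp_all add: init small_sqrt[OF t sm A] nonneg continuous_on_diff cont)
    then show ?thesis by simp
  qed
  show "\<bar>e t - sb t\<bar> \<le> 8 * ratio_const k * e t * sqrt (B * t)"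
    if sm: "8 * ratio_const k * (1 + 8 * k) * sqrt (B * t) \<le> 1"
  proof -
    have "\<bar>e t - sb t\<bar> \<le> 4 * ?c * e t * sqrt (B * t)"
    proof (rule small_aux[OF t B A costs_nonneg(1) rc, where p = "\<lambda>t. e t - sb t"
          and q = "\<lambda>t. sa t - r2 t" and v = "\<lambda>t. sg t - r1 t" and ?g1.0 = "\<lambda>t. B * t * sb t"
          and ?g2.0 = "\<lambda>t. B * t * r2 t + Q * t * r2 t" and ?g3.0 = "\<lambda>t. - (Q * t * r1 t)"])
      fix x :: real assume x: "x > 0"
      show "\<bar>B * x * sb x\<bar> \<le> ?c * e x * sqrt (B * x)"
        using x B nonneg(3)[of x] by (intro double div_le_sqrt[OF _ B order_refl] s_upper) auto
      have "B * x * r2 x \<le> ratio_const k * e x * sqrt (B * x)"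
        using x A B Q nonneg(6)[of x] by (intro div_le_sqrt[OF _ B, of _ R2] r_upper_weak) auto
      moreover have "Q * x * r2 x \<le> ratio_const k * e x * sqrt (B * x)"
        using x A B Q nonneg(6)[of x] by (intro Q_src[of _ R2] r_upper_weak) auto
      moreover have "B * x * r2 x \<ge> 0" "Q * x * r2 x \<ge> 0" using x B Q nonneg(6)[of x] by auto
      ultimately show "\<bar>B * x * r2 x + Q * x * r2 x\<bar> \<le> ?c * e x * sqrt (B * x)" by linarith
      show "\<bar>- (Q * x * r1 x)\<bar> \<le> ?c * e x * sqrt (B * x)"
        using x A B P Q nonneg(5)[of x] Q_src[of x R1 "r1 x" "ratio_const k" B] r_upper_weak(1)[of x]
        by (intro double') auto
    next
      fix x :: real assume x: "x > 0"
      show "euler_deriv (\<lambda>t. e t - sb t) (k * ((sa x - r2 x) + (sg x - r1 x)) - 4 * k * (e x - sb x) + B * x * sb x) x"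
        by (rule euler_deriv_cong[OF euler_deriv_diff[OF de[OF x] dsb[OF x]]]) (simp add: algebra_simps)
      show "euler_deriv (\<lambda>t. sa t - r2 t) (k * ((e x - sb x) - (sg x - r1 x)) - (4 * k + A * x) * (sa x - r2 x)
          + (B * x * r2 x + Q * x * r2 x)) x"
        by (rule euler_deriv_cong[OF euler_deriv_diff[OF dsa[OF x] dr2[OF x]]]) (simp add: algebra_simps)
      show "euler_deriv (\<lambda>t. sg t - r1 t) (k * ((e x - sb x) - (sa x - r2 x)) - (4 * k + C * x) * (sg x - r1 x)
          + - (Q * x * r1 x)) x"
        by (rule euler_deriv_cong[OF euler_deriv_diff[OF dsg[OF x] dr1[OF x]]]) (simp add: algebra_simps)
    qed (simp_all add: init small_sqrt[OF t sm B] nonneg continuous_on_diff cont)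
    then show ?thesis by simp
  qed
  show "\<bar>e t - sg t\<bar> \<le> 8 * ratio_const k * e t * sqrt (C * t)"
    if sm: "8 * ratio_const k * (1 + 8 * k) * sqrt (C * t) \<le> 1"
  proof -
    have "\<bar>e t - sg t\<bar> \<le> 4 * ?c * e t * sqrt (C * t)"
    proof (rule small_aux[OF t costs_nonneg(1) B A rc, where p = "\<lambda>t. e t - sg t"
          and q = "\<lambda>t. sb t - r2 t" and v = "\<lambda>t. sa t - r1 t" and ?g1.0 = "\<lambda>t. C * t * sg t"
          and ?g2.0 = "\<lambda>t. (A + Q) * t * r2 t" and ?g3.0 = "\<lambda>t. (B + P) * t * r1 t"])
      fix x :: real assume x: "x > 0"
      have mono: "ratio_const k * e x * sqrt (L * x) \<le> ratio_const k * e x * sqrt (C * x)" if "L \<le> C" for L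
        using that x ratio_const_pos nonneg(1)[of x] by (intro mult_left_mono) (auto simp: mult_right_mono)
      show "\<bar>C * x * sg x\<bar> \<le> ?c * e x * sqrt (C * x)"
        using x costs_nonneg(1) nonneg(4)[of x]
        by (intro double div_le_sqrt[OF _ costs_nonneg(1) order_refl] s_upper) auto
      have "(A + Q) * x * r2 x \<le> ratio_const k * e x * sqrt ((A + Q) * x)"
        using x A B Q nonneg(6)[of x] by (intro div_le_sqrt[of _ _ R2] r_upper_weak) auto
      with mono[of "A + Q"] B P x A Q nonneg(6)[of x]
      show "\<bar>(A + Q) * x * r2 x\<bar> \<le> ?c * e x * sqrt (C * x)" by (intro double) auto
      have "(B + P) * x * r1 x \<le> ratio_const k * e x * sqrt ((B + P) * x)"
        using x A B P nonneg(5)[of x] by (intro div_le_sqrt[of _ _ R1] r_upper_weak) auto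
      with mono[of "B + P"] B P x A Q nonneg(5)[of x]
      show "\<bar>(B + P) * x * r1 x\<bar> \<le> ?c * e x * sqrt (C * x)" by (intro double) auto
    next
      fix x :: real assume x: "x > 0"
      show "euler_deriv (\<lambda>t. e t - sg t) (k * ((sb x - r2 x) + (sa x - r1 x)) - 4 * k * (e x - sg x) + C * x * sg x) x"
        by (rule euler_deriv_cong[OF euler_deriv_diff[OF de[OF x] dsg[OF x]]]) (simp add: algebra_simps)
      show "euler_deriv (\<lambda>t. sb t - r2 t) (k * ((e x - sg x) - (sa x - r1 x)) - (4 * k + B * x) * (sb x - r2 x)
          + (A + Q) * x * r2 x) x"
        by (rule euler_deriv_cong[OF euler_deriv_diff[OF dsb[OF x] dr2[OF x]]]) (simp add: algebra_simps)
      show "euler_deriv (\<lambda>t. sa t - r1 t) (k * ((e x - sg x) - (sb x - r2 x)) - (4 * k + A * x) * (sa x - r1 x)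
          + (B + P) * x * r1 x) x"
        by (rule euler_deriv_cong[OF euler_deriv_diff[OF dsa[OF x] dr1[OF x]]]) (simp add: algebra_simps)
    qed (simp_all add: init small_sqrt[OF t sm costs_nonneg(1)] nonneg continuous_on_diff cont)
    then show ?thesis by simp
  qed
qed

text \<open>With x = sqrt (N t): for small x, \<open>sm\<close> places s / e within O(x) of 1, and 1
  / (1 + x^2) differs from 1 by at most x^2. Otherwise x is bounded below and both terms are O(1 /
  (1 + x^2)).\<close>

lemma dev_aux:
  assumes t: "t \<ge> 0" and N: "N \<ge> 0" and s: "(1 + N * t) * s \<le> ratio_const k * e t" "s \<ge> 0"
    and sm: "8 * ratio_const k * (1 + 8 * k) * sqrt (N * t) \<le> 1 \<Longrightarrow>
      \<bar>e t - s\<bar> \<le> 8 * ratio_const k * e t * sqrt (N * t)"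
  shows "\<bar>s / e t - 1 / (1 + N * t)\<bar> \<le> dev_const k * (sqrt (N * t) / (1 + N * t))"
proof -
  define x where "x = sqrt (N * t)"
  have x: "x \<ge> 0" "N * t = x\<^sup>2" using t N by (auto simp: x_def)
  have ep: "e t > 0" using e_pos t by simp
  define y where "y = s / e t"
  define c where "c = ratio_const k"
  define d where "d = 8 * c * (1 + 8 * k)"
  have c: "c \<ge> 6" using ratio_const_pos by (simp add: c_def)
  have d: "d \<ge> 1" using c k mult_mono[of 1 "8 * c" 1 "1 + 8 * k"] by (simp add: d_def)
  have px: "1 + x\<^sup>2 > 0" by (simp add: add_pos_nonneg)
  have y: "(1 + x\<^sup>2) * y \<le> c" "y \<ge> 0" using divide_right_mono[OF s(1), of "e t"] s(2) ep by (simp_all add: y_def x(2) c_def)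
  have sm': "\<bar>1 - y\<bar> \<le> 8 * c * x" if "d * x \<le> 1"
  proof -
    have "\<bar>e t - s\<bar> \<le> 8 * c * e t * x"
      using sm that by (simp add: x_def c_def d_def)
    moreover have "\<bar>e t - s\<bar> = e t * \<bar>1 - y\<bar>"
      using ep by (simp add: y_def abs_mult_pos' right_diff_distrib)
    ultimately have "e t * \<bar>1 - y\<bar> \<le> e t * (8 * c * x)" by (simp add: mult_ac)
    then show ?thesis using ep by simp
  qed
  have "\<bar>(1 + x\<^sup>2) * y - 1\<bar> \<le> (2 * (8 * c + 1) + (c + 1) * d) * x"
  proof (cases "d * x \<le> 1")
    case True
    then have x1: "x \<le> 1" using mult_right_mono[OF d x(1)] by linarith
    then have x2: "x\<^sup>2 \<le> x" using x(1) by (simp add: power2_eq_square mult_left_le)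
    have "\<bar>(1 + x\<^sup>2) * y - 1\<bar> = \<bar>(1 + x\<^sup>2) * (y - 1) + x\<^sup>2\<bar>" by (simp add: algebra_simps)
    also have "\<dots> \<le> (1 + x\<^sup>2) * \<bar>1 - y\<bar> + x\<^sup>2"
      using abs_triangle_ineq[of "(1 + x\<^sup>2) * (y - 1)" "x\<^sup>2"] px by (simp add: abs_mult abs_minus_commute)
    also have "\<dots> \<le> 2 * (8 * c * x) + x"
      using sm'[OF True] x1 x2 x by (intro add_mono mult_mono) auto
    also have "\<dots> \<le> (2 * (8 * c + 1) + (c + 1) * d) * x"
      using x c d mult_right_mono[of 0 "1 + (c + 1) * d" x] by (simp add: algebra_simps)
    finally show ?thesis .
  next
    case False
    have "(1 + x\<^sup>2) * y \<ge> 0" using y px by simp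
    then have "\<bar>(1 + x\<^sup>2) * y - 1\<bar> \<le> c + 1" using y c by linarith
    also have "\<dots> \<le> (c + 1) * (d * x)" using mult_left_mono[of 1 "d * x" "c + 1"] False c by simp
    also have "\<dots> \<le> (2 * (8 * c + 1) + (c + 1) * d) * x"
      using x c by (simp add: algebra_simps)
    finally show ?thesis .
  qed
  then have "\<bar>(1 + x\<^sup>2) * y - 1\<bar> / (1 + x\<^sup>2) \<le> dev_const k * x / (1 + x\<^sup>2)"
    unfolding dev_const_def c_def d_def using px by (intro divide_right_mono) auto
  moreover have "\<bar>y - 1 / (1 + x\<^sup>2)\<bar> = \<bar>(1 + x\<^sup>2) * y - 1\<bar> / (1 + x\<^sup>2)"
  proof -
    have "y - 1 / (1 + x\<^sup>2) = ((1 + x\<^sup>2) * y - 1) / (1 + x\<^sup>2)" using px by (simp add: diff_divide_distrib)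
    then show ?thesis using px by (simp add: abs_divide)
  qed
  ultimately show ?thesis
    by (simp only: x_def[symmetric]) (simp only: x(2) y_def[symmetric] times_divide_eq_right)
qed

lemma dev:
  assumes "t \<ge> 0"
  shows "\<bar>sa t / e t - 1 / (1 + A * t)\<bar> \<le> dev_const k * (sqrt (A * t) / (1 + A * t))"
    "\<bar>sb t / e t - 1 / (1 + B * t)\<bar> \<le> dev_const k * (sqrt (B * t) / (1 + B * t))"
    "\<bar>sg t / e t - 1 / (1 + C * t)\<bar> \<le> dev_const k * (sqrt (C * t) / (1 + C * t))"
  using assms A B costs_nonneg(1) nonneg by (intro dev_aux s_small s_upper; simp)+

text \<open>Under t d/dt, ln e gives k times the sum of s / e - 1, and k ln (1 + L t) gives k (1 - 1
  / (1 + L t)); together these are k times the three deviations in \<open>dev\<close>. They are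
  dominated by the derivatives of three terms 2 k \<open>dev_const k\<close> arctan (sqrt (L t)),
  each at most pi k \<open>dev_const k\<close>.\<close>

lemma log_e_bound:
  assumes t: "t \<ge> 0"
  shows "\<bar>ln (e t) + k * (ln (1 + A * t) + ln (1 + B * t) + ln (1 + C * t))\<bar> \<le> 3 * pi * k * dev_const k"
proof -
  define G where "G t = ln (e t) + k * (ln (1 + A * t) + ln (1 + B * t) + ln (1 + C * t))" for t
  define H where "H t = 2 * k * dev_const k *
    (arctan (sqrt (A * t)) + arctan (sqrt (B * t)) + arctan (sqrt (C * t)))" for t
  have contG: "continuous_on {0..t} G"
    unfolding G_def using e_pos one_plus_pos A B costs_nonneg(1)
    by (intro continuous_intros) (metis atLeastAtMost_iff less_irrefl)+
  have contH: "continuous_on {0..t} H"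
    unfolding H_def by (intro continuous_intros)
  have der: "\<exists>D E. euler_deriv G D x \<and> euler_deriv H E x \<and> \<bar>D\<bar> \<le> E" if x: "x > 0" for x
  proof -
    define D where "D = (k * (sa x + sb x + sg x) - 3 * k * e x) / e x +
      k * (A * x / (1 + A * x) + B * x / (1 + B * x) + C * x / (1 + C * x))"
    define E where "E = 2 * k * dev_const k * (sqrt (A * x) / (2 * (1 + A * x)) +
      sqrt (B * x) / (2 * (1 + B * x)) + sqrt (C * x) / (2 * (1 + C * x)))"
    have ep: "e x > 0" using e_pos x by simp
    have "euler_deriv G D x"
      unfolding G_def D_def
      using x A B costs_nonneg(1) ep one_plus_pos[of x]
      by (intro euler_deriv_add euler_deriv_cmult euler_deriv_ln de euler_deriv_affine) auto
    moreover have "euler_deriv H E x"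
      unfolding H_def E_def using x A B costs_nonneg(1)
      by (intro euler_deriv_add euler_deriv_cmult euler_deriv_arctan_sqrt) auto
    moreover have "\<bar>D\<bar> \<le> E"
    proof -
      have fr: "L * x / (1 + L * x) = 1 - 1 / (1 + L * x)" if "L \<ge> 0" for L
        using one_plus_pos[of x L] x that by (simp add: field_simps)
      have "D = k * ((sa x / e x - 1 / (1 + A * x)) + (sb x / e x - 1 / (1 + B * x))
          + (sg x / e x - 1 / (1 + C * x)))"
        unfolding D_def fr[OF A] fr[OF B] fr[OF costs_nonneg(1)] using ep by (simp add: field_simps)
      then have "\<bar>D\<bar> = k * \<bar>(sa x / e x - 1 / (1 + A * x)) + (sb x / e x - 1 / (1 + B * x))
          + (sg x / e x - 1 / (1 + C * x))\<bar>" using k by (simp add: abs_mult)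
      also have "\<dots> \<le> k * (dev_const k * (sqrt (A * x) / (1 + A * x)) + dev_const k * (sqrt (B * x) / (1 + B * x))
          + dev_const k * (sqrt (C * x) / (1 + C * x)))"
        using dev[of x] x k by (intro mult_left_mono) linarith+
      also have "\<dots> = E"
      proof -
        have half: "u / (2 * w) = u / w / 2" for u w :: real by simp
        have "k * (d * a + d * b + d * c) = 2 * k * d * (a / 2 + b / 2 + c / 2)" for a b c d :: real
          by (simp add: algebra_simps)
        then show ?thesis unfolding E_def half .
      qed
      finally show ?thesis .
    qed
    ultimately show ?thesis by blast
  qed
  have GH0: "G 0 = 0" "H 0 = 0" using init by (auto simp: G_def H_def)
  have "0 \<le> H t - G t"
  proof (rule barrier[where g = "\<lambda>t. H t - G t" and a = 0])
    fix x :: real assume "x > 0"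
    from der[OF this] obtain D E where "euler_deriv G D x" "euler_deriv H E x" "\<bar>D\<bar> \<le> E" by blast
    then show "\<exists>D\<ge>0. euler_deriv (\<lambda>t. H t - G t) D x"
      using euler_deriv_diff[of H E x G D] by (intro exI[of _ "E - D"]) auto
  qed (use t GH0 in \<open>auto intro!: continuous_on_diff contG contH\<close>)
  moreover have "0 \<le> H t + G t"
  proof (rule barrier[where g = "\<lambda>t. H t + G t" and a = 0])
    fix x :: real assume "x > 0"
    from der[OF this] obtain D E where "euler_deriv G D x" "euler_deriv H E x" "\<bar>D\<bar> \<le> E" by blast
    then show "\<exists>D\<ge>0. euler_deriv (\<lambda>t. H t + G t) D x"
      using euler_deriv_add[of H E x G D] by (intro exI[of _ "E + D"]) auto
  qed (use t GH0 in \<open>auto intro!: continuous_on_add contG contH\<close>)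
  moreover have "H t \<le> 2 * k * dev_const k * (pi / 2 + pi / 2 + pi / 2)"
    unfolding H_def using k ratio_const_pos
    by (intro mult_left_mono add_mono less_imp_le[OF arctan_ubound]) (auto simp: dev_const_def)
  ultimately show ?thesis unfolding G_def by (simp add: mult_ac)
qed

lemma e_bound:
  defines "K \<equiv> exp (3 * pi * k * dev_const k)"
  defines "W \<equiv> (1 + A) powr k * (1 + B) powr k * (1 + C) powr k"
  shows "1 / K \<le> e 1 * W" "e 1 * W \<le> K"
proof -
  have e: "e 1 > 0" using e_pos by simp
  have W: "W = exp (k * (ln (1 + A) + ln (1 + B) + ln (1 + C)))"
    using A B costs_nonneg(1) unfolding W_def by (simp add: powr_def exp_add algebra_simps)
  have "e 1 * W = exp (ln (e 1) + k * (ln (1 + A) + ln (1 + B) + ln (1 + C)))"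
    using e by (simp add: W exp_add)
  then show "1 / K \<le> e 1 * W" "e 1 * W \<le> K"
    using log_e_bound[of 1] unfolding K_def by (simp_all add: abs_le_iff flip: exp_minus' inverse_eq_divide exp_minus)
qed

end

section \<open>Homogeneous components of the kernel\<close>

locale dunkl_series =
  fixes k a b c :: real
  assumes k: "k > 0"
begin

definition cr :: "nat \<Rightarrow> real" where "cr n = 1 / (real n + 3 * k)"
definition cp :: "nat \<Rightarrow> real" where "cp n = k / (real n * (real n + 6 * k))"
definition cq :: "nat \<Rightarrow> real" where "cq n = 3 * k * cp n / (real n + 3 * k)"

text \<open>With N the sum of the three reflections, this is the inverse of n + 3 k - k N;
  the coefficients come from N^3 = 9 N.\<close>

definition resolv :: "nat \<Rightarrow> (real \<Rightarrow> real \<Rightarrow> real \<Rightarrow> real) \<Rightarrow> real \<Rightarrow> real \<Rightarrow> real \<Rightarrow> real" where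
  "resolv n g x y z = cr n * g x y z + cp n * (g y x z + g x z y + g z y x)
     + cq n * (g x y z + g y z x + g z x y)"

lemma coeffs_nonneg: "cr n \<ge> 0" "cp n \<ge> 0" "cq n \<ge> 0"
  using k by (auto simp: cr_def cp_def cq_def)

text \<open>With R the sum of the three rotations, identity included, N^2 = 3 R and N R = 3 N. The
  equations are the coefficients of 1, R and N in (n + 3 k - k N) (cr + cp N + cq R) = 1. At n = 0
  that operator kills constants, hence n > 0.\<close>

lemma coeffs_eq:
  assumes "n > 0"
  shows "(real n + 3 * k) * cr n = 1" "(real n + 3 * k) * cq n = 3 * k * cp n"
    "(real n + 3 * k) * cp n = k * cr n + 3 * k * cq n"
proof -
  have pos: "real n > 0" "real n + 3 * k > 0" "real n + 6 * k > 0" using assms k by auto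
  show 1: "(real n + 3 * k) * cr n = 1" using pos by (simp add: cr_def)
  show 2: "(real n + 3 * k) * cq n = 3 * k * cp n" using pos by (simp add: cq_def)
  have "cp n * (real n * (real n + 6 * k)) = k" using pos by (simp add: cp_def)
  moreover have "(real n + 3 * k) * ((real n + 3 * k) * cp n)
    = cp n * (real n * (real n + 6 * k)) + 9 * k * k * cp n" by (simp add: algebra_simps)
  moreover have "(real n + 3 * k) * (k * cr n + 3 * k * cq n)
    = k * ((real n + 3 * k) * cr n) + 3 * k * ((real n + 3 * k) * cq n)" by (simp add: algebra_simps)
  ultimately have "(real n + 3 * k) * ((real n + 3 * k) * cp n) = (real n + 3 * k) * (k * cr n + 3 * k * cq n)"
    using 1 2 by simp
  then show "(real n + 3 * k) * cp n = k * cr n + 3 * k * cq n" using pos by simp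
qed

text \<open>On constants N equals 3, so the inverse acts as 1 / n. As all coefficients are
  nonnegative, this also bounds its norm; it is the origin of the factorial in the bounds for
  \<open>hom\<close>.\<close>

lemma coeffs_sum:
  assumes "n > 0"
  shows "cr n + 3 * cp n + 3 * cq n = 1 / real n"
proof -
  have "(real n + 3 * k) * (cr n + 3 * cp n + 3 * cq n)
    = (real n + 3 * k) * cr n + 3 * ((real n + 3 * k) * cp n) + 3 * ((real n + 3 * k) * cq n)"
    by (simp add: algebra_simps)
  also have "\<dots> = 1 + 3 * k * (cr n + 3 * cp n + 3 * cq n)"
    unfolding coeffs_eq[OF assms] by (simp add: algebra_simps)
  finally have "real n * (cr n + 3 * cp n + 3 * cq n) = 1" by (simp add: algebra_simps)
  then show ?thesis using assms by (simp add: field_simps)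
qed

lemma resolv_eq:
  assumes "n > 0"
  shows "(real n + 3 * k) * resolv n g x y z
    = k * (resolv n g y x z + resolv n g x z y + resolv n g z y x) + g x y z"
proof -
  have "(real n + 3 * k) * resolv n g x y z = ((real n + 3 * k) * cr n) * g x y z
     + ((real n + 3 * k) * cp n) * (g y x z + g x z y + g z y x)
     + ((real n + 3 * k) * cq n) * (g x y z + g y z x + g z x y)"
    unfolding resolv_def by (simp add: algebra_simps)
  also have "\<dots> = k * (resolv n g y x z + resolv n g x z y + resolv n g z y x) + g x y z"
    unfolding coeffs_eq[OF assms] unfolding resolv_def by (simp add: algebra_simps)
  finally show ?thesis .
qed

primrec hom :: "nat \<Rightarrow> real \<Rightarrow> real \<Rightarrow> real \<Rightarrow> real" where
  "hom 0 = (\<lambda>x y z. 1)"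
| "hom (Suc n) = resolv (Suc n) (\<lambda>x y z. (x * a + y * b + z * c) * hom n x y z)"

text \<open>The component of one degree less, taken as zero below degree 0 so that the recursion
  also holds for n = 0.\<close>

definition prev :: "nat \<Rightarrow> real \<Rightarrow> real \<Rightarrow> real \<Rightarrow> real" where
  "prev n x y z = (case n of 0 \<Rightarrow> 0 | Suc m \<Rightarrow> hom m x y z)"

lemma prev_simps [simp]: "prev 0 x y z = 0" "prev (Suc n) x y z = hom n x y z"
  by (simp_all add: prev_def)

lemma hom_rec:
  "(real n + 3 * k) * hom n x y z
    = k * (hom n y x z + hom n x z y + hom n z y x) + (x * a + y * b + z * c) * prev n x y z"
proof (cases n)
  case (Suc m)
  show ?thesis unfolding Suc hom.simps prev_simps by (rule resolv_eq) simp
qed simp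

lemma hom_homogeneous: "hom n (t * x) (t * y) (t * z) = t ^ n * hom n x y z"
proof (induction n arbitrary: x y z)
  case (Suc n)
  show ?case by (simp add: resolv_def Suc algebra_simps)
qed simp

lemma hom_differentiable:
  "(\<lambda>t. hom n (x + t * d1) (y + t * d2) (z + t * d3)) field_differentiable at t"
proof (induction n arbitrary: x y z d1 d2 d3)
  case (Suc n)
  show ?case unfolding hom.simps resolv_def by (intro derivative_intros Suc)
qed simp

text \<open>The derivative of the degree n component in direction (d1, d2, d3) as the eigen-equation
  prescribes it, with the reflection quotients moved to the right-hand side.\<close>

definition grad :: "nat \<Rightarrow> real \<Rightarrow> real \<Rightarrow> real \<Rightarrow> real \<Rightarrow> real \<Rightarrow> real \<Rightarrow> real" where
  "grad n x y z d1 d2 d3 = (d1 * a + d2 * b + d3 * c) * prev n x y z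
     - k * ((d1 - d2) / (x - y) * (hom n x y z - hom n y x z)
          + (d2 - d3) / (y - z) * (hom n x y z - hom n x z y)
          + (d1 - d3) / (x - z) * (hom n x y z - hom n z y x))"

text \<open>Differentiating \<open>hom_rec\<close> gives this relation for the true derivative, the
  direction being permuted together with the point. That the prescribed gradient obeys it too
  reduces \<open>hom_grad\<close> to the uniqueness of a linear system.\<close>

lemma grad_rec:
  assumes reg: "x \<noteq> y" "y \<noteq> z" "x \<noteq> z"
  shows "(real (Suc n) + 3 * k) * grad (Suc n) x y z d1 d2 d3
    = k * (grad (Suc n) y x z d2 d1 d3 + grad (Suc n) x z y d1 d3 d2 + grad (Suc n) z y x d3 d2 d1)
      + (d1 * a + d2 * b + d3 * c) * hom n x y z + (x * a + y * b + z * c) * grad n x y z d1 d2 d3"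
proof -
  define u v w where uvw: "u = (d1 - d2) / (x - y)" "v = (d2 - d3) / (y - z)" "w = (d1 - d3) / (x - z)"
  have uvw': "(d2 - d1) / (y - x) = u" "(d3 - d2) / (z - y) = v" "(d3 - d1) / (z - x) = w"
    unfolding uvw using minus_divide_divide[of "d1 - d2" "x - y"] minus_divide_divide[of "d2 - d3" "y - z"]
      minus_divide_divide[of "d1 - d3" "x - z"] by simp_all
  have R: "u * (x - y) - (d1 - d2) = 0" "v * (y - z) - (d2 - d3) = 0" "w * (x - z) - (d1 - d3) = 0"
    using reg by (simp_all add: uvw)
  define N where "N = real (Suc n) + 3 * k"
  have E: "N * hom (Suc n) x y z - (k * (hom (Suc n) y x z + hom (Suc n) x z y + hom (Suc n) z y x)
      + (x * a + y * b + z * c) * hom n x y z) = 0" for x y z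
    using hom_rec[of "Suc n" x y z] by (simp add: N_def)
  have F: "(N - 1) * hom n x y z - (k * (hom n y x z + hom n x z y + hom n z y x)
      + (x * a + y * b + z * c) * prev n x y z) = 0"
    using hom_rec[of n x y z] by (simp add: N_def algebra_simps)
  define h where "h = hom (Suc n)"
  define g where "g = hom n"
  define f where "f = prev n"
  \<comment> \<open>The certificate combines the recursion in degree n, weighted by the pairing of
    the direction with Y, the recursion in degree n + 1 at the point and its three reflections,
    weighted by u, v, w, and the relations u (x - y) = d1 - d2 and their analogues.\<close>
  have "N * grad (Suc n) x y z d1 d2 d3
    - (k * (grad (Suc n) y x z d2 d1 d3 + grad (Suc n) x z y d1 d3 d2 + grad (Suc n) z y x d3 d2 d1)
      + (d1 * a + d2 * b + d3 * c) * hom n x y z + (x * a + y * b + z * c) * grad n x y z d1 d2 d3)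
    = (d1 * a + d2 * b + d3 * c) * ((N - 1) * g x y z - (k * (g y x z + g x z y + g z y x)
      + (x * a + y * b + z * c) * f x y z))
     - k * (u + v + w) * (N * h x y z - (k * (h y x z + h x z y + h z y x) + (x * a + y * b + z * c) * g x y z))
     + k * u * (N * h y x z - (k * (h x y z + h y z x + h z x y) + (y * a + x * b + z * c) * g y x z))
     + k * v * (N * h x z y - (k * (h z x y + h x y z + h y z x) + (x * a + z * b + y * c) * g x z y))
     + k * w * (N * h z y x - (k * (h y z x + h z x y + h x y z) + (z * a + y * b + x * c) * g z y x))
     - k * (a - b) * g y x z * (u * (x - y) - (d1 - d2))
     - k * (b - c) * g x z y * (v * (y - z) - (d2 - d3))
     - k * (a - c) * g z y x * (w * (x - z) - (d1 - d3))"
    unfolding grad_def uvw[symmetric] uvw' prev_simps h_def[symmetric] g_def[symmetric] f_def[symmetric]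
    by (simp add: algebra_simps)
  also have "\<dots> = 0"
    unfolding h_def g_def f_def E F R by simp
  finally show ?thesis by (simp add: N_def)
qed

text \<open>Summing over even and over odd elements leaves a 2 by 2 system with determinant N^2 - 9
  k^2 > 0.\<close>

lemma mixing_trivial_kernel:
  fixes p1 :: real
  assumes N: "N > 3 * k"
    and "N * p1 = k * (q1 + q2 + q3)" "N * p2 = k * (q1 + q2 + q3)" "N * p3 = k * (q1 + q2 + q3)"
    and "N * q1 = k * (p1 + p2 + p3)" "N * q2 = k * (p1 + p2 + p3)" "N * q3 = k * (p1 + p2 + p3)"
  shows "p1 = 0"
proof -
  define S where "S = p1 + p2 + p3"
  define T where "T = q1 + q2 + q3"
  have 1: "N * S = 3 * k * T" "N * T = 3 * k * S"
    using assms(2-7) by (simp_all add: S_def T_def algebra_simps)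
  have "N * (N * T) = 3 * k * (3 * k * T)" unfolding 1(2) using 1(1) by simp
  then have "(N * N - (3 * k) * (3 * k)) * T = 0" by (simp add: algebra_simps)
  moreover have "N * N > (3 * k) * (3 * k)" using N k by (intro mult_strict_mono) auto
  ultimately have "T = 0" by simp
  then show ?thesis using assms(2) N k by (simp add: T_def)
qed

text \<open>The induction hypothesis makes the sources of the two recursions equal, so on the joint
  orbit of point and direction the error solves a homogeneous system whose only solution is
  zero.\<close>

lemma hom_grad:
  assumes "x \<noteq> y" "y \<noteq> z" "x \<noteq> z"
  shows "((\<lambda>t. hom n (x + t * d1) (y + t * d2) (z + t * d3)) has_real_derivative grad n x y z d1 d2 d3) (at 0)"
  using assms
proof (induction n arbitrary: x y z d1 d2 d3)
  case 0
  then show ?case by (simp add: grad_def)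
next
  case (Suc n)
  define D where "D x y z d1 d2 d3 = deriv (\<lambda>t. hom (Suc n) (x + t * d1) (y + t * d2) (z + t * d3)) 0"
    for x y z d1 d2 d3
  have D: "((\<lambda>t. hom (Suc n) (x + t * d1) (y + t * d2) (z + t * d3)) has_real_derivative D x y z d1 d2 d3) (at 0)"
    for x y z d1 d2 d3
    unfolding D_def DERIV_deriv_iff_field_differentiable by (rule hom_differentiable)
  define N where "N = real (Suc n) + 3 * k"
  have rec: "N * D x y z d1 d2 d3 = k * (D y x z d2 d1 d3 + D x z y d1 d3 d2 + D z y x d3 d2 d1)
      + (d1 * a + d2 * b + d3 * c) * hom n x y z + (x * a + y * b + z * c) * grad n x y z d1 d2 d3"
    if reg: "x \<noteq> y" "y \<noteq> z" "x \<noteq> z" for x y z d1 d2 d3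
  proof (rule DERIV_unique)
    show "((\<lambda>t. N * hom (Suc n) (x + t * d1) (y + t * d2) (z + t * d3)) has_real_derivative
      N * D x y z d1 d2 d3) (at 0)"
      by (rule DERIV_cmult[OF D])
    have "((\<lambda>t. k * (hom (Suc n) (y + t * d2) (x + t * d1) (z + t * d3)
          + hom (Suc n) (x + t * d1) (z + t * d3) (y + t * d2)
          + hom (Suc n) (z + t * d3) (y + t * d2) (x + t * d1))
        + ((x + t * d1) * a + (y + t * d2) * b + (z + t * d3) * c) * hom n (x + t * d1) (y + t * d2) (z + t * d3))
      has_real_derivative k * (D y x z d2 d1 d3 + D x z y d1 d3 d2 + D z y x d3 d2 d1)
        + ((d1 * a + d2 * b + d3 * c) * hom n (x + 0 * d1) (y + 0 * d2) (z + 0 * d3)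
          + grad n x y z d1 d2 d3 * ((x + 0 * d1) * a + (y + 0 * d2) * b + (z + 0 * d3) * c))) (at 0)"
      by (intro DERIV_add DERIV_cmult DERIV_mult D Suc.IH reg) (auto intro!: derivative_eq_intros)
    then show "((\<lambda>t. N * hom (Suc n) (x + t * d1) (y + t * d2) (z + t * d3)) has_real_derivative
      k * (D y x z d2 d1 d3 + D x z y d1 d3 d2 + D z y x d3 d2 d1)
        + (d1 * a + d2 * b + d3 * c) * hom n x y z + (x * a + y * b + z * c) * grad n x y z d1 d2 d3) (at 0)"
      unfolding N_def hom_rec prev_simps by (simp add: algebra_simps)
  qed
  define e where "e x y z d1 d2 d3 = D x y z d1 d2 d3 - grad (Suc n) x y z d1 d2 d3" for x y z d1 d2 d3
  have e: "N * e x y z d1 d2 d3 = k * (e y x z d2 d1 d3 + e x z y d1 d3 d2 + e z y x d3 d2 d1)"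
    if "x \<noteq> y" "y \<noteq> z" "x \<noteq> z" for x y z d1 d2 d3
    using rec[OF that] grad_rec[OF that, of n] by (simp add: e_def N_def algebra_simps)
  note ne = Suc.prems Suc.prems[symmetric]
  have "e x y z d1 d2 d3 = 0"
  proof (rule mixing_trivial_kernel[of N])
    show "N > 3 * k" by (simp add: N_def)
    show "N * e x y z d1 d2 d3 = k * (e y x z d2 d1 d3 + e x z y d1 d3 d2 + e z y x d3 d2 d1)"
      by (rule e[OF Suc.prems])
    show "N * e y z x d2 d3 d1 = k * (e y x z d2 d1 d3 + e x z y d1 d3 d2 + e z y x d3 d2 d1)"
      "N * e z x y d3 d1 d2 = k * (e y x z d2 d1 d3 + e x z y d1 d3 d2 + e z y x d3 d2 d1)"
      "N * e y x z d2 d1 d3 = k * (e x y z d1 d2 d3 + e y z x d2 d3 d1 + e z x y d3 d1 d2)"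
      "N * e x z y d1 d3 d2 = k * (e x y z d1 d2 d3 + e y z x d2 d3 d1 + e z x y d3 d1 d2)"
      "N * e z y x d3 d2 d1 = k * (e x y z d1 d2 d3 + e y z x d2 d3 d1 + e z x y d3 d1 d2)"
      by (subst e, (rule ne)+, simp)+
  qed
  then show ?case using D[of x d1 y d2 z d3] by (simp add: e_def)
qed

end

section \<open>Double power series\<close>

text \<open>A Wiener-type norm: M bounds the sum of the absolute coefficients. It behaves well under
  affine factors and infinite sums, whereas pointwise bounds for real arguments would not pass
  analyticity to a limit. Radius 1 is enough because the affine substitutions stay
  arbitrary.\<close>

definition dps :: "real \<Rightarrow> (real \<Rightarrow> real \<Rightarrow> real) \<Rightarrow> bool" where
  "dps M h \<longleftrightarrow> (\<exists>(c :: nat \<times> nat \<Rightarrow> real) S. S \<le> M \<and> ((\<lambda>p. norm (c p)) has_sum S) UNIV \<and>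
     (\<forall>s t. \<bar>s\<bar> \<le> 1 \<longrightarrow> \<bar>t\<bar> \<le> 1 \<longrightarrow> ((\<lambda>p. c p * s ^ fst p * t ^ snd p) has_sum h s t) UNIV))"

lemma dpsI:
  fixes c :: "nat \<times> nat \<Rightarrow> real"
  assumes "(B has_sum S) UNIV" "S \<le> M" "\<And>p. norm (c p) \<le> B p"
    and "\<And>s t. \<bar>s\<bar> \<le> 1 \<Longrightarrow> \<bar>t\<bar> \<le> 1 \<Longrightarrow> ((\<lambda>p. c p * s ^ fst p * t ^ snd p) has_sum h s t) UNIV"
  shows "dps M h"
proof -
  have "(\<lambda>p. norm (c p)) summable_on UNIV"
    using assms(1,3) by (intro Infinite_Sum.abs_summable_on_comparison_test'[of B]) (auto intro: has_sum_imp_summable)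
  then have s: "((\<lambda>p. norm (c p)) has_sum (\<Sum>\<^sub>\<infinity>p. norm (c p))) UNIV" by simp
  moreover have "(\<Sum>\<^sub>\<infinity>p. norm (c p)) \<le> M"
    using has_sum_mono[OF s assms(1)] assms(2,3) by auto
  ultimately show ?thesis unfolding dps_def using assms(4) by blast
qed

lemma dpsE:
  assumes "dps M h"
  obtains c :: "nat \<times> nat \<Rightarrow> real" and S where "S \<le> M" "((\<lambda>p. norm (c p)) has_sum S) UNIV"
    "\<And>s t. \<bar>s\<bar> \<le> 1 \<Longrightarrow> \<bar>t\<bar> \<le> 1 \<Longrightarrow> ((\<lambda>p. c p * s ^ fst p * t ^ snd p) has_sum h s t) UNIV"
  using assms unfolding dps_def by blast

lemma dps_mono: "dps M h \<Longrightarrow> M \<le> M' \<Longrightarrow> dps M' h"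
  unfolding dps_def by (meson order_trans)

lemma dps_const: "dps \<bar>v\<bar> (\<lambda>s t. v)"
proof (rule dpsI[where c = "\<lambda>p. if p = (0, 0) then v else 0" and B = "\<lambda>p. if p = (0, 0) then \<bar>v\<bar> else 0"])
  show "((\<lambda>p. if p = (0::nat, 0::nat) then \<bar>v\<bar> else 0) has_sum \<bar>v\<bar>) UNIV"
    by (rule has_sum_finite_neutralI[of "{(0, 0)}"]) auto
  show "((\<lambda>p. (if p = (0, 0) then v else 0) * s ^ fst p * t ^ snd p) has_sum v) UNIV" for s t
    by (rule has_sum_finite_neutralI[of "{(0, 0)}"]) auto
qed auto

lemma dps_add:
  assumes "dps M g" "dps N h"
  shows "dps (M + N) (\<lambda>s t. g s t + h s t)"
proof -
  from assms(1) obtain c S where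
    c: "S \<le> M" "((\<lambda>p. norm (c p)) has_sum S) UNIV"
      "\<And>s t. \<bar>s\<bar> \<le> 1 \<Longrightarrow> \<bar>t\<bar> \<le> 1 \<Longrightarrow> ((\<lambda>p. c p * s ^ fst p * t ^ snd p) has_sum g s t) UNIV"
    by (rule dpsE) blast
  from assms(2) obtain d T where
    d: "T \<le> N" "((\<lambda>p. norm (d p)) has_sum T) UNIV"
      "\<And>s t. \<bar>s\<bar> \<le> 1 \<Longrightarrow> \<bar>t\<bar> \<le> 1 \<Longrightarrow> ((\<lambda>p. d p * s ^ fst p * t ^ snd p) has_sum h s t) UNIV"
    by (rule dpsE) blast
  show ?thesis
  proof (rule dpsI[where c = "\<lambda>p. c p + d p"])
    show "((\<lambda>p. norm (c p) + norm (d p)) has_sum (S + T)) UNIV" by (rule has_sum_add[OF c(2) d(2)])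
    show "((\<lambda>p. (c p + d p) * s ^ fst p * t ^ snd p) has_sum g s t + h s t) UNIV"
      if "\<bar>s\<bar> \<le> 1" "\<bar>t\<bar> \<le> 1" for s t
      using has_sum_add[OF c(3)[OF that] d(3)[OF that]] by (simp add: algebra_simps)
  qed (use c d in \<open>auto intro: norm_triangle_ineq\<close>)
qed

lemma dps_cmult:
  assumes "dps M g"
  shows "dps (\<bar>v\<bar> * M) (\<lambda>s t. v * g s t)"
proof -
  from assms(1) obtain c S where
    c: "S \<le> M" "((\<lambda>p. norm (c p)) has_sum S) UNIV"
      "\<And>s t. \<bar>s\<bar> \<le> 1 \<Longrightarrow> \<bar>t\<bar> \<le> 1 \<Longrightarrow> ((\<lambda>p. c p * s ^ fst p * t ^ snd p) has_sum g s t) UNIV"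
    by (rule dpsE) blast
  show ?thesis
  proof (rule dpsI[where c = "\<lambda>p. v * c p"])
    show "((\<lambda>p. \<bar>v\<bar> * norm (c p)) has_sum (\<bar>v\<bar> * S)) UNIV" by (rule has_sum_cmult_right[OF c(2)])
    show "((\<lambda>p. v * c p * s ^ fst p * t ^ snd p) has_sum v * g s t) UNIV"
      if "\<bar>s\<bar> \<le> 1" "\<bar>t\<bar> \<le> 1" for s t
      using has_sum_cmult_right[OF c(3)[OF that]] by (simp add: mult.assoc)
  qed (use c in \<open>auto intro: mult_left_mono simp: abs_mult\<close>)
qed

lemma has_sum_shift:
  fixes f :: "'a \<Rightarrow> real"
  assumes "inj e" "\<And>p. p \<notin> range e \<Longrightarrow> g p = 0" "\<And>p. g (e p) = f p" "(f has_sum S) UNIV"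
  shows "(g has_sum S) UNIV"
proof -
  have "(g has_sum S) (range e)"
    using assms by (subst has_sum_reindex) (auto simp: o_def)
  then show ?thesis
    by (subst has_sum_cong_neutral[of "range e" UNIV g g]) (use assms in auto)
qed

text \<open>In use, e raises one exponent and u is the corresponding variable; moving coefficients
  along an injection preserves their absolute sum.\<close>

lemma dps_shift:
  fixes e :: "nat \<times> nat \<Rightarrow> nat \<times> nat"
  assumes "dps M g" "inj e" "\<And>p s t. s ^ fst (e p) * t ^ snd (e p) = u s t * (s ^ fst p * t ^ snd p)"
  shows "dps M (\<lambda>s t. u s t * g s t)"
proof -
  from assms(1) obtain c S where
    c: "S \<le> M" "((\<lambda>p. norm (c p)) has_sum S) UNIV"
      "\<And>s t. \<bar>s\<bar> \<le> 1 \<Longrightarrow> \<bar>t\<bar> \<le> 1 \<Longrightarrow> ((\<lambda>p. c p * s ^ fst p * t ^ snd p) has_sum g s t) UNIV"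
    by (rule dpsE) blast
  define d where "d p = (if p \<in> range e then c (inv e p) else 0)" for p
  have d: "p \<notin> range e \<Longrightarrow> d p = 0" "d (e p) = c p" for p
    using assms(2) by (auto simp: d_def)
  show ?thesis
  proof (rule dpsI[where c = d])
    show "((\<lambda>p. norm (d p)) has_sum S) UNIV"
      by (rule has_sum_shift[OF assms(2) _ _ c(2)]) (auto simp: d)
    show "((\<lambda>p. d p * s ^ fst p * t ^ snd p) has_sum u s t * g s t) UNIV"
      if "\<bar>s\<bar> \<le> 1" "\<bar>t\<bar> \<le> 1" for s t
      by (rule has_sum_shift[OF assms(2) _ _ has_sum_cmult_right[OF c(3)[OF that], of "u s t"]])
        (auto simp: d mult.assoc assms(3))
  qed (use c in auto)
qed

lemma dps_mult_affine:
  assumes "dps M g" "M \<ge> 0" "\<bar>p\<bar> + \<bar>q\<bar> + \<bar>r\<bar> \<le> K"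
  shows "dps (K * M) (\<lambda>s t. (p + q * s + r * t) * g s t)"
proof -
  have 1: "dps M (\<lambda>s t. s * g s t)"
    by (rule dps_shift[OF assms(1), of "\<lambda>p. (Suc (fst p), snd p)"]) (auto simp: inj_on_def prod_eq_iff)
  have 2: "dps M (\<lambda>s t. t * g s t)"
    by (rule dps_shift[OF assms(1), of "\<lambda>p. (fst p, Suc (snd p))"]) (auto simp: inj_on_def prod_eq_iff)
  have "dps (\<bar>p\<bar> * M + \<bar>q\<bar> * M + \<bar>r\<bar> * M) (\<lambda>s t. p * g s t + q * (s * g s t) + r * (t * g s t))"
    by (intro dps_add dps_cmult assms(1) 1 2)
  then have "dps ((\<bar>p\<bar> + \<bar>q\<bar> + \<bar>r\<bar>) * M) (\<lambda>s t. (p + q * s + r * t) * g s t)"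
    by (simp add: algebra_simps)
  then show ?thesis
    by (rule dps_mono) (rule mult_right_mono[OF assms(3,2)])
qed

text \<open>Evaluation at the centre is enough, because \<open>hom_dps\<close> admits any point as
  the centre.\<close>

lemma dps_bound:
  assumes "dps M g"
  shows "\<bar>g 0 0\<bar> \<le> M"
proof -
  from assms(1) obtain c S where
    c: "S \<le> M" "((\<lambda>p. norm (c p)) has_sum S) UNIV"
      "\<And>s t. \<bar>s\<bar> \<le> 1 \<Longrightarrow> \<bar>t\<bar> \<le> 1 \<Longrightarrow> ((\<lambda>p. c p * s ^ fst p * t ^ snd p) has_sum g s t) UNIV"
    by (rule dpsE) blast
  have "(\<lambda>p. norm (c p)) summable_on UNIV" using c(2) by (rule has_sum_imp_summable)
  then have "(\<lambda>p. norm (c p * 0 ^ fst p * 0 ^ snd p)) summable_on UNIV"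
    by (rule Infinite_Sum.abs_summable_on_comparison_test') (auto simp: power_0_left)
  then have s: "((\<lambda>p. norm (c p * 0 ^ fst p * 0 ^ snd p)) has_sum
      (\<Sum>\<^sub>\<infinity>p. norm (c p * 0 ^ fst p * 0 ^ snd p))) UNIV" by simp
  have "norm (g 0 0) \<le> (\<Sum>\<^sub>\<infinity>p. norm (c p * 0 ^ fst p * 0 ^ snd p))"
    by (rule norm_has_sum_bound[OF s c(3)]) auto
  also have "\<dots> \<le> S" by (rule has_sum_mono[OF s c(2)]) (auto simp: power_0_left)
  finally show ?thesis using c(1) by simp
qed

text \<open>The coefficients of the sum are the sums over n at fixed exponents; absolute summability
  over all pairs of n and an exponent pair permits exchanging the order.\<close>

lemma dps_suminf:
  assumes h: "\<And>n::nat. dps (M n) (h n)" and M: "summable M"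
  shows "dps (suminf M) (\<lambda>s t. \<Sum>n. h n s t)"
proof -
  have "\<exists>c S. \<forall>n. S n \<le> M n \<and> ((\<lambda>p. norm (c n p)) has_sum S n) UNIV \<and>
     (\<forall>s t. \<bar>s\<bar> \<le> 1 \<longrightarrow> \<bar>t\<bar> \<le> 1 \<longrightarrow>
       ((\<lambda>p :: nat \<times> nat. c n p * s ^ fst p * t ^ snd p) has_sum h n s t) UNIV)"
    using h unfolding dps_def by (subst choice_iff[symmetric])+ blast
  then obtain c S where
    c: "\<And>n. S n \<le> M n" "\<And>n. ((\<lambda>p. norm (c n p)) has_sum S n) UNIV"
      "\<And>n s t. \<bar>s\<bar> \<le> 1 \<Longrightarrow> \<bar>t\<bar> \<le> 1 \<Longrightarrow> ((\<lambda>p. c n p * s ^ fst p * t ^ snd p) has_sum h n s t) UNIV"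
    by blast
  have S0: "S n \<ge> 0" for n using has_sum_nonneg[OF c(2)] by simp
  have sS: "summable S"
    using M c(1) S0 by (intro summable_comparison_test'[OF M, of 0]) auto
  have infS: "(\<Sum>\<^sub>\<infinity>p. norm (c n p)) = S n" for n using infsumI[OF c(2)] .
  have joint: "(\<lambda>x. norm (case x of (n, p) \<Rightarrow> c n p)) summable_on UNIV \<times> UNIV"
    unfolding Infinite_Sum.abs_summable_on_Sigma_iff
  proof (intro conjI ballI)
    show "(\<lambda>p. norm (case (n, p) of (n, p) \<Rightarrow> c n p)) summable_on UNIV" for n
      using has_sum_imp_summable[OF c(2)] by simp
    show "(\<lambda>n. norm (\<Sum>\<^sub>\<infinity>p. norm (case (n, p) of (n, p) \<Rightarrow> c n p))) summable_on UNIV"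
      using sS S0 by (simp add: infS[simplified] summable_on_UNIV_nonneg_real_iff)
  qed
  have jsum: "((\<lambda>x. norm (case x of (n, p) \<Rightarrow> c n p)) has_sum suminf S) (UNIV \<times> UNIV)"
  proof (rule has_sum_SigmaI[OF _ _ joint])
    show "((\<lambda>p. norm (case (n, p) of (n, p) \<Rightarrow> c n p)) has_sum S n) UNIV" for n
      using c(2) by simp
    show "(S has_sum suminf S) UNIV"
      using sS S0 by (intro norm_summable_imp_has_sum) (auto intro: summable_sums)
  qed
  have jswap: "((\<lambda>(p, n). norm (c n p)) has_sum suminf S) (UNIV \<times> UNIV)"
    using jsum by (subst has_sum_swap) (simp add: case_prod_unfold)
  have inner: "(\<lambda>n. norm (c n p)) summable_on UNIV" for p
    using summable_on_SigmaD1[of "\<lambda>p n. norm (c n p)" UNIV "\<lambda>_. UNIV" p] jswap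
    by (auto dest: has_sum_imp_summable)
  have outer: "((\<lambda>p. \<Sum>\<^sub>\<infinity>n. norm (c n p)) has_sum suminf S) UNIV"
    by (rule has_sum_SigmaD[OF jswap]) (use inner in auto)
  show ?thesis
  proof (rule dpsI[OF outer, where c = "\<lambda>p. \<Sum>\<^sub>\<infinity>n. c n p"])
    show "suminf S \<le> suminf M" using c(1) sS M by (intro suminf_le)
    show "norm (\<Sum>\<^sub>\<infinity>n. c n p) \<le> (\<Sum>\<^sub>\<infinity>n. norm (c n p))" for p
      by (rule norm_infsum_bound[OF inner])
    fix s t :: real assume st: "\<bar>s\<bar> \<le> 1" "\<bar>t\<bar> \<le> 1"
    have le1: "\<bar>s ^ i * t ^ j\<bar> \<le> 1" for i j
      using st by (simp add: abs_mult power_abs mult_le_one power_le_one)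
    have nle: "norm (c n p * s ^ fst p * t ^ snd p) \<le> norm (c n p)" for n p
      using mult_left_mono[OF le1[of "fst p" "snd p"], of "\<bar>c n p\<bar>"] by (simp add: abs_mult mult.assoc)
    let ?f = "\<lambda>(n, p). c n p * s ^ fst p * t ^ snd p"
    have "(\<lambda>x. norm (?f x)) summable_on UNIV \<times> UNIV"
      by (rule Infinite_Sum.abs_summable_on_comparison_test'[OF joint]) (use nle in auto)
    then have sf: "?f summable_on UNIV \<times> UNIV" by (rule abs_summable_summable)
    define X where "X = infsum ?f (UNIV \<times> UNIV)"
    have X: "(?f has_sum X) (UNIV \<times> UNIV)" using sf by (simp add: X_def)
    have "((\<lambda>n. h n s t) has_sum X) UNIV"
      by (rule has_sum_SigmaD[OF X]) (use c(3)[OF st] in auto)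
    then have Xeq: "X = (\<Sum>n. h n s t)" using has_sum_imp_sums sums_unique by blast
    have X': "((\<lambda>(p, n). c n p * s ^ fst p * t ^ snd p) has_sum X) (UNIV \<times> UNIV)"
      using X by (subst has_sum_swap) (simp add: case_prod_unfold)
    have cs: "(\<lambda>n. c n p) summable_on UNIV" for p
      using abs_summable_summable[OF inner] .
    have "((\<lambda>p. (\<Sum>\<^sub>\<infinity>n. c n p) * s ^ fst p * t ^ snd p) has_sum X) UNIV"
    proof (rule has_sum_SigmaD[OF X'])
      show "((\<lambda>n. case (p, n) of (p, n) \<Rightarrow> c n p * s ^ fst p * t ^ snd p) has_sum
        (\<Sum>\<^sub>\<infinity>n. c n p) * s ^ fst p * t ^ snd p) UNIV" for p
        using has_sum_cmult_left[OF has_sum_infsum[OF cs[of p]], of "s ^ fst p * t ^ snd p"]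
        by (simp add: mult.assoc)
    qed
    then show "((\<lambda>p. (\<Sum>\<^sub>\<infinity>n. c n p) * s ^ fst p * t ^ snd p) has_sum (\<Sum>n. h n s t)) UNIV"
      unfolding Xeq .
  qed
qed

lemma add_sum_bounds:
  fixes p q r :: real
  assumes "p \<ge> 0" "q \<ge> 0" "r \<ge> 0"
  shows "p \<le> p + q + r" "q \<le> p + q + r" "r \<le> p + q + r"
  using assms by simp_all

section \<open>Factorial bounds and the kernel as an entire series\<close>

context dunkl_series
begin

text \<open>Each degree multiplies by a linear form of norm at most m and then applies
  \<open>resolv\<close>, of norm 1 / n. The coordinates remain arbitrary affine functions in the
  induction because \<open>resolv\<close> permutes them.\<close>

lemma hom_dps:
  assumes "\<bar>x0\<bar> + \<bar>x1\<bar> + \<bar>x2\<bar> \<le> K" "\<bar>y0\<bar> + \<bar>y1\<bar> + \<bar>y2\<bar> \<le> K" "\<bar>z0\<bar> + \<bar>z1\<bar> + \<bar>z2\<bar> \<le> K"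
  defines "m \<equiv> K * (\<bar>a\<bar> + \<bar>b\<bar> + \<bar>c\<bar>)"
  shows "dps (m ^ n / fact n)
    (\<lambda>s t. hom n (x0 + x1 * s + x2 * t) (y0 + y1 * s + y2 * t) (z0 + z1 * s + z2 * t))"
  using assms(1-3)
proof (induction n arbitrary: x0 x1 x2 y0 y1 y2 z0 z1 z2)
  case 0
  then show ?case using dps_const[of 1] by simp
next
  case (Suc n)
  have K0: "K \<ge> 0" using Suc.prems(1) by linarith
  have m0: "m \<ge> 0" using K0 by (simp add: m_def)
  define g where "g x y z = (x * a + y * b + z * c) * hom n x y z" for x y z
  have g: "dps (m * (m ^ n / fact n))
      (\<lambda>s t. g (x0 + x1 * s + x2 * t) (y0 + y1 * s + y2 * t) (z0 + z1 * s + z2 * t))"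
    if "\<bar>x0\<bar> + \<bar>x1\<bar> + \<bar>x2\<bar> \<le> K" "\<bar>y0\<bar> + \<bar>y1\<bar> + \<bar>y2\<bar> \<le> K" "\<bar>z0\<bar> + \<bar>z1\<bar> + \<bar>z2\<bar> \<le> K"
    for x0 x1 x2 y0 y1 y2 z0 z1 z2
  proof -
    have "\<bar>x0 * a + y0 * b + z0 * c\<bar> + \<bar>x1 * a + y1 * b + z1 * c\<bar> + \<bar>x2 * a + y2 * b + z2 * c\<bar>
      \<le> (\<bar>x0\<bar> + \<bar>x1\<bar> + \<bar>x2\<bar>) * \<bar>a\<bar> + (\<bar>y0\<bar> + \<bar>y1\<bar> + \<bar>y2\<bar>) * \<bar>b\<bar> + (\<bar>z0\<bar> + \<bar>z1\<bar> + \<bar>z2\<bar>) * \<bar>c\<bar>"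
    proof -
      have "\<bar>x * a + y * b + z * c\<bar> \<le> \<bar>x\<bar> * \<bar>a\<bar> + \<bar>y\<bar> * \<bar>b\<bar> + \<bar>z\<bar> * \<bar>c\<bar>" for x y z
        using abs_triangle_ineq[of "x * a + y * b" "z * c"] abs_triangle_ineq[of "x * a" "y * b"]
        by (simp add: abs_mult)
      from this[of x0 y0 z0] this[of x1 y1 z1] this[of x2 y2 z2]
      show ?thesis by (simp add: algebra_simps)
    qed
    also have "\<dots> \<le> K * \<bar>a\<bar> + K * \<bar>b\<bar> + K * \<bar>c\<bar>"
      using that by (intro add_mono mult_right_mono) auto
    finally have le: "\<bar>x0 * a + y0 * b + z0 * c\<bar> + \<bar>x1 * a + y1 * b + z1 * c\<bar> + \<bar>x2 * a + y2 * b + z2 * c\<bar> \<le> m"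
      by (simp add: m_def algebra_simps)
    have eq: "(\<lambda>s t. g (x0 + x1 * s + x2 * t) (y0 + y1 * s + y2 * t) (z0 + z1 * s + z2 * t))
      = (\<lambda>s t. ((x0 * a + y0 * b + z0 * c) + (x1 * a + y1 * b + z1 * c) * s + (x2 * a + y2 * b + z2 * c) * t)
         * hom n (x0 + x1 * s + x2 * t) (y0 + y1 * s + y2 * t) (z0 + z1 * s + z2 * t))"
      by (intro ext) (simp add: g_def algebra_simps)
    show ?thesis unfolding eq using m0 by (intro dps_mult_affine[OF Suc.IH[OF that]] le) auto
  qed
  define G where "G = m * (m ^ n / fact n)"
  note gs = g[folded G_def]
  let ?n = "Suc n"
  have "dps (\<bar>cr ?n\<bar> * G + \<bar>cp ?n\<bar> * (G + G + G) + \<bar>cq ?n\<bar> * (G + G + G))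
    (\<lambda>s t. resolv ?n g (x0 + x1 * s + x2 * t) (y0 + y1 * s + y2 * t) (z0 + z1 * s + z2 * t))"
    unfolding resolv_def by (intro dps_add dps_cmult gs Suc.prems)
  moreover have "\<bar>cr ?n\<bar> * G + \<bar>cp ?n\<bar> * (G + G + G) + \<bar>cq ?n\<bar> * (G + G + G) = m ^ ?n / fact ?n"
  proof -
    have "\<bar>cr ?n\<bar> * G + \<bar>cp ?n\<bar> * (G + G + G) + \<bar>cq ?n\<bar> * (G + G + G)
      = (cr ?n + 3 * cp ?n + 3 * cq ?n) * G"
      using coeffs_nonneg[of ?n] by (simp add: algebra_simps)
    then show ?thesis using coeffs_sum[of ?n] by (simp add: G_def)
  qed
  ultimately show ?case unfolding hom.simps g_def by simp
qed

lemma hom_bound: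
  assumes "\<bar>x\<bar> \<le> K" "\<bar>y\<bar> \<le> K" "\<bar>z\<bar> \<le> K"
  shows "\<bar>hom n x y z\<bar> \<le> (K * (\<bar>a\<bar> + \<bar>b\<bar> + \<bar>c\<bar>)) ^ n / fact n"
  using dps_bound[OF hom_dps[of x 0 0 K y 0 0 z 0 0 n]] assms by simp

lemma summable_exp_majorant: "summable (\<lambda>n. (m::real) ^ n / fact n)"
  using summable_exp[of m] by (simp add: divide_inverse mult.commute)

lemma hom_summable: "summable (\<lambda>n. hom n x y z)"
proof -
  have "\<bar>x\<bar> \<le> max \<bar>x\<bar> (max \<bar>y\<bar> \<bar>z\<bar>)" "\<bar>y\<bar> \<le> max \<bar>x\<bar> (max \<bar>y\<bar> \<bar>z\<bar>)" "\<bar>z\<bar> \<le> max \<bar>x\<bar> (max \<bar>y\<bar> \<bar>z\<bar>)" by auto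
  from hom_bound[OF this] show ?thesis
    by (intro summable_comparison_test'[OF summable_exp_majorant, of 0]) auto
qed

definition ker :: "real \<Rightarrow> real \<Rightarrow> real \<Rightarrow> real" where
  "ker x y z = (\<Sum>n. hom n x y z)"

lemma hom_sums: "(\<lambda>n. hom n x y z) sums ker x y z"
  unfolding ker_def using hom_summable by (rule summable_sums)

lemma prev_sums: "(\<lambda>n. prev n x y z) sums ker x y z"
  using sums_Suc[of "\<lambda>n. prev n x y z" "ker x y z"] hom_sums by simp

lemma ker_zero: "ker 0 0 0 = 1"
proof -
  have "hom n 0 0 0 = (if n = 0 then 1 else 0)" for n
    using hom_homogeneous[of n 0 0 0 0] by (cases n) simp_all
  then have "ker 0 0 0 = (\<Sum>n. if n = 0 then 1 else 0)" unfolding ker_def by simp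
  also have "\<dots> = 1" using sums_unique[OF sums_single[of 0 "\<lambda>_. 1::real"]] by simp
  finally show ?thesis .
qed

lemma ker_dps: "\<exists>M. dps M (\<lambda>s t. ker (x0 + x1 * s + x2 * t) (y0 + y1 * s + y2 * t) (z0 + z1 * s + z2 * t))"
proof -
  define K where "K = (\<bar>x0\<bar> + \<bar>x1\<bar> + \<bar>x2\<bar>) + (\<bar>y0\<bar> + \<bar>y1\<bar> + \<bar>y2\<bar>) + (\<bar>z0\<bar> + \<bar>z1\<bar> + \<bar>z2\<bar>)"
  have "\<bar>x0\<bar> + \<bar>x1\<bar> + \<bar>x2\<bar> \<le> K" "\<bar>y0\<bar> + \<bar>y1\<bar> + \<bar>y2\<bar> \<le> K" "\<bar>z0\<bar> + \<bar>z1\<bar> + \<bar>z2\<bar> \<le> K"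
    unfolding K_def by (rule add_sum_bounds; simp)+
  from dps_suminf[OF hom_dps[OF this] summable_exp_majorant] show ?thesis
    unfolding ker_def by blast
qed

text \<open>By homogeneity t d/dt multiplies degree n by n, so this is \<open>hom_rec\<close> summed
  over n. No root value is divided by, so the ray may lie in a wall.\<close>

lemma ker_ray:
  assumes t: "t > 0"
  shows "euler_deriv (\<lambda>t. ker (t * x) (t * y) (t * z))
    (k * (ker (t * y) (t * x) (t * z) + ker (t * x) (t * z) (t * y) + ker (t * z) (t * y) (t * x))
      - (3 * k - t * (x * a + y * b + z * c)) * ker (t * x) (t * y) (t * z)) t"
proof -
  define h where "h n = hom n x y z" for n
  have ker: "ker (t * x) (t * y) (t * z) = (\<Sum>n. hom n x y z * t ^ n)" for t x y z
    unfolding ker_def hom_homogeneous by (simp add: mult.commute)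
  have sm: "summable (\<lambda>n. hom n x y z * t ^ n)" for t x y z
    using hom_summable[of "t * x" "t * y" "t * z"] by (simp add: hom_homogeneous mult.commute)
  have sums: "(\<lambda>n. hom n x y z * t ^ n) sums ker (t * x) (t * y) (t * z)" for t x y z
    unfolding ker using sm by (rule summable_sums)
  have psums: "(\<lambda>n. prev n x y z * t ^ n) sums (t * ker (t * x) (t * y) (t * z))"
    using sums_Suc[of "\<lambda>n. prev n x y z * t ^ n"] sums_mult[OF sums[where t = t and x = x and y = y and z = z], of t]
    by (simp add: mult_ac)
  have der: "((\<lambda>t. ker (t * x) (t * y) (t * z)) has_real_derivative (\<Sum>n. diffs h n * t ^ n)) (at t)"
    unfolding ker h_def[symmetric]
    by (rule termdiffs_strong_converges_everywhere) (use sm in \<open>simp add: h_def\<close>)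
  have "summable (\<lambda>n. diffs h n * t ^ n)"
    by (rule termdiff_converges_all) (use sm in \<open>simp add: h_def\<close>)
  from sums_mult[OF diffs_equiv[OF this], of t]
  have "(\<lambda>n. real n * hom n x y z * t ^ n) sums (t * (\<Sum>n. diffs h n * t ^ n))"
  proof (rule sums_cong[THEN iffD1, rotated])
    show "t * (real n * h n * t ^ (n - Suc 0)) = real n * hom n x y z * t ^ n" for n
      by (cases n) (simp_all add: h_def mult_ac)
  qed
  moreover have "(\<lambda>n. real n * hom n x y z * t ^ n) sums
    (k * (ker (t * y) (t * x) (t * z) + ker (t * x) (t * z) (t * y) + ker (t * z) (t * y) (t * x))
      - 3 * k * ker (t * x) (t * y) (t * z) + (x * a + y * b + z * c) * (t * ker (t * x) (t * y) (t * z)))"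
  proof (rule sums_cong[THEN iffD1, rotated])
    show "(\<lambda>n. k * (hom n y x z * t ^ n + hom n x z y * t ^ n + hom n z y x * t ^ n)
        - 3 * k * (hom n x y z * t ^ n) + (x * a + y * b + z * c) * (prev n x y z * t ^ n)) sums
      (k * (ker (t * y) (t * x) (t * z) + ker (t * x) (t * z) (t * y) + ker (t * z) (t * y) (t * x))
      - 3 * k * ker (t * x) (t * y) (t * z) + (x * a + y * b + z * c) * (t * ker (t * x) (t * y) (t * z)))"
      by (intro sums_add sums_diff sums_mult sums psums)
    show "k * (hom n y x z * t ^ n + hom n x z y * t ^ n + hom n z y x * t ^ n)
        - 3 * k * (hom n x y z * t ^ n) + (x * a + y * b + z * c) * (prev n x y z * t ^ n)
      = real n * hom n x y z * t ^ n" for n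
    proof -
      have "real n * hom n x y z = k * (hom n y x z + hom n x z y + hom n z y x)
        - 3 * k * hom n x y z + (x * a + y * b + z * c) * prev n x y z"
        using hom_rec[of n x y z] by (simp add: algebra_simps)
      then show ?thesis by (simp only:) (simp add: algebra_simps)
    qed
  qed
  ultimately have "t * (\<Sum>n. diffs h n * t ^ n) =
    k * (ker (t * y) (t * x) (t * z) + ker (t * x) (t * z) (t * y) + ker (t * z) (t * y) (t * x))
      - 3 * k * ker (t * x) (t * y) (t * z) + (x * a + y * b + z * c) * (t * ker (t * x) (t * y) (t * z))"
    by (rule sums_unique2)
  then have eq: "k * (ker (t * y) (t * x) (t * z) + ker (t * x) (t * z) (t * y) + ker (t * z) (t * y) (t * x))
      - (3 * k - t * (x * a + y * b + z * c)) * ker (t * x) (t * y) (t * z) = t * (\<Sum>n. diffs h n * t ^ n)"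
    by (simp add: algebra_simps)
  show ?thesis unfolding eq using der t by (simp add: euler_deriv_def)
qed

lemma ker_ray_continuous: "continuous_on UNIV (\<lambda>t. ker (t * x) (t * y) (t * z))"
proof -
  have ker: "ker (t * x) (t * y) (t * z) = (\<Sum>n. hom n x y z * t ^ n)" for t
    unfolding ker_def hom_homogeneous by (simp add: mult.commute)
  have "summable (\<lambda>n. hom n x y z * t ^ n)" for t
    using hom_summable[of "t * x" "t * y" "t * z"] by (simp add: hom_homogeneous mult.commute)
  from termdiffs_strong_converges_everywhere[OF this]
  show ?thesis unfolding ker by (auto intro!: continuous_at_imp_continuous_on DERIV_isCont)
qed

end

section \<open>Existence and uniqueness of the Dunkl kernel\<close>

context dunkl_series
begin

text \<open>Termwise differentiation. The work lies in a summable majorant for \<open>grad\<close>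
  on a whole interval around 0, on which its denominators must stay away from zero.\<close>

lemma ker_grad:
  assumes reg: "x \<noteq> y" "y \<noteq> z" "x \<noteq> z"
  shows "((\<lambda>t. ker (x + t * d1) (y + t * d2) (z + t * d3)) has_real_derivative
    (d1 * a + d2 * b + d3 * c) * ker x y z
     - k * ((d1 - d2) / (x - y) * (ker x y z - ker y x z)
          + (d2 - d3) / (y - z) * (ker x y z - ker x z y)
          + (d1 - d3) / (x - z) * (ker x y z - ker z y x))) (at 0)"
proof -
  \<comment> \<open>For \<open>\<bar>s\<bar>\<close> up to this radius u + s d keeps at least half
    the size of u; the added 1 admits d = 0.\<close>
  define rr where "rr u d = \<bar>u\<bar> / (2 * (\<bar>d\<bar> + 1))" for u d :: real
  have rr: "rr u d > 0" "rr u d * \<bar>d\<bar> \<le> \<bar>u\<bar> / 2" if "u \<noteq> 0" for u d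
    using that by (auto simp: rr_def field_simps)
  define r where "r = min 1 (min (rr (x - y) (d1 - d2)) (min (rr (y - z) (d2 - d3)) (rr (x - z) (d1 - d3))))"
  have r: "r > 0" "r \<le> 1" "r \<le> rr (x - y) (d1 - d2)" "r \<le> rr (y - z) (d2 - d3)" "r \<le> rr (x - z) (d1 - d3)"
    using reg rr(1) by (auto simp: r_def)
  have away: "\<bar>u + s * d\<bar> \<ge> \<bar>u\<bar> / 2" if "\<bar>s\<bar> \<le> r" "r \<le> rr u d" "u \<noteq> 0" for u s d
  proof -
    have "\<bar>s * d\<bar> \<le> rr u d * \<bar>d\<bar>" using that by (auto simp: abs_mult intro: mult_right_mono)
    with rr(2)[OF that(3), of d] show ?thesis by linarith
  qed
  define K where "K = (\<bar>x\<bar> + \<bar>d1\<bar>) + (\<bar>y\<bar> + \<bar>d2\<bar>) + (\<bar>z\<bar> + \<bar>d3\<bar>)"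
  have Kge: "\<bar>x\<bar> + \<bar>d1\<bar> \<le> K" "\<bar>y\<bar> + \<bar>d2\<bar> \<le> K" "\<bar>z\<bar> + \<bar>d3\<bar> \<le> K"
    unfolding K_def by (rule add_sum_bounds; simp)+
  define m where "m = K * (\<bar>a\<bar> + \<bar>b\<bar> + \<bar>c\<bar>)"
  define pm where "pm n = (case n of 0 \<Rightarrow> 0 | Suc j \<Rightarrow> m ^ j / fact j)" for n
  define U where "U u d = \<bar>d\<bar> / (\<bar>u\<bar> / 2)" for u d :: real
  define M where "M n = \<bar>d1 * a + d2 * b + d3 * c\<bar> * pm n
    + k * (U (x - y) (d1 - d2) * (2 * (m ^ n / fact n)) + U (y - z) (d2 - d3) * (2 * (m ^ n / fact n))
      + U (x - z) (d1 - d3) * (2 * (m ^ n / fact n)))" for n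
  have "summable pm"
    using summable_exp_majorant[of m] by (subst summable_Suc_iff[symmetric]) (simp add: pm_def)
  then have sM: "summable M"
    unfolding M_def by (intro summable_add summable_mult summable_exp_majorant)
  have bound: "norm (grad n (x + s * d1) (y + s * d2) (z + s * d3) d1 d2 d3) \<le> M n" if s: "\<bar>s\<bar> \<le> r" for n s
  proof -
    have coord: "\<bar>p + s * d\<bar> \<le> \<bar>p\<bar> + \<bar>d\<bar>" for p d
    proof -
      have "\<bar>s * d\<bar> \<le> 1 * \<bar>d\<bar>" unfolding abs_mult using s r by (intro mult_right_mono) auto
      then show ?thesis by linarith
    qed
    have K: "\<bar>x + s * d1\<bar> \<le> K" "\<bar>y + s * d2\<bar> \<le> K" "\<bar>z + s * d3\<bar> \<le> K"
      using Kge coord[of x d1] coord[of y d2] coord[of z d3] by (blast intro: order_trans)+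
    have hb: "\<bar>hom n p q w\<bar> \<le> m ^ n / fact n" if "\<bar>p\<bar> \<le> K" "\<bar>q\<bar> \<le> K" "\<bar>w\<bar> \<le> K" for n p q w
      unfolding m_def by (rule hom_bound[OF that])
    have pb: "\<bar>prev n (x + s * d1) (y + s * d2) (z + s * d3)\<bar> \<le> pm n"
      using hb[OF K] by (cases n) (auto simp: pm_def)
    have tb: "\<bar>d / (u + s * d) * (h1 - h2)\<bar> \<le> U u d * (2 * (m ^ n / fact n))"
      if "r \<le> rr u d" "u \<noteq> 0" "\<bar>h1\<bar> \<le> m ^ n / fact n" "\<bar>h2\<bar> \<le> m ^ n / fact n" for u d h1 h2
    proof -
      have "\<bar>u\<bar> / 2 > 0" "\<bar>u\<bar> / 2 \<le> \<bar>u + s * d\<bar>" using away[OF s that(1,2)] that(2) by auto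
      then have "\<bar>d / (u + s * d)\<bar> \<le> U u d"
        unfolding U_def abs_divide by (intro divide_left_mono mult_pos_pos) linarith+
      moreover have "\<bar>h1 - h2\<bar> \<le> 2 * (m ^ n / fact n)" using that(3,4) by linarith
      moreover have "U u d \<ge> 0" by (simp add: U_def)
      ultimately show ?thesis unfolding abs_mult by (intro mult_mono) auto
    qed
    have e: "(x + s * d1) - (y + s * d2) = (x - y) + s * (d1 - d2)"
      "(y + s * d2) - (z + s * d3) = (y - z) + s * (d2 - d3)"
      "(x + s * d1) - (z + s * d3) = (x - z) + s * (d1 - d3)" by (simp_all add: algebra_simps)
    have ne: "x - y \<noteq> 0" "y - z \<noteq> 0" "x - z \<noteq> 0" using reg by auto
    note t1 = tb[OF r(3) ne(1) hb[OF K] hb[OF K(2,1,3)]]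
    note t2 = tb[OF r(4) ne(2) hb[OF K] hb[OF K(1,3,2)]]
    note t3 = tb[OF r(5) ne(3) hb[OF K] hb[OF K(3,2,1)]]
    have "\<bar>p + q + w\<bar> \<le> p' + q' + w'" if "\<bar>p\<bar> \<le> p'" "\<bar>q\<bar> \<le> q'" "\<bar>w\<bar> \<le> w'" for p q w p' q' w' :: real
      using that by linarith
    note t4 = mult_left_mono[OF this[OF t1 t2 t3] less_imp_le[OF k]]
    have t5: "\<bar>(d1 * a + d2 * b + d3 * c) * prev n (x + s * d1) (y + s * d2) (z + s * d3)\<bar>
       \<le> \<bar>d1 * a + d2 * b + d3 * c\<bar> * pm n"
      unfolding abs_mult using pb by (intro mult_left_mono) auto
    have "\<bar>p - k * q\<bar> \<le> p' + k * q'" if "\<bar>p\<bar> \<le> p'" "k * \<bar>q\<bar> \<le> k * q'" for p q p' q'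
    proof -
      have "\<bar>k * q\<bar> = k * \<bar>q\<bar>" using k by (simp add: abs_mult)
      then show ?thesis using abs_triangle_ineq4[of p "k * q"] that by linarith
    qed
    from this[OF t5 t4] show ?thesis
      unfolding grad_def e M_def real_norm_def .
  qed
  let ?f = "\<lambda>n t. hom n (x + t * d1) (y + t * d2) (z + t * d3)"
  have "((\<lambda>t. \<Sum>n. ?f n t) has_field_derivative
    (\<Sum>n. grad n (x + 0 * d1) (y + 0 * d2) (z + 0 * d3) d1 d2 d3)) (at 0)"
  proof (rule has_field_derivative_series'(2)[where S = "{-r..r}" and ?x0.0 = 0])
    show "((\<lambda>t. ?f n t) has_field_derivative grad n (x + s * d1) (y + s * d2) (z + s * d3) d1 d2 d3)
        (at s within {-r..r})" if "s \<in> {-r..r}" for n s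
    proof -
      have s: "\<bar>s\<bar> \<le> r" using that by auto
      have e: "(x + s * d1) - (y + s * d2) = (x - y) + s * (d1 - d2)"
        "(y + s * d2) - (z + s * d3) = (y - z) + s * (d2 - d3)"
        "(x + s * d1) - (z + s * d3) = (x - z) + s * (d1 - d3)" by (simp_all add: algebra_simps)
      have nz: "u + s * d \<noteq> 0" if "r \<le> rr u d" "u \<noteq> 0" for u d
        using away[OF s that] that(2) by linarith
      have "(x + s * d1) - (y + s * d2) \<noteq> 0" "(y + s * d2) - (z + s * d3) \<noteq> 0"
        "(x + s * d1) - (z + s * d3) \<noteq> 0"
        unfolding e using nz[OF r(3)] nz[OF r(4)] nz[OF r(5)] reg by simp_all
      then have "x + s * d1 \<noteq> y + s * d2" "y + s * d2 \<noteq> z + s * d3" "x + s * d1 \<noteq> z + s * d3"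
        by simp_all
      from hom_grad[OF this, of n d1 d2 d3]
      have "((\<lambda>t. ?f n (t + s)) has_real_derivative grad n (x + s * d1) (y + s * d2) (z + s * d3) d1 d2 d3) (at 0)"
        by (simp add: algebra_simps)
      then show ?thesis
        using DERIV_shift[of "?f n" _ 0 s] by (simp add: has_field_derivative_at_within)
    qed
    show "uniformly_convergent_on {-r..r}
      (\<lambda>n s. \<Sum>i<n. grad i (x + s * d1) (y + s * d2) (z + s * d3) d1 d2 d3)"
      by (rule Weierstrass_m_test'[OF bound sM]) auto
    show "summable (\<lambda>n. ?f n 0)" by (rule hom_summable)
  qed (use r in auto)
  moreover have "(\<lambda>n. grad n x y z d1 d2 d3) sums
    ((d1 * a + d2 * b + d3 * c) * ker x y z
     - k * ((d1 - d2) / (x - y) * (ker x y z - ker y x z)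
          + (d2 - d3) / (y - z) * (ker x y z - ker x z y)
          + (d1 - d3) / (x - z) * (ker x y z - ker z y x)))"
    unfolding grad_def by (intro sums_add sums_diff sums_mult hom_sums prev_sums)
  ultimately show ?thesis unfolding ker_def[symmetric] by (simp add: sums_iff)
qed

end

section \<open>Roots and reflections in coordinates\<close>

lemma root_nth [simp]:
  "root_alpha $ 1 = 1" "root_alpha $ 2 = -1" "root_alpha $ 3 = 0"
  "root_beta $ 1 = 0" "root_beta $ 2 = 1" "root_beta $ 3 = -1"
  "root_gamma $ 1 = 1" "root_gamma $ 2 = 0" "root_gamma $ 3 = -1"
  by (simp_all add: root_alpha_def root_beta_def root_gamma_def)

lemma inner_3: "x \<bullet> y = x$1 * y$1 + x$2 * y$2 + x$3 * y$3" for x y :: "real^3"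
  by (simp add: inner_vec_def sum_3)

lemma refl_nth:
  "refl_root root_alpha X = vector [X$2, X$1, X$3]"
  "refl_root root_beta X = vector [X$1, X$3, X$2]"
  "refl_root root_gamma X = vector [X$3, X$2, X$1]"
  by (simp_all add: refl_root_def inner_3 vec_eq_iff forall_3 diff_divide_distrib)

lemma vector_eta: "vector [X$1, X$2, X$3] = (X :: real^3)"
  by (simp add: vec_eq_iff forall_3)

lemma aa_iff: "X \<in> aa \<longleftrightarrow> X$1 + X$2 + X$3 = 0"
  by (simp add: aa_def)

lemma regular_iff:
  "(\<forall>a\<in>posroots. a \<bullet> X \<noteq> 0) \<longleftrightarrow> X$1 \<noteq> X$2 \<and> X$2 \<noteq> X$3 \<and> X$1 \<noteq> X$3"
  by (auto simp: posroots_def inner_3)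

lemma dunkl_op_eq:
  "dunkl_op k \<xi> f X = deriv (\<lambda>t. f (X + t *\<^sub>R \<xi>)) 0
     + k * ((\<xi>$1 - \<xi>$2) / (X$1 - X$2) * (f X - f (vector [X$2, X$1, X$3]))
          + (\<xi>$2 - \<xi>$3) / (X$2 - X$3) * (f X - f (vector [X$1, X$3, X$2]))
          + (\<xi>$1 - \<xi>$3) / (X$1 - X$3) * (f X - f (vector [X$3, X$2, X$1])))"
proof -
  have "root_alpha \<noteq> root_beta" "root_alpha \<noteq> root_gamma" "root_beta \<noteq> root_gamma"
    by (auto dest: arg_cong[of _ _ "\<lambda>v. v $ 1"] arg_cong[of _ _ "\<lambda>v. v $ 3"])
  then show ?thesis
    unfolding dunkl_op_def posroots_def
    by (simp add: refl_nth inner_3) (simp add: distrib_left mult.assoc)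
qed

context dunkl_series
begin

definition kernel_fun :: "real^3 \<Rightarrow> real" where
  "kernel_fun X = (if X \<in> aa then ker (X$1) (X$2) (X$3) else 0)"

lemma kernel_fun_analytic: "real_analytic_aa kernel_fun"
  unfolding real_analytic_aa_def
proof
  fix P assume P: "P \<in> aa"
  obtain M where "dps M (\<lambda>s t. ker (P$1 + 1 * s + 0 * t) (P$2 + (-1) * s + 1 * t) (P$3 + 0 * s + (-1) * t))"
    using ker_dps by blast
  then obtain d S where d: "\<And>s t. \<bar>s\<bar> \<le> 1 \<Longrightarrow> \<bar>t\<bar> \<le> 1 \<Longrightarrow>
      ((\<lambda>p. d p * s ^ fst p * t ^ snd p) has_sum
         ker (P$1 + 1 * s + 0 * t) (P$2 + (-1) * s + 1 * t) (P$3 + 0 * s + (-1) * t)) UNIV"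
    by (rule dpsE) blast
  show "\<exists>r>0. \<exists>c. \<forall>s t. \<bar>s\<bar> < r \<and> \<bar>t\<bar> < r \<longrightarrow>
    ((\<lambda>(i, j). c i j * s ^ i * t ^ j) has_sum kernel_fun (P + s *\<^sub>R root_alpha + t *\<^sub>R root_beta)) UNIV"
  proof (intro exI[of _ 1] conjI exI[of _ "\<lambda>i j. d (i, j)"] allI impI)
    fix s t :: real assume st: "\<bar>s\<bar> < 1 \<and> \<bar>t\<bar> < 1"
    have "kernel_fun (P + s *\<^sub>R root_alpha + t *\<^sub>R root_beta)
      = ker (P$1 + 1 * s + 0 * t) (P$2 + (-1) * s + 1 * t) (P$3 + 0 * s + (-1) * t)"
      using P by (simp add: kernel_fun_def aa_iff)
    then show "((\<lambda>(i, j). d (i, j) * s ^ i * t ^ j) has_sum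
        kernel_fun (P + s *\<^sub>R root_alpha + t *\<^sub>R root_beta)) UNIV"
      using d[of s t] st by (simp add: case_prod_unfold)
  qed simp
qed

lemma kernel_fun_is_kernel: "is_dunkl_kernel k (vector [a, b, c]) kernel_fun"
  unfolding is_dunkl_kernel_def regular_iff
proof (intro conjI allI impI ballI)
  show "kernel_fun 0 = 1" by (simp add: kernel_fun_def aa_iff ker_zero)
  fix \<xi> X assume xi: "\<xi> \<in> aa" and X: "X \<in> aa" and reg: "X$1 \<noteq> X$2 \<and> X$2 \<noteq> X$3 \<and> X$1 \<noteq> X$3"
  have eq: "kernel_fun (X + t *\<^sub>R \<xi>) = ker (X$1 + t * \<xi>$1) (X$2 + t * \<xi>$2) (X$3 + t * \<xi>$3)" for t
  proof -
    have "X + t *\<^sub>R \<xi> \<in> aa"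
    proof -
      have "(X$1 + t * \<xi>$1) + (X$2 + t * \<xi>$2) + (X$3 + t * \<xi>$3)
        = (X$1 + X$2 + X$3) + t * (\<xi>$1 + \<xi>$2 + \<xi>$3)" by (simp add: algebra_simps)
      then show ?thesis using X xi by (simp add: aa_iff)
    qed
    then show ?thesis by (simp add: kernel_fun_def)
  qed
  have perm: "vector [X$2, X$1, X$3] \<in> aa" "vector [X$1, X$3, X$2] \<in> aa" "vector [X$3, X$2, X$1] \<in> aa"
    using X by (auto simp: aa_iff)
  have "deriv (\<lambda>t. kernel_fun (X + t *\<^sub>R \<xi>)) 0 =
     (\<xi>$1 * a + \<xi>$2 * b + \<xi>$3 * c) * ker (X$1) (X$2) (X$3)
     - k * ((\<xi>$1 - \<xi>$2) / (X$1 - X$2) * (ker (X$1) (X$2) (X$3) - ker (X$2) (X$1) (X$3))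
          + (\<xi>$2 - \<xi>$3) / (X$2 - X$3) * (ker (X$1) (X$2) (X$3) - ker (X$1) (X$3) (X$2))
          + (\<xi>$1 - \<xi>$3) / (X$1 - X$3) * (ker (X$1) (X$2) (X$3) - ker (X$3) (X$2) (X$1)))"
    unfolding eq using reg by (intro DERIV_imp_deriv ker_grad) auto
  then show "dunkl_op k \<xi> kernel_fun X = (\<xi> \<bullet> vector [a, b, c]) * kernel_fun X"
    unfolding dunkl_op_eq using X perm by (simp add: kernel_fun_def inner_3)
qed (use kernel_fun_analytic in \<open>auto simp: kernel_fun_def\<close>)

end

section \<open>Restriction to lines and uniqueness\<close>

lemma has_sum_antidiagonal:
  fixes f :: "nat \<Rightarrow> nat \<Rightarrow> real"
  assumes "((\<lambda>(i, j). f i j) has_sum S) UNIV"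
  shows "(\<lambda>n. \<Sum>i\<le>n. f i (n - i)) sums S"
proof (rule has_sum_imp_sums, rule has_sum_SigmaD)
  have "bij_betw (\<lambda>(n, i). (i, n - i)) (Sigma UNIV (\<lambda>n::nat. {..n})) (UNIV :: (nat \<times> nat) set)"
    by (rule bij_betwI[of _ _ _ "\<lambda>(i, j). (i + j, i)"]) auto
  from has_sum_reindex_bij_betw[OF this, of "\<lambda>(i, j). f i j" S] assms
  show "((\<lambda>(n, i). f i (n - i)) has_sum S) (Sigma UNIV (\<lambda>n. {..n}))"
    by (simp add: case_prod_unfold)
qed auto

text \<open>Along a line the double series regroups by total degree into a power series in t.
  Without such an existence result the value of \<open>deriv\<close> in the Dunkl operator would
  carry no information.\<close>

lemma analytic_field_differentiable:
  assumes f: "real_analytic_aa f" and X: "X \<in> aa" and xi: "\<xi> \<in> aa"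
  shows "(\<lambda>t. f (X + t *\<^sub>R \<xi>)) field_differentiable at 0"
proof -
  from f X obtain r c where r: "r > 0" and c: "\<And>s t. \<bar>s\<bar> < r \<and> \<bar>t\<bar> < r \<Longrightarrow>
      ((\<lambda>(i, j). c i j * s ^ i * t ^ j) has_sum f (X + s *\<^sub>R root_alpha + t *\<^sub>R root_beta)) UNIV"
    unfolding real_analytic_aa_def by blast
  define u v where uv: "u = \<xi>$1" "v = - \<xi>$3"
  have xi_eq: "\<xi> = u *\<^sub>R root_alpha + v *\<^sub>R root_beta"
    using xi by (simp add: uv vec_eq_iff forall_3 aa_iff)
  define d where "d = r / (\<bar>u\<bar> + \<bar>v\<bar> + 1)"
  have d: "d > 0" "d * \<bar>u\<bar> < r" "d * \<bar>v\<bar> < r" using r by (auto simp: d_def field_simps add_pos_nonneg)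
  define A where "A n = (\<Sum>i\<le>n. c i (n - i) * u ^ i * v ^ (n - i))" for n
  have A: "(\<lambda>n. A n * t ^ n) sums f (X + t *\<^sub>R \<xi>)" if t: "norm t < d" for t
  proof -
    have "\<bar>t * u\<bar> \<le> d * \<bar>u\<bar>" "\<bar>t * v\<bar> \<le> d * \<bar>v\<bar>"
      using t unfolding abs_mult by (auto intro!: mult_right_mono)
    then have "\<bar>t * u\<bar> < r \<and> \<bar>t * v\<bar> < r" using d by linarith
    from has_sum_antidiagonal[OF c[OF this]]
    have "(\<lambda>n. \<Sum>i\<le>n. c i (n - i) * (t * u) ^ i * (t * v) ^ (n - i)) sums f (X + t *\<^sub>R \<xi>)"
      unfolding xi_eq by (simp add: scaleR_add_right add.assoc)
    moreover have "(\<Sum>i\<le>n. c i (n - i) * (t * u) ^ i * (t * v) ^ (n - i)) = A n * t ^ n" for n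
      unfolding A_def sum_distrib_right
    proof (rule sum.cong)
      fix i assume "i \<in> {..n}"
      then have "t ^ n = t ^ i * t ^ (n - i)" by (simp flip: power_add)
      then show "c i (n - i) * (t * u) ^ i * (t * v) ^ (n - i) = c i (n - i) * u ^ i * v ^ (n - i) * t ^ n"
        by (simp add: power_mult_distrib)
    qed simp
    ultimately show ?thesis by simp
  qed
  have "((\<lambda>t. \<Sum>n. A n * t ^ n) has_field_derivative (\<Sum>n. diffs A n * 0 ^ n)) (at 0)"
    by (rule termdiffs_strong'[of d]) (use A d in \<open>auto intro: sums_summable\<close>)
  then have "((\<lambda>t. f (X + t *\<^sub>R \<xi>)) has_field_derivative (\<Sum>n. diffs A n * 0 ^ n)) (at 0)"
    by (rule has_field_derivative_transform_within_open[of _ _ _ "ball 0 d"])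
      (use A d in \<open>auto simp: sums_iff\<close>)
  then show ?thesis by (auto simp: field_differentiable_def)
qed

lemma analytic_ray_continuous:
  assumes f: "real_analytic_aa f" and X: "X \<in> aa" and xi: "\<xi> \<in> aa"
  shows "isCont (\<lambda>t. f (X + t *\<^sub>R \<xi>)) s"
proof -
  have "X + s *\<^sub>R \<xi> \<in> aa"
  proof -
    have "(X$1 + s * \<xi>$1) + (X$2 + s * \<xi>$2) + (X$3 + s * \<xi>$3)
      = (X$1 + X$2 + X$3) + s * (\<xi>$1 + \<xi>$2 + \<xi>$3)" by (simp add: algebra_simps)
    then show ?thesis using X xi by (simp add: aa_iff)
  qed
  then have "isCont (\<lambda>t. f ((X + s *\<^sub>R \<xi>) + t *\<^sub>R \<xi>)) 0"
    by (intro field_differentiable_imp_continuous_at analytic_field_differentiable f xi)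
  then have "isCont (\<lambda>t. f (X + (t + s) *\<^sub>R \<xi>)) 0" by (simp add: scaleR_add_left add_ac)
  then show ?thesis unfolding isCont_iff by (simp add: add.commute)
qed

text \<open>With \<xi> = X every reflection quotient has the weight 1 / t. This concerns an
  arbitrary kernel, hence regular rays, the ones on which the eigen-equation is imposed.\<close>

lemma dunkl_kernel_ray:
  assumes f: "is_dunkl_kernel k Y f" and z: "x + y + z = 0" and reg: "x \<noteq> y" "y \<noteq> z" "x \<noteq> z" and t: "t > 0"
  shows "euler_deriv (\<lambda>t. f (t *\<^sub>R vector [x, y, z]))
    (k * (f (t *\<^sub>R vector [y, x, z]) + f (t *\<^sub>R vector [x, z, y]) + f (t *\<^sub>R vector [z, y, x]))
      - (3 * k - t * (x * Y$1 + y * Y$2 + z * Y$3)) * f (t *\<^sub>R vector [x, y, z])) t"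
proof -
  define X :: "real^3" where "X = vector [x, y, z]"
  have X: "X \<in> aa" "t *\<^sub>R X \<in> aa" using z by (simp_all add: X_def aa_iff flip: distrib_left)
  have sc: "t *\<^sub>R vector [p, q, r] = (vector [t * p, t * q, t * r] :: real^3)" for p q r
    by (simp add: vec_eq_iff forall_3)
  have f': "real_analytic_aa f" using f by (simp add: is_dunkl_kernel_def)
  define D where "D = deriv (\<lambda>s. f (t *\<^sub>R X + s *\<^sub>R X)) 0"
  have "((\<lambda>s. f (t *\<^sub>R X + s *\<^sub>R X)) has_real_derivative D) (at 0)"
    unfolding D_def DERIV_deriv_iff_field_differentiable
    by (rule analytic_field_differentiable[OF f' X(2,1)])
  then have "((\<lambda>s. f ((s + t) *\<^sub>R X)) has_real_derivative D) (at 0)"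
    by (simp add: scaleR_add_left add_ac)
  then have der: "((\<lambda>s. f (s *\<^sub>R X)) has_real_derivative D) (at t)"
    using DERIV_shift[of "\<lambda>s. f (s *\<^sub>R X)" D 0 t] by simp
  have rt: "t * x \<noteq> t * y" "t * y \<noteq> t * z" "t * x \<noteq> t * z" using reg t by auto
  have q: "(x - y) / (t * x - t * y) = 1 / t" "(y - z) / (t * y - t * z) = 1 / t" "(x - z) / (t * x - t * z) = 1 / t"
    using reg t by (simp_all add: divide_simps) (simp_all add: algebra_simps)
  have "dunkl_op k X f (t *\<^sub>R X) = (X \<bullet> Y) * f (t *\<^sub>R X)"
    using f X rt unfolding is_dunkl_kernel_def regular_iff by (auto simp: X_def)
  then have "D + k * (1 / t * (f (t *\<^sub>R X) - f (t *\<^sub>R vector [y, x, z]))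
      + 1 / t * (f (t *\<^sub>R X) - f (t *\<^sub>R vector [x, z, y]))
      + 1 / t * (f (t *\<^sub>R X) - f (t *\<^sub>R vector [z, y, x]))) = (x * Y$1 + y * Y$2 + z * Y$3) * f (t *\<^sub>R X)"
    unfolding dunkl_op_eq D_def[symmetric] by (simp add: X_def q sc inner_3)
  then have "t * (D + k * (1 / t * (f (t *\<^sub>R X) - f (t *\<^sub>R vector [y, x, z]))
      + 1 / t * (f (t *\<^sub>R X) - f (t *\<^sub>R vector [x, z, y]))
      + 1 / t * (f (t *\<^sub>R X) - f (t *\<^sub>R vector [z, y, x])))) = t * ((x * Y$1 + y * Y$2 + z * Y$3) * f (t *\<^sub>R X))"
    by simp
  then have "k * (f (t *\<^sub>R vector [y, x, z]) + f (t *\<^sub>R vector [x, z, y]) + f (t *\<^sub>R vector [z, y, x]))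
      - (3 * k - t * (x * Y$1 + y * Y$2 + z * Y$3)) * f (t *\<^sub>R X) = t * D"
    using t by (simp add: algebra_simps)
  then show ?thesis using der t unfolding X_def euler_deriv_def by simp
qed

text \<open>The six differences g - f over the orbit start at 0 and satisfy a cooperative system, so
  the minimum principle applies. The rates here have no sign; the factor exp (- (m * t)), with m
  above every pairing of an orbit point with Y, makes the derivative strict.\<close>

lemma dunkl_kernel_le:
  assumes k: "k > 0" and f: "is_dunkl_kernel k Y f" and g: "is_dunkl_kernel k Y g"
    and z: "x + y + z = 0" and reg: "x \<noteq> y" "y \<noteq> z" "x \<noteq> z"
  shows "f (vector [x, y, z]) \<le> g (vector [x, y, z])"
proof -
  let ?S = "{(x, y, z), (y, x, z), (x, z, y), (z, y, x), (y, z, x), (z, x, y)}"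
  let ?Y = "\<lambda>x y z. x * Y$1 + y * Y$2 + z * Y$3"
  define m where "m = 1 + (\<Sum>(p, q, r)\<in>?S. \<bar>?Y p q r\<bar>)"
  define h where "h p t = (case p of (x, y, z) \<Rightarrow> g (t *\<^sub>R vector [x, y, z]) - f (t *\<^sub>R vector [x, y, z]))" for p t
  let ?I = "(\<lambda>p t. exp (- (m * t)) * h p t) ` ?S"
  have ana: "real_analytic_aa f" "real_analytic_aa g" and zero: "f 0 = 1" "g 0 = 1"
    using f g by (auto simp: is_dunkl_kernel_def)
  have Ym: "?Y p q r < m" if "(p, q, r) \<in> ?S" for p q r
  proof -
    have "\<bar>?Y p q r\<bar> \<le> (\<Sum>(p, q, r)\<in>?S. \<bar>?Y p q r\<bar>)"
      using member_le_sum[OF that, of "\<lambda>(p, q, r). \<bar>?Y p q r\<bar>"] by (simp only: split_conv) auto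
    then show ?thesis unfolding m_def by linarith
  qed
  have S: "p + q + r = 0" "p \<noteq> q" "q \<noteq> r" "p \<noteq> r"
    "(q, p, r) \<in> ?S" "(p, r, q) \<in> ?S" "(r, q, p) \<in> ?S" if "(p, q, r) \<in> ?S" for p q r
    using that z reg by auto
  have "(\<lambda>t. exp (- (m * t)) * h (x, y, z) t) 1 \<ge> 0"
  proof (rule finite_barrier[where I = ?I and T = 1 and u = "\<lambda>t. exp (- (m * t)) * h (x, y, z) t"])
    show "finite ?I" by simp
    show "(\<lambda>t. exp (- (m * t)) * h (x, y, z) t) \<in> ?I" by blast
    show "u 0 \<ge> 0" if "u \<in> ?I" for u using that zero by (auto simp: h_def)
    show "continuous_on {0..1} u" if u: "u \<in> ?I" for u
    proof -
      from u obtain p where p: "p \<in> ?S" "u = (\<lambda>t. exp (- (m * t)) * h p t)" by blast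
      obtain p1 p2 p3 where p': "p = (p1, p2, p3)" by (cases p)
      have v: "vector [p1, p2, p3] \<in> aa" using S(1)[of p1 p2 p3] p(1) p' by (simp add: aa_iff)
      have z0: "(0 :: real^3) \<in> aa" by (simp add: aa_iff)
      have "isCont (\<lambda>t. f (t *\<^sub>R vector [p1, p2, p3])) s"
        "isCont (\<lambda>t. g (t *\<^sub>R vector [p1, p2, p3])) s" for s
        using analytic_ray_continuous[OF ana(1) z0 v] analytic_ray_continuous[OF ana(2) z0 v] by simp_all
      then show ?thesis unfolding p(2) h_def p'
        by (intro continuous_at_imp_continuous_on ballI) (auto intro!: continuous_intros)
    qed
    fix u t assume u: "u \<in> ?I" and t: "0 < t" and neg: "u t < 0"
      and le: "\<And>v. v \<in> ?I \<Longrightarrow> u t \<le> v t"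
    from u obtain p where p: "p \<in> ?S" "u = (\<lambda>t. exp (- (m * t)) * h p t)" by blast
    obtain p1 p2 p3 where p': "p = (p1, p2, p3)" by (cases p)
    note pS = S[OF p(1)[unfolded p']]
    let ?p = "(p1, p2, p3)"
    have hneg: "h ?p t < 0" using neg p(2) p' by (simp add: mult_less_0_iff)
    have hle: "h ?p t \<le> h q t" if "q \<in> ?S" for q
    proof -
      have "u t \<le> (\<lambda>t. exp (- (m * t)) * h q t) t" by (rule le) (rule imageI[OF that])
      then show ?thesis unfolding p(2) p' by simp
    qed
    define D where "D = k * (h (p2, p1, p3) t + h (p1, p3, p2) t + h (p3, p2, p1) t)
       - (3 * k - t * ?Y p1 p2 p3) * h ?p t"
    have hp: "h ?p = (\<lambda>t. g (t *\<^sub>R vector [p1, p2, p3]) - f (t *\<^sub>R vector [p1, p2, p3]))"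
      by (simp add: h_def fun_eq_iff)
    have dh: "euler_deriv (h ?p) D t"
      unfolding hp
      by (rule euler_deriv_cong[OF euler_deriv_diff[OF dunkl_kernel_ray[OF g pS(1-4) t]
            dunkl_kernel_ray[OF f pS(1-4) t]]]) (simp add: D_def h_def algebra_simps)
    have "euler_deriv u (- m * t * exp (- (m * t)) * h ?p t + D * exp (- (m * t))) t"
      using euler_deriv_mult[OF euler_deriv_exp[OF t, of m] dh] unfolding p(2) p' .
    moreover have "- m * t * exp (- (m * t)) * h ?p t + D * exp (- (m * t)) > 0"
    proof -
      have "k * (3 * h ?p t) \<le> k * (h (p2, p1, p3) t + h (p1, p3, p2) t + h (p3, p2, p1) t)"
        using hle[OF pS(5)] hle[OF pS(6)] hle[OF pS(7)] k by (intro mult_left_mono) auto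
      then have "D \<ge> t * ?Y p1 p2 p3 * h ?p t" unfolding D_def by (simp add: algebra_simps)
      moreover have "t * (?Y p1 p2 p3 - m) * h ?p t > 0"
        using t Ym[OF p(1)[unfolded p']] hneg by (simp add: mult_neg_neg mult_pos_neg)
      ultimately have "D - m * t * h ?p t > 0" by (simp add: algebra_simps)
      then have "exp (- (m * t)) * (D - m * t * h ?p t) > 0" by simp
      then show ?thesis by (simp add: algebra_simps)
    qed
    ultimately show "\<exists>D>0. euler_deriv u D t" by blast
  qed auto
  then show ?thesis by (simp add: h_def zero_le_mult_iff)
qed

text \<open>Two one-sided comparisons give equality off the walls. Points on walls are reached along
  V, at which no root vanishes, so all but finitely many points of the line are regular.\<close>

lemma dunkl_kernel_unique:
  assumes k: "k > 0" and f: "is_dunkl_kernel k Y f" and g: "is_dunkl_kernel k Y g"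
  shows "f = g"
proof
  fix X :: "real^3"
  have ana: "real_analytic_aa f" "real_analytic_aa g" using f g by (auto simp: is_dunkl_kernel_def)
  show "f X = g X"
  proof (cases "X \<in> aa")
    case True
    define V :: "real^3" where "V = vector [1, 0, -1]"
    have V: "V \<in> aa" by (simp add: V_def aa_iff)
    have reg: "f Z = g Z" if "Z \<in> aa" "Z$1 \<noteq> Z$2" "Z$2 \<noteq> Z$3" "Z$1 \<noteq> Z$3" for Z
      using dunkl_kernel_le[OF k f g, of "Z$1" "Z$2" "Z$3"] dunkl_kernel_le[OF k g f, of "Z$1" "Z$2" "Z$3"] that
      by (simp add: aa_iff vector_eta)
    have "eventually (\<lambda>t. t \<noteq> X$2 - X$1 \<and> t \<noteq> X$3 - X$2 \<and> t \<noteq> (X$3 - X$1) / 2) (at 0)"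
      by (intro eventually_conj eventually_neq_at_within)
    then have "eventually (\<lambda>t. f (X + t *\<^sub>R V) - g (X + t *\<^sub>R V) = 0) (at 0)"
    proof eventually_elim
      case (elim t)
      have "f (X + t *\<^sub>R V) = g (X + t *\<^sub>R V)"
        by (rule reg) (use elim True in \<open>auto simp: V_def aa_iff\<close>)
      then show ?case by simp
    qed
    then have "((\<lambda>t. f (X + t *\<^sub>R V) - g (X + t *\<^sub>R V)) \<longlongrightarrow> 0) (at 0)"
      by (rule tendsto_eventually)
    moreover have "isCont (\<lambda>t. f (X + t *\<^sub>R V) - g (X + t *\<^sub>R V)) 0"
      by (intro continuous_intros analytic_ray_continuous ana V True)
    then have "((\<lambda>t. f (X + t *\<^sub>R V) - g (X + t *\<^sub>R V)) \<longlongrightarrow> f X - g X) (at 0)"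
      by (simp add: isCont_def)
    ultimately have "0 = f X - g X" by (rule tendsto_unique[rotated]) simp
    then show ?thesis by simp
  next
    case False
    then show ?thesis using f g by (simp add: is_dunkl_kernel_def)
  qed
qed

lemma dunkl_kernel_eq:
  assumes "k > 0" "X \<in> aa"
  shows "dunkl_kernel k X l = dunkl_series.ker k (l$1) (l$2) (l$3) (X$1) (X$2) (X$3)"
proof -
  interpret dunkl_series k "l$1" "l$2" "l$3" by standard (rule assms)
  have "is_dunkl_kernel k l kernel_fun" using kernel_fun_is_kernel by (simp add: vector_eta)
  then have "(THE f. is_dunkl_kernel k l f) = kernel_fun"
    using dunkl_kernel_unique[OF assms(1)] by (intro the_equality)
  then show ?thesis using assms(2) by (simp add: dunkl_kernel_def kernel_fun_def)
qed

section \<open>Estimates in the closed chamber\<close>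

definition rot_lower :: "real \<Rightarrow> real" where "rot_lower k = (k / (1 + 6 * k))\<^sup>2"
definition rot_upper :: "real \<Rightarrow> real" where "rot_upper k = 9 + 9 * k * ratio_const k"

text \<open>The exponential controls e W in both directions. The sum dominates every loss factor L
  that occurs: 1 for the identity, the second and third summands for reflections, the last two for
  rotations.\<close>

definition est_const :: "real \<Rightarrow> real" where
  "est_const k = exp (3 * pi * k * dev_const k) *
     (1 + ratio_const k + (1 + 6 * k) / k + 6 * rot_upper k + 2 / rot_lower k)"

definition comparable :: "real \<Rightarrow> real \<Rightarrow> real \<Rightarrow> bool" where
  "comparable k f g \<longleftrightarrow> g / est_const k \<le> f \<and> f \<le> est_const k * g"

text \<open>Z plays the role of the rearranged point; it may lie on walls, where some of the rates
  vanish.\<close>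

locale chamber_point =
  fixes k :: real and l Z :: "real^3"
  assumes k: "k > 0" and l: "l \<in> Cplus" and Z: "Z \<in> aa" "Z$1 \<ge> Z$2" "Z$2 \<ge> Z$3"

sublocale chamber_point \<subseteq> dunkl_series k "l$1" "l$2" "l$3"
  by standard (rule k)

context chamber_point
begin

definition "A = alph l * alph Z"
definition "B = bet l * bet Z"
definition "P = alph l * bet Z"
definition "Q = bet l * alph Z"
definition "C = gam l * gam Z"
definition "W = (1 + A) powr k * (1 + B) powr k * (1 + C) powr k"
definition "mass = 1 / (1 + A) + 1 / (1 + B) + 1 / (1 + C)"

definition "psi p q r t = exp (- ((l \<bullet> Z) * t)) * ker (t * p) (t * q) (t * r)"

lemma nonneg: "A \<ge> 0" "B \<ge> 0" "P \<ge> 0" "Q \<ge> 0" "C \<ge> 0"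
  using l Z by (simp_all add: A_def B_def P_def Q_def C_def alph_def bet_def gam_def Cplus_def)

lemma C_eq: "C = A + B + P + Q"
  by (simp add: A_def B_def P_def Q_def C_def alph_def bet_def gam_def algebra_simps)

lemma psi_continuous: "continuous_on UNIV (psi p q r)"
  unfolding psi_def by (intro continuous_intros ker_ray_continuous)

lemma psi_zero: "psi p q r 0 = 1"
  by (simp add: psi_def ker_zero)

lemma psi_deriv:
  assumes t: "t > 0" and N: "N = l \<bullet> Z - (p * l$1 + q * l$2 + r * l$3)"
  shows "euler_deriv (psi p q r)
    (k * (psi q p r t + psi p r q t + psi r q p t) - (3 * k + N * t) * psi p q r t) t"
  unfolding psi_def[abs_def]
  by (rule euler_deriv_cong[OF euler_deriv_mult[OF euler_deriv_exp[OF t] ker_ray[OF t]]])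
    (simp add: N psi_def algebra_simps)

lemmas cost_defs = A_def B_def P_def Q_def alph_def bet_def inner_3

text \<open>Exchanging P and Q amounts to exchanging the two rotations, so the normalization Q <= P
  of \<open>dunkl_ray\<close> costs no generality.\<close>

lemma psi_ray:
  "Q \<le> P \<Longrightarrow> dunkl_ray k A B P Q (psi (Z$1) (Z$2) (Z$3)) (psi (Z$2) (Z$1) (Z$3)) (psi (Z$1) (Z$3) (Z$2))
     (psi (Z$3) (Z$2) (Z$1)) (psi (Z$3) (Z$1) (Z$2)) (psi (Z$2) (Z$3) (Z$1))"
  "P \<le> Q \<Longrightarrow> dunkl_ray k A B Q P (psi (Z$1) (Z$2) (Z$3)) (psi (Z$2) (Z$1) (Z$3)) (psi (Z$1) (Z$3) (Z$2))
     (psi (Z$3) (Z$2) (Z$1)) (psi (Z$2) (Z$3) (Z$1)) (psi (Z$3) (Z$1) (Z$2))"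
proof -
  have PQ: "P * Q = A * B" "Q * P = A * B" by (simp_all add: A_def B_def P_def Q_def)
  note d = psi_deriv[where N = 0] psi_deriv[where N = A] psi_deriv[where N = B]
    psi_deriv[where N = "A + B + P + Q"] psi_deriv[where N = "A + B + P"] psi_deriv[where N = "A + B + Q"]
  have e: "euler_deriv (psi (Z$1) (Z$2) (Z$3)) (k * (psi (Z$2) (Z$1) (Z$3) t + psi (Z$1) (Z$3) (Z$2) t
      + psi (Z$3) (Z$2) (Z$1) t) - 3 * k * psi (Z$1) (Z$2) (Z$3) t) t" if "t > 0" for t
    by (rule euler_deriv_cong[OF d(1)[OF that]]) (simp_all add: cost_defs algebra_simps)
  have sa: "euler_deriv (psi (Z$2) (Z$1) (Z$3)) (k * (psi (Z$1) (Z$2) (Z$3) t + psi (Z$3) (Z$1) (Z$2) t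
      + psi (Z$2) (Z$3) (Z$1) t) - (3 * k + A * t) * psi (Z$2) (Z$1) (Z$3) t) t" if "t > 0" for t
    by (rule euler_deriv_cong[OF d(2)[OF that]]) (simp_all add: cost_defs algebra_simps)
  have sb: "euler_deriv (psi (Z$1) (Z$3) (Z$2)) (k * (psi (Z$1) (Z$2) (Z$3) t + psi (Z$3) (Z$1) (Z$2) t
      + psi (Z$2) (Z$3) (Z$1) t) - (3 * k + B * t) * psi (Z$1) (Z$3) (Z$2) t) t" if "t > 0" for t
    by (rule euler_deriv_cong[OF d(3)[OF that]]) (simp_all add: cost_defs algebra_simps)
  have sg: "euler_deriv (psi (Z$3) (Z$2) (Z$1)) (k * (psi (Z$1) (Z$2) (Z$3) t + psi (Z$3) (Z$1) (Z$2) t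
      + psi (Z$2) (Z$3) (Z$1) t) - (3 * k + (A + B + P + Q) * t) * psi (Z$3) (Z$2) (Z$1) t) t" if "t > 0" for t
    by (rule euler_deriv_cong[OF d(4)[OF that]]) (simp_all add: cost_defs algebra_simps)
  have rP: "euler_deriv (psi (Z$3) (Z$1) (Z$2)) (k * (psi (Z$2) (Z$1) (Z$3) t + psi (Z$1) (Z$3) (Z$2) t
      + psi (Z$3) (Z$2) (Z$1) t) - (3 * k + (A + B + P) * t) * psi (Z$3) (Z$1) (Z$2) t) t" if "t > 0" for t
    by (rule euler_deriv_cong[OF d(5)[OF that]]) (simp_all add: cost_defs algebra_simps)
  have rQ: "euler_deriv (psi (Z$2) (Z$3) (Z$1)) (k * (psi (Z$2) (Z$1) (Z$3) t + psi (Z$1) (Z$3) (Z$2) t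
      + psi (Z$3) (Z$2) (Z$1) t) - (3 * k + (A + B + Q) * t) * psi (Z$2) (Z$3) (Z$1) t) t" if "t > 0" for t
    by (rule euler_deriv_cong[OF d(6)[OF that]]) (simp_all add: cost_defs algebra_simps)
  show "dunkl_ray k A B P Q (psi (Z$1) (Z$2) (Z$3)) (psi (Z$2) (Z$1) (Z$3)) (psi (Z$1) (Z$3) (Z$2))
     (psi (Z$3) (Z$2) (Z$1)) (psi (Z$3) (Z$1) (Z$2)) (psi (Z$2) (Z$3) (Z$1))" if "Q \<le> P"
    by unfold_locales
      (use that k nonneg PQ psi_zero psi_continuous e sa sb sg rP rQ in simp_all)
  show "dunkl_ray k A B Q P (psi (Z$1) (Z$2) (Z$3)) (psi (Z$2) (Z$1) (Z$3)) (psi (Z$1) (Z$3) (Z$2))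
     (psi (Z$3) (Z$2) (Z$1)) (psi (Z$2) (Z$3) (Z$1)) (psi (Z$3) (Z$1) (Z$2))" if "P \<le> Q"
    by unfold_locales
      (use that k nonneg PQ psi_zero psi_continuous e sa sb sg rP rQ in \<open>simp_all add: add_ac\<close>)
qed

lemma psi_estimates:
  defines "e \<equiv> psi (Z$1) (Z$2) (Z$3) 1" and "K \<equiv> exp (3 * pi * k * dev_const k)"
  shows "e > 0" "1 / K \<le> e * W" "e * W \<le> K"
    "(1 + A) * psi (Z$2) (Z$1) (Z$3) 1 \<le> ratio_const k * e" "k / (1 + 6 * k) * e \<le> (1 + A) * psi (Z$2) (Z$1) (Z$3) 1"
    "(1 + B) * psi (Z$1) (Z$3) (Z$2) 1 \<le> ratio_const k * e" "k / (1 + 6 * k) * e \<le> (1 + B) * psi (Z$1) (Z$3) (Z$2) 1"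
    "(1 + C) * psi (Z$3) (Z$2) (Z$1) 1 \<le> ratio_const k * e" "k / (1 + 6 * k) * e \<le> (1 + C) * psi (Z$3) (Z$2) (Z$1) 1"
    "(1 + (A + B + P)) * psi (Z$3) (Z$1) (Z$2) 1 \<le> rot_upper k * e * mass"
    "rot_lower k * e * mass \<le> (1 + (A + B + P)) * psi (Z$3) (Z$1) (Z$2) 1"
    "(1 + (A + B + Q)) * psi (Z$2) (Z$3) (Z$1) 1 \<le> rot_upper k * e * mass"
    "rot_lower k * e * mass \<le> (1 + (A + B + Q)) * psi (Z$2) (Z$3) (Z$1) 1"
proof -
  have C': "A + B + Q + P = A + B + P + Q" by simp
  note defs = e_def K_def W_def mass_def C_eq rot_upper_def rot_lower_def
  consider "Q \<le> P" | "P \<le> Q" by linarith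
  then have "e > 0 \<and> 1 / K \<le> e * W \<and> e * W \<le> K \<and>
    (1 + A) * psi (Z$2) (Z$1) (Z$3) 1 \<le> ratio_const k * e \<and> k / (1 + 6 * k) * e \<le> (1 + A) * psi (Z$2) (Z$1) (Z$3) 1 \<and>
    (1 + B) * psi (Z$1) (Z$3) (Z$2) 1 \<le> ratio_const k * e \<and> k / (1 + 6 * k) * e \<le> (1 + B) * psi (Z$1) (Z$3) (Z$2) 1 \<and>
    (1 + C) * psi (Z$3) (Z$2) (Z$1) 1 \<le> ratio_const k * e \<and> k / (1 + 6 * k) * e \<le> (1 + C) * psi (Z$3) (Z$2) (Z$1) 1 \<and>
    (1 + (A + B + P)) * psi (Z$3) (Z$1) (Z$2) 1 \<le> rot_upper k * e * mass \<and>
    rot_lower k * e * mass \<le> (1 + (A + B + P)) * psi (Z$3) (Z$1) (Z$2) 1 \<and>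
    (1 + (A + B + Q)) * psi (Z$2) (Z$3) (Z$1) 1 \<le> rot_upper k * e * mass \<and>
    rot_lower k * e * mass \<le> (1 + (A + B + Q)) * psi (Z$2) (Z$3) (Z$1) 1"
  proof cases
    case 1
    interpret ray: dunkl_ray k A B P Q "psi (Z$1) (Z$2) (Z$3)" "psi (Z$2) (Z$1) (Z$3)" "psi (Z$1) (Z$3) (Z$2)"
     "psi (Z$3) (Z$2) (Z$1)" "psi (Z$3) (Z$1) (Z$2)" "psi (Z$2) (Z$3) (Z$1)"
      by (rule psi_ray(1)[OF 1])
    have t: "(0::real) \<le> 1" by simp
    show ?thesis
      unfolding defs
      using ray.e_pos[OF t] ray.e_bound ray.s_upper[OF t] ray.s_lower[OF t] ray.r_upper[OF t] ray.r_lower[OF t]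
      unfolding mult_1_right by blast
  next
    case 2
    interpret ray: dunkl_ray k A B Q P "psi (Z$1) (Z$2) (Z$3)" "psi (Z$2) (Z$1) (Z$3)" "psi (Z$1) (Z$3) (Z$2)"
     "psi (Z$3) (Z$2) (Z$1)" "psi (Z$2) (Z$3) (Z$1)" "psi (Z$3) (Z$1) (Z$2)"
      by (rule psi_ray(2)[OF 2])
    have t: "(0::real) \<le> 1" by simp
    show ?thesis
      unfolding defs
      using ray.e_pos[OF t] ray.e_bound ray.s_upper[OF t] ray.s_lower[OF t] ray.r_upper[OF t] ray.r_lower[OF t]
      unfolding mult_1_right C' by blast
  qed
  then show "e > 0" "1 / K \<le> e * W" "e * W \<le> K"
    "(1 + A) * psi (Z$2) (Z$1) (Z$3) 1 \<le> ratio_const k * e" "k / (1 + 6 * k) * e \<le> (1 + A) * psi (Z$2) (Z$1) (Z$3) 1"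
    "(1 + B) * psi (Z$1) (Z$3) (Z$2) 1 \<le> ratio_const k * e" "k / (1 + 6 * k) * e \<le> (1 + B) * psi (Z$1) (Z$3) (Z$2) 1"
    "(1 + C) * psi (Z$3) (Z$2) (Z$1) 1 \<le> ratio_const k * e" "k / (1 + 6 * k) * e \<le> (1 + C) * psi (Z$3) (Z$2) (Z$1) 1"
    "(1 + (A + B + P)) * psi (Z$3) (Z$1) (Z$2) 1 \<le> rot_upper k * e * mass"
    "rot_lower k * e * mass \<le> (1 + (A + B + P)) * psi (Z$3) (Z$1) (Z$2) 1"
    "(1 + (A + B + Q)) * psi (Z$2) (Z$3) (Z$1) 1 \<le> rot_upper k * e * mass"
    "rot_lower k * e * mass \<le> (1 + (A + B + Q)) * psi (Z$2) (Z$3) (Z$1) 1"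
    by blast+
qed

lemma const_pos: "ratio_const k > 0" "rot_upper k > 0" "rot_lower k > 0"
  using k by (auto simp: ratio_const_def rot_upper_def rot_lower_def intro!: add_pos_nonneg)

text \<open>F is the extra factor by which a component falls below e. As e has order 1 / W, the
  kernel value has the order of the bound, and the two constants L and K multiply.\<close>

lemma comparableI:
  assumes F: "F > 0" and lo: "psi (Z$1) (Z$2) (Z$3) 1 \<le> L * (F * psi p q r 1)"
    and hi: "F * psi p q r 1 \<le> L * psi (Z$1) (Z$2) (Z$3) 1"
    and L: "L > 0" "L \<le> 1 + ratio_const k + (1 + 6 * k) / k + 6 * rot_upper k + 2 / rot_lower k"
    and X: "p + q + r = 0" and bnd: "bnd u v w l Z = exp (l \<bullet> Z) / (W * F)"
  shows "comparable k (dunkl_kernel k (vector [p, q, r]) l) (bnd u v w l Z)"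
proof -
  define K where "K = exp (3 * pi * k * dev_const k)"
  define e where "e = psi (Z$1) (Z$2) (Z$3) 1"
  define s where "s = psi p q r 1"
  define E where "E = exp (l \<bullet> Z)"
  have K: "K > 0" and E: "E > 0" by (simp_all add: K_def E_def)
  have W: "W > 0" unfolding W_def using nonneg by (simp add: add_nonneg_eq_0_iff)
  note est = psi_estimates(1-3)[folded e_def K_def]
  have M: "L * K \<le> est_const k" "L * K > 0"
    using mult_left_mono[OF L(2), of K] K L(1) by (simp_all add: est_const_def K_def mult.commute)
  have dk: "dunkl_kernel k (vector [p, q, r]) l = E * s"
    using k X by (simp add: dunkl_kernel_eq aa_iff s_def psi_def E_def flip: exp_add mult.assoc)
  have "F * s * W \<le> L * (e * W)" using mult_right_mono[OF hi, of W] W by (simp add: e_def s_def mult_ac)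
  also have "\<dots> \<le> L * K" using est(3) L(1) by (intro mult_left_mono) auto
  finally have 1: "s \<le> L * K / (W * F)" using W F by (simp add: field_simps)
  have "1 / K \<le> e * W" by (rule est(2))
  also have "\<dots> \<le> L * (F * s) * W" using lo W by (intro mult_right_mono) (auto simp: e_def s_def)
  finally have "1 / K \<le> L * (F * s) * W" .
  then have 2: "1 / (L * K) / (W * F) \<le> s" using W F K L(1) by (simp add: field_simps)
  have b: "bnd u v w l Z = E / (W * F)" "bnd u v w l Z > 0" unfolding bnd E_def using W F by simp_all
  have "E * s \<le> L * K * bnd u v w l Z"
    using mult_left_mono[OF 1, of E] E by (simp add: b(1) mult_ac)
  also have "\<dots> \<le> est_const k * bnd u v w l Z" using M b(2) by (intro mult_right_mono) auto
  finally have hi': "E * s \<le> est_const k * bnd u v w l Z" .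
  have "bnd u v w l Z / est_const k \<le> bnd u v w l Z / (L * K)"
    using M b(2) by (intro divide_left_mono) auto
  also have "\<dots> \<le> E * s"
    using mult_left_mono[OF 2, of E] E by (simp add: b(1) mult_ac)
  finally show ?thesis unfolding comparable_def dk using hi' by simp
qed

lemma bnd_eq:
  "bnd k k k l Z = exp (l \<bullet> Z) / (W * 1)"
  "bnd (k+1) k k l Z = exp (l \<bullet> Z) / (W * (1 + A))"
  "bnd k (k+1) k l Z = exp (l \<bullet> Z) / (W * (1 + B))"
  "bnd k k (k+1) l Z = exp (l \<bullet> Z) / (W * (1 + C))"
  "bnd (k+1) (k+1) k l Z = exp (l \<bullet> Z) / (W * ((1 + A) * (1 + B)))"
  "bnd k (k+1) (k+1) l Z = exp (l \<bullet> Z) / (W * ((1 + B) * (1 + C)))"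
  "bnd (k+1) k (k+1) l Z = exp (l \<bullet> Z) / (W * ((1 + A) * (1 + C)))"
proof -
  have "1 + A > 0" "1 + B > 0" "1 + C > 0" using nonneg by auto
  then have "(1 + A) powr (k + 1) = (1 + A) powr k * (1 + A)" "(1 + B) powr (k + 1) = (1 + B) powr k * (1 + B)"
    "(1 + C) powr (k + 1) = (1 + C) powr k * (1 + C)"
    by (simp_all add: powr_add)
  note p = this
  show "bnd k k k l Z = exp (l \<bullet> Z) / (W * 1)"
    "bnd (k+1) k k l Z = exp (l \<bullet> Z) / (W * (1 + A))"
    "bnd k (k+1) k l Z = exp (l \<bullet> Z) / (W * (1 + B))"
    "bnd k k (k+1) l Z = exp (l \<bullet> Z) / (W * (1 + C))"
    "bnd (k+1) (k+1) k l Z = exp (l \<bullet> Z) / (W * ((1 + A) * (1 + B)))"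
    "bnd k (k+1) (k+1) l Z = exp (l \<bullet> Z) / (W * ((1 + B) * (1 + C)))"
    "bnd (k+1) k (k+1) l Z = exp (l \<bullet> Z) / (W * ((1 + A) * (1 + C)))"
    unfolding bnd_def A_def[symmetric] B_def[symmetric] C_def[symmetric] p W_def by (simp_all only: mult_ac mult_1_right)
qed

lemma comparable_id: "comparable k (dunkl_kernel k (vector [Z$1, Z$2, Z$3]) l) (bnd k k k l Z)"
  by (rule comparableI[OF _ _ _ _ _ _ bnd_eq(1), of 1])
    (use const_pos k Z(1) in \<open>simp_all add: aa_iff\<close>)

lemma reflection_bounds:
  assumes "F * s \<le> ratio_const k * e" "k / (1 + 6 * k) * e \<le> F * s" "e > 0"
  defines "L \<equiv> ratio_const k + (1 + 6 * k) / k"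
  shows "e \<le> L * (F * s)" "F * s \<le> L * e" "L > 0"
    "L \<le> 1 + ratio_const k + (1 + 6 * k) / k + 6 * rot_upper k + 2 / rot_lower k"
proof -
  have c: "(1 + 6 * k) / k > 0" using k by simp
  show "L > 0" using c const_pos by (simp add: L_def)
  have Fs: "F * s \<ge> 0" using assms(2,3) k by (smt (verit) divide_pos_pos mult_pos_pos)
  have "e = (1 + 6 * k) / k * (k / (1 + 6 * k) * e)" using k by simp
  also have "\<dots> \<le> (1 + 6 * k) / k * (F * s)" using assms(2) c by (intro mult_left_mono) auto
  also have "\<dots> \<le> L * (F * s)" using Fs const_pos by (intro mult_right_mono) (auto simp: L_def)
  finally show "e \<le> L * (F * s)" .
  show "F * s \<le> L * e" using assms(1,3) c mult_pos_pos[OF c assms(3)] by (simp only: L_def distrib_right)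
  show "L \<le> 1 + ratio_const k + (1 + 6 * k) / k + 6 * rot_upper k + 2 / rot_lower k"
    using const_pos by (simp add: L_def)
qed

lemma comparable_reflection:
  "comparable k (dunkl_kernel k (vector [Z$2, Z$1, Z$3]) l) (bnd (k+1) k k l Z)"
  "comparable k (dunkl_kernel k (vector [Z$1, Z$3, Z$2]) l) (bnd k (k+1) k l Z)"
  "comparable k (dunkl_kernel k (vector [Z$3, Z$2, Z$1]) l) (bnd k k (k+1) l Z)"
proof -
  note est = psi_estimates
  have pos: "1 + A > 0" "1 + B > 0" "1 + C > 0" using nonneg by auto
  have sum: "Z$1 + Z$2 + Z$3 = 0" using Z(1) by (simp add: aa_iff)
  show "comparable k (dunkl_kernel k (vector [Z$2, Z$1, Z$3]) l) (bnd (k+1) k k l Z)"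
    using reflection_bounds[OF est(4,5,1)] pos(1) sum by (intro comparableI[OF _ _ _ _ _ _ bnd_eq(2)]) auto
  show "comparable k (dunkl_kernel k (vector [Z$1, Z$3, Z$2]) l) (bnd k (k+1) k l Z)"
    using reflection_bounds[OF est(6,7,1)] pos(2) sum by (intro comparableI[OF _ _ _ _ _ _ bnd_eq(3)]) auto
  show "comparable k (dunkl_kernel k (vector [Z$3, Z$2, Z$1]) l) (bnd k k (k+1) l Z)"
    using reflection_bounds[OF est(8,9,1)] pos(3) sum by (intro comparableI[OF _ _ _ _ _ _ bnd_eq(4)]) auto
qed

text \<open>The ray estimates give s of order e mass / R. If R is comparable to F mass, this becomes
  e / F, the form \<open>comparableI\<close> requires.\<close>

lemma rotation_bounds:
  assumes "R * s \<le> rot_upper k * e * mass" "rot_lower k * e * mass \<le> R * s" "e > 0" "R > 0" "F > 0"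
    and F: "R \<le> 2 * (F * mass)" "F * mass \<le> 6 * R"
  defines "L \<equiv> 6 * rot_upper k + 2 / rot_lower k"
  shows "e \<le> L * (F * s)" "F * s \<le> L * e" "L > 0"
    "L \<le> 1 + ratio_const k + (1 + 6 * k) / k + 6 * rot_upper k + 2 / rot_lower k"
proof -
  show "L > 0" using const_pos by (auto simp: L_def intro!: add_pos_pos)
  have "R * (F * s) \<le> F * (rot_upper k * e * mass)"
    using mult_left_mono[OF assms(1), of F] assms(5) by (simp add: mult_ac)
  also have "\<dots> = rot_upper k * e * (F * mass)" by (simp add: mult_ac)
  also have "\<dots> \<le> rot_upper k * e * (6 * R)" using F(2) const_pos assms(3) by (intro mult_left_mono) auto
  finally have "R * (F * s) \<le> R * (6 * rot_upper k * e)" by (simp add: mult_ac)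
  then have hi: "F * s \<le> 6 * rot_upper k * e" using assms(4) by simp
  also have "\<dots> \<le> L * e" using const_pos assms(3) by (intro mult_right_mono) (auto simp: L_def)
  finally show "F * s \<le> L * e" .
  have "rot_lower k * e * R \<le> rot_lower k * e * (2 * (F * mass))"
    using F(1) const_pos assms(3) by (intro mult_left_mono) auto
  also have "\<dots> = 2 * F * (rot_lower k * e * mass)" by (simp add: mult_ac)
  also have "\<dots> \<le> 2 * F * (R * s)" using assms(2,5) by (intro mult_left_mono) auto
  finally have "R * (rot_lower k * e) \<le> R * (2 * (F * s))" by (simp add: mult_ac)
  then have lo: "rot_lower k * e \<le> 2 * (F * s)" using assms(4) by simp
  then have lo': "e \<le> 2 / rot_lower k * (F * s)" using const_pos by (simp add: field_simps)
  have "F * s \<ge> 0" using lo assms(3) const_pos by (smt (verit) mult_pos_pos)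
  then have "2 / rot_lower k * (F * s) \<le> L * (F * s)"
    using const_pos by (intro mult_right_mono) (auto simp: L_def)
  with lo' show "e \<le> L * (F * s)" by linarith
  have "(1 + 6 * k) / k > 0" using k by simp
  then show "L \<le> 1 + ratio_const k + (1 + 6 * k) / k + 6 * rot_upper k + 2 / rot_lower k"
    using const_pos by (simp add: L_def)
qed

section \<open>Rewriting the rotation estimates as products of powers\<close>

lemma mult_sum_recip:
  fixes p q r :: real
  assumes "p \<noteq> 0" "q \<noteq> 0" "r \<noteq> 0"
  shows "p * q * (1 / p + 1 / q + 1 / r) = q + p + p * q / r"
    "q * r * (1 / p + 1 / q + 1 / r) = q * r / p + r + q"
    "p * r * (1 / p + 1 / q + 1 / r) = r + p * r / q + p"
  using assms by (simp_all add: field_simps)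

lemma frac_le_other: "0 \<le> x \<Longrightarrow> x \<le> y \<Longrightarrow> 0 \<le> z \<Longrightarrow> (1 + x) * (1 + z) / (1 + y) \<le> 1 + z" for x y z :: real
  by (simp add: divide_le_eq mult.commute mult_left_mono)

text \<open>Multiplying \<open>mass\<close> by two of its denominators leaves their sum plus a
  quotient, here at most 1 + B because A <= C. The product thus has the order of 1 + A + B.\<close>

lemma mass_AB:
  assumes "S \<ge> 0" "S \<le> A + B"
  shows "1 + (A + B + S) \<le> 2 * ((1 + A) * (1 + B) * mass)" "(1 + A) * (1 + B) * mass \<le> 6 * (1 + (A + B + S))"
proof -
  have nz: "1 + A > 0" "1 + B > 0" "1 + C > 0" using nonneg by auto
  define x where "x = (1 + A) * (1 + B) / (1 + C)"
  have eq: "(1 + A) * (1 + B) * mass = (1 + B) + (1 + A) + x"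
    unfolding mass_def x_def by (rule mult_sum_recip; use nz in simp)
  have "x \<le> 1 + B" using nonneg C_eq unfolding x_def by (intro frac_le_other) auto
  moreover have "x \<ge> 0" using nz by (simp add: x_def)
  ultimately show "1 + (A + B + S) \<le> 2 * ((1 + A) * (1 + B) * mass)"
    "(1 + A) * (1 + B) * mass \<le> 6 * (1 + (A + B + S))"
    unfolding eq using assms nonneg by simp_all
qed

text \<open>For B <= A the A-term of \<open>mass\<close> is dominated by its B-term, so the product
  has the order of 1 + C.\<close>

lemma mass_BC:
  assumes "B \<le> A" "R \<le> C" "C \<le> 2 * R"
  shows "1 + R \<le> 2 * ((1 + B) * (1 + C) * mass)" "(1 + B) * (1 + C) * mass \<le> 6 * (1 + R)"
proof -
  have nz: "1 + A > 0" "1 + B > 0" "1 + C > 0" using nonneg by auto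
  define x where "x = (1 + B) * (1 + C) / (1 + A)"
  have eq: "(1 + B) * (1 + C) * mass = x + (1 + C) + (1 + B)"
    unfolding mass_def x_def by (rule mult_sum_recip; use nz in simp)
  have "x \<le> 1 + C" using nonneg assms unfolding x_def by (intro frac_le_other) auto
  moreover have "x \<ge> 0" using nz by (simp add: x_def)
  moreover have "B \<le> C" using C_eq nonneg by auto
  ultimately show "1 + R \<le> 2 * ((1 + B) * (1 + C) * mass)" "(1 + B) * (1 + C) * mass \<le> 6 * (1 + R)"
    unfolding eq using assms nonneg by simp_all
qed

lemma mass_AC:
  assumes "A \<le> B" "R \<le> C" "C \<le> 2 * R"
  shows "1 + R \<le> 2 * ((1 + A) * (1 + C) * mass)" "(1 + A) * (1 + C) * mass \<le> 6 * (1 + R)"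
proof -
  have nz: "1 + A > 0" "1 + B > 0" "1 + C > 0" using nonneg by auto
  define x where "x = (1 + A) * (1 + C) / (1 + B)"
  have eq: "(1 + A) * (1 + C) * mass = (1 + C) + x + (1 + A)"
    unfolding mass_def x_def by (rule mult_sum_recip; use nz in simp)
  have "x \<le> 1 + C" using nonneg assms unfolding x_def by (intro frac_le_other) auto
  moreover have "x \<ge> 0" using nz by (simp add: x_def)
  moreover have "A \<le> C" using C_eq nonneg by auto
  ultimately show "1 + R \<le> 2 * ((1 + A) * (1 + C) * mass)" "(1 + A) * (1 + C) * mass \<le> 6 * (1 + R)"
    unfolding eq using assms nonneg by simp_all
qed

text \<open>This is the meaning of the case split on l: the rate A + B + P has the order of A + B if
  P <= B, and of C if Q <= A, since only Q is missing from C. The rate A + B + Q behaves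
  symmetrically.\<close>

lemma P_le_B: "alph l \<le> bet l \<Longrightarrow> P \<le> B" and Q_le_A: "bet l \<le> alph l \<Longrightarrow> Q \<le> A"
  unfolding P_def B_def Q_def A_def using Z by (auto intro!: mult_right_mono simp: alph_def bet_def)

text \<open>Here \<open>mass\<close> has the order of 1 / (1 + min A B), so when the rate is of
  order C the comparison of A with B decides which factor accompanies 1 + C.\<close>

lemma comparable_rotation_P:
  "alph l \<le> bet l \<Longrightarrow> comparable k (dunkl_kernel k (vector [Z$3, Z$1, Z$2]) l) (bnd (k+1) (k+1) k l Z)"
  "bet l \<le> alph l \<Longrightarrow> B \<le> A \<Longrightarrow> comparable k (dunkl_kernel k (vector [Z$3, Z$1, Z$2]) l) (bnd k (k+1) (k+1) l Z)"
  "bet l \<le> alph l \<Longrightarrow> A \<le> B \<Longrightarrow> comparable k (dunkl_kernel k (vector [Z$3, Z$1, Z$2]) l) (bnd (k+1) k (k+1) l Z)"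
proof -
  have pos: "1 + A > 0" "1 + B > 0" "1 + C > 0" "1 + (A + B + P) > 0" using nonneg by auto
  have F: "(1 + A) * (1 + B) > 0" "(1 + B) * (1 + C) > 0" "(1 + A) * (1 + C) > 0" using pos by auto
  have sum: "Z$3 + Z$1 + Z$2 = 0" using Z(1) by (simp add: aa_iff)
  note rb = rotation_bounds[OF psi_estimates(10,11,1) pos(4)]
  show "comparable k (dunkl_kernel k (vector [Z$3, Z$1, Z$2]) l) (bnd (k+1) (k+1) k l Z)" if "alph l \<le> bet l"
  proof -
    have "P \<ge> 0" "P \<le> A + B" using P_le_B[OF that] nonneg by auto
    from rb[OF F(1) mass_AB[OF this]] show ?thesis
      by (rule comparableI[OF F(1) _ _ _ _ sum bnd_eq(5)])
  qed
  show "comparable k (dunkl_kernel k (vector [Z$3, Z$1, Z$2]) l) (bnd k (k+1) (k+1) l Z)" if "bet l \<le> alph l" "B \<le> A"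
  proof -
    have "A + B + P \<le> C" "C \<le> 2 * (A + B + P)" using Q_le_A[OF that(1)] nonneg C_eq by auto
    from rb[OF F(2) mass_BC[OF that(2) this]] show ?thesis
      by (rule comparableI[OF F(2) _ _ _ _ sum bnd_eq(6)])
  qed
  show "comparable k (dunkl_kernel k (vector [Z$3, Z$1, Z$2]) l) (bnd (k+1) k (k+1) l Z)" if "bet l \<le> alph l" "A \<le> B"
  proof -
    have "A + B + P \<le> C" "C \<le> 2 * (A + B + P)" using Q_le_A[OF that(1)] nonneg C_eq by auto
    from rb[OF F(3) mass_AC[OF that(2) this]] show ?thesis
      by (rule comparableI[OF F(3) _ _ _ _ sum bnd_eq(7)])
  qed
qed

lemma comparable_rotation_Q:
  "bet l \<le> alph l \<Longrightarrow> comparable k (dunkl_kernel k (vector [Z$2, Z$3, Z$1]) l) (bnd (k+1) (k+1) k l Z)"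
  "alph l \<le> bet l \<Longrightarrow> B \<le> A \<Longrightarrow> comparable k (dunkl_kernel k (vector [Z$2, Z$3, Z$1]) l) (bnd k (k+1) (k+1) l Z)"
  "alph l \<le> bet l \<Longrightarrow> A \<le> B \<Longrightarrow> comparable k (dunkl_kernel k (vector [Z$2, Z$3, Z$1]) l) (bnd (k+1) k (k+1) l Z)"
proof -
  have pos: "1 + A > 0" "1 + B > 0" "1 + C > 0" "1 + (A + B + Q) > 0" using nonneg by auto
  have F: "(1 + A) * (1 + B) > 0" "(1 + B) * (1 + C) > 0" "(1 + A) * (1 + C) > 0" using pos by auto
  have sum: "Z$2 + Z$3 + Z$1 = 0" using Z(1) by (simp add: aa_iff)
  note rb = rotation_bounds[OF psi_estimates(12,13,1) pos(4)]
  show "comparable k (dunkl_kernel k (vector [Z$2, Z$3, Z$1]) l) (bnd (k+1) (k+1) k l Z)" if "bet l \<le> alph l"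
  proof -
    have "Q \<ge> 0" "Q \<le> A + B" using Q_le_A[OF that] nonneg by auto
    from rb[OF F(1) mass_AB[OF this]] show ?thesis
      by (rule comparableI[OF F(1) _ _ _ _ sum bnd_eq(5)])
  qed
  show "comparable k (dunkl_kernel k (vector [Z$2, Z$3, Z$1]) l) (bnd k (k+1) (k+1) l Z)" if "alph l \<le> bet l" "B \<le> A"
  proof -
    have "A + B + Q \<le> C" "C \<le> 2 * (A + B + Q)" using P_le_B[OF that(1)] nonneg C_eq by auto
    from rb[OF F(2) mass_BC[OF that(2) this]] show ?thesis
      by (rule comparableI[OF F(2) _ _ _ _ sum bnd_eq(6)])
  qed
  show "comparable k (dunkl_kernel k (vector [Z$2, Z$3, Z$1]) l) (bnd (k+1) k (k+1) l Z)" if "alph l \<le> bet l" "A \<le> B"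
  proof -
    have "A + B + Q \<le> C" "C \<le> 2 * (A + B + Q)" using P_le_B[OF that(1)] nonneg C_eq by auto
    from rb[OF F(3) mass_AC[OF that(2) this]] show ?thesis
      by (rule comparableI[OF F(3) _ _ _ _ sum bnd_eq(7)])
  qed
qed

end

section \<open>Assembly over the six chambers\<close>

lemma est_const_pos: "k > 0 \<Longrightarrow> est_const k > 0"
  by (auto simp: est_const_def ratio_const_def rot_upper_def rot_lower_def intro!: mult_pos_pos add_pos_nonneg)

lemma asymp_onI:
  assumes "k > 0" "\<And>l X. S (l, X) \<Longrightarrow> comparable k (f (l, X)) (g (l, X))"
  shows "asymp_on S f g"
  unfolding asymp_on_def
  using assms est_const_pos[OF assms(1)] by (auto simp: comparable_def)

text \<open>In use the permutation is inverted: with Z = \<open>xplus X\<close>, the fourth case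
  gives X = (Z3, Z1, Z2) and belongs to \<open>comparable_rotation_P\<close>, while the fifth gives
  X = (Z2, Z3, Z1) and belongs to \<open>comparable_rotation_Q\<close>.\<close>

lemma xplus_cases:
  assumes "X$1 + X$2 + X$3 = 0"
  shows "X$1 \<ge> X$2 \<Longrightarrow> X$2 \<ge> X$3 \<Longrightarrow> xplus X = vector [X$1, X$2, X$3]"
    "X$2 \<ge> X$1 \<Longrightarrow> X$1 \<ge> X$3 \<Longrightarrow> xplus X = vector [X$2, X$1, X$3]"
    "X$1 \<ge> X$3 \<Longrightarrow> X$3 \<ge> X$2 \<Longrightarrow> xplus X = vector [X$1, X$3, X$2]"
    "X$2 \<ge> X$3 \<Longrightarrow> X$3 \<ge> X$1 \<Longrightarrow> xplus X = vector [X$2, X$3, X$1]"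
    "X$3 \<ge> X$1 \<Longrightarrow> X$1 \<ge> X$2 \<Longrightarrow> xplus X = vector [X$3, X$1, X$2]"
    "X$3 \<ge> X$2 \<Longrightarrow> X$2 \<ge> X$1 \<Longrightarrow> xplus X = vector [X$3, X$2, X$1]"
  using assms by (auto simp: xplus_def Let_def vec_eq_iff forall_3 max_def min_def)

theorem theorem2:
  fixes k :: real
  assumes "k > 0"
  shows
   "asymp_on (\<lambda>(l,X). l \<in> Cplus \<and> X \<in> aa \<and> X$1 \<ge> X$2 \<and> X$2 \<ge> X$3)
      (\<lambda>(l,X). dunkl_kernel k X l) (\<lambda>(l,X). bnd k k k l X)
  \<and> asymp_on (\<lambda>(l,X). l \<in> Cplus \<and> X \<in> aa \<and> X$2 \<ge> X$1 \<and> X$1 \<ge> X$3)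
      (\<lambda>(l,X). dunkl_kernel k X l) (\<lambda>(l,X). bnd (k+1) k k l (xplus X))
  \<and> asymp_on (\<lambda>(l,X). l \<in> Cplus \<and> X \<in> aa \<and> X$1 \<ge> X$3 \<and> X$3 \<ge> X$2)
      (\<lambda>(l,X). dunkl_kernel k X l) (\<lambda>(l,X). bnd k (k+1) k l (xplus X))
  \<and> asymp_on (\<lambda>(l,X). l \<in> Cplus \<and> X \<in> aa \<and> X$2 \<ge> X$3 \<and> X$3 \<ge> X$1
                 \<and> alph l \<le> bet l)
      (\<lambda>(l,X). dunkl_kernel k X l) (\<lambda>(l,X). bnd (k+1) (k+1) k l (xplus X))
  \<and> asymp_on (\<lambda>(l,X). l \<in> Cplus \<and> X \<in> aa \<and> X$2 \<ge> X$3 \<and> X$3 \<ge> X$1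
                 \<and> alph l \<ge> bet l \<and> alph l * alph (xplus X) \<ge> bet l * bet (xplus X))
      (\<lambda>(l,X). dunkl_kernel k X l) (\<lambda>(l,X). bnd k (k+1) (k+1) l (xplus X))
  \<and> asymp_on (\<lambda>(l,X). l \<in> Cplus \<and> X \<in> aa \<and> X$2 \<ge> X$3 \<and> X$3 \<ge> X$1
                 \<and> alph l \<ge> bet l \<and> alph l * alph (xplus X) \<le> bet l * bet (xplus X))
      (\<lambda>(l,X). dunkl_kernel k X l) (\<lambda>(l,X). bnd (k+1) k (k+1) l (xplus X))
  \<and> asymp_on (\<lambda>(l,X). l \<in> Cplus \<and> X \<in> aa \<and> X$3 \<ge> X$1 \<and> X$1 \<ge> X$2
                 \<and> bet l \<le> alph l)
      (\<lambda>(l,X). dunkl_kernel k X l) (\<lambda>(l,X). bnd (k+1) (k+1) k l (xplus X))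
  \<and> asymp_on (\<lambda>(l,X). l \<in> Cplus \<and> X \<in> aa \<and> X$3 \<ge> X$1 \<and> X$1 \<ge> X$2
                 \<and> bet l \<ge> alph l \<and> alph l * alph (xplus X) \<ge> bet l * bet (xplus X))
      (\<lambda>(l,X). dunkl_kernel k X l) (\<lambda>(l,X). bnd k (k+1) (k+1) l (xplus X))
  \<and> asymp_on (\<lambda>(l,X). l \<in> Cplus \<and> X \<in> aa \<and> X$3 \<ge> X$1 \<and> X$1 \<ge> X$2
                 \<and> bet l \<ge> alph l \<and> alph l * alph (xplus X) \<le> bet l * bet (xplus X))
      (\<lambda>(l,X). dunkl_kernel k X l) (\<lambda>(l,X). bnd (k+1) k (k+1) l (xplus X))
  \<and> asymp_on (\<lambda>(l,X). l \<in> Cplus \<and> X \<in> aa \<and> X$3 \<ge> X$2 \<and> X$2 \<ge> X$1)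
      (\<lambda>(l,X). dunkl_kernel k X l) (\<lambda>(l,X). bnd k k (k+1) l (xplus X))"
proof -
  have chamber: "chamber_point k l (xplus X)" if "l \<in> Cplus" "X \<in> aa" for l X
    using that assms by unfold_locales (auto simp: xplus_def Let_def aa_iff max_def min_def)
  have c1: "asymp_on (\<lambda>(l,X). l \<in> Cplus \<and> X \<in> aa \<and> X$1 \<ge> X$2 \<and> X$2 \<ge> X$3)
      (\<lambda>(l,X). dunkl_kernel k X l) (\<lambda>(l,X). bnd k k k l X)"
  proof (rule asymp_onI[OF assms], unfold split_conv)
    fix l X :: "real^3"
    assume X: "l \<in> Cplus \<and> X \<in> aa \<and> X$1 \<ge> X$2 \<and> X$2 \<ge> X$3"
    then have xp: "xplus X = vector [X$1, X$2, X$3]" by (intro xplus_cases(1)) (auto simp: aa_iff)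
    interpret cp: chamber_point k l "xplus X" using chamber X by blast
    show "comparable k (dunkl_kernel k X l) (bnd k k k l X)"
      using cp.comparable_id X by (simp add: xp[unfolded vector_eta] vector_eta)
  qed
  have c2: "asymp_on (\<lambda>(l,X). l \<in> Cplus \<and> X \<in> aa \<and> X$2 \<ge> X$1 \<and> X$1 \<ge> X$3)
      (\<lambda>(l,X). dunkl_kernel k X l) (\<lambda>(l,X). bnd (k+1) k k l (xplus X))"
  proof (rule asymp_onI[OF assms], unfold split_conv)
    fix l X :: "real^3"
    assume X: "l \<in> Cplus \<and> X \<in> aa \<and> X$2 \<ge> X$1 \<and> X$1 \<ge> X$3"
    then have xp: "xplus X = vector [X$2, X$1, X$3]" by (intro xplus_cases(2)) (auto simp: aa_iff)
    interpret cp: chamber_point k l "xplus X" using chamber X by blast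
    show "comparable k (dunkl_kernel k X l) (bnd (k+1) k k l (xplus X))"
      using cp.comparable_reflection(1) X by (simp add: xp vector_eta)
  qed
  have c3: "asymp_on (\<lambda>(l,X). l \<in> Cplus \<and> X \<in> aa \<and> X$1 \<ge> X$3 \<and> X$3 \<ge> X$2)
      (\<lambda>(l,X). dunkl_kernel k X l) (\<lambda>(l,X). bnd k (k+1) k l (xplus X))"
  proof (rule asymp_onI[OF assms], unfold split_conv)
    fix l X :: "real^3"
    assume X: "l \<in> Cplus \<and> X \<in> aa \<and> X$1 \<ge> X$3 \<and> X$3 \<ge> X$2"
    then have xp: "xplus X = vector [X$1, X$3, X$2]" by (intro xplus_cases(3)) (auto simp: aa_iff)
    interpret cp: chamber_point k l "xplus X" using chamber X by blast
    show "comparable k (dunkl_kernel k X l) (bnd k (k+1) k l (xplus X))"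
      using cp.comparable_reflection(2) X by (simp add: xp vector_eta)
  qed
  have c4: "asymp_on (\<lambda>(l,X). l \<in> Cplus \<and> X \<in> aa \<and> X$2 \<ge> X$3 \<and> X$3 \<ge> X$1
                 \<and> alph l \<le> bet l)
      (\<lambda>(l,X). dunkl_kernel k X l) (\<lambda>(l,X). bnd (k+1) (k+1) k l (xplus X))"
  proof (rule asymp_onI[OF assms], unfold split_conv)
    fix l X :: "real^3"
    assume X: "l \<in> Cplus \<and> X \<in> aa \<and> X$2 \<ge> X$3 \<and> X$3 \<ge> X$1 \<and> alph l \<le> bet l"
    then have xp: "xplus X = vector [X$2, X$3, X$1]" by (intro xplus_cases(4)) (auto simp: aa_iff)
    interpret cp: chamber_point k l "xplus X" using chamber X by blast
    show "comparable k (dunkl_kernel k X l) (bnd (k+1) (k+1) k l (xplus X))"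
      using cp.comparable_rotation_P(1) X by (simp add: xp vector_eta)
  qed
  have c5: "asymp_on (\<lambda>(l,X). l \<in> Cplus \<and> X \<in> aa \<and> X$2 \<ge> X$3 \<and> X$3 \<ge> X$1
                 \<and> alph l \<ge> bet l \<and> alph l * alph (xplus X) \<ge> bet l * bet (xplus X))
      (\<lambda>(l,X). dunkl_kernel k X l) (\<lambda>(l,X). bnd k (k+1) (k+1) l (xplus X))"
  proof (rule asymp_onI[OF assms], unfold split_conv)
    fix l X :: "real^3"
    assume X: "l \<in> Cplus \<and> X \<in> aa \<and> X$2 \<ge> X$3 \<and> X$3 \<ge> X$1 \<and> alph l \<ge> bet l \<and> alph l * alph (xplus X) \<ge> bet l * bet (xplus X)"
    then have xp: "xplus X = vector [X$2, X$3, X$1]" by (intro xplus_cases(4)) (auto simp: aa_iff)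
    interpret cp: chamber_point k l "xplus X" using chamber X by blast
    show "comparable k (dunkl_kernel k X l) (bnd k (k+1) (k+1) l (xplus X))"
      using cp.comparable_rotation_P(2)[unfolded cp.A_def cp.B_def] X by (simp add: xp vector_eta)
  qed
  have c6: "asymp_on (\<lambda>(l,X). l \<in> Cplus \<and> X \<in> aa \<and> X$2 \<ge> X$3 \<and> X$3 \<ge> X$1
                 \<and> alph l \<ge> bet l \<and> alph l * alph (xplus X) \<le> bet l * bet (xplus X))
      (\<lambda>(l,X). dunkl_kernel k X l) (\<lambda>(l,X). bnd (k+1) k (k+1) l (xplus X))"
  proof (rule asymp_onI[OF assms], unfold split_conv)
    fix l X :: "real^3"
    assume X: "l \<in> Cplus \<and> X \<in> aa \<and> X$2 \<ge> X$3 \<and> X$3 \<ge> X$1 \<and> alph l \<ge> bet l \<and> alph l * alph (xplus X) \<le> bet l * bet (xplus X)"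
    then have xp: "xplus X = vector [X$2, X$3, X$1]" by (intro xplus_cases(4)) (auto simp: aa_iff)
    interpret cp: chamber_point k l "xplus X" using chamber X by blast
    show "comparable k (dunkl_kernel k X l) (bnd (k+1) k (k+1) l (xplus X))"
      using cp.comparable_rotation_P(3)[unfolded cp.A_def cp.B_def] X by (simp add: xp vector_eta)
  qed
  have c7: "asymp_on (\<lambda>(l,X). l \<in> Cplus \<and> X \<in> aa \<and> X$3 \<ge> X$1 \<and> X$1 \<ge> X$2
                 \<and> bet l \<le> alph l)
      (\<lambda>(l,X). dunkl_kernel k X l) (\<lambda>(l,X). bnd (k+1) (k+1) k l (xplus X))"
  proof (rule asymp_onI[OF assms], unfold split_conv)
    fix l X :: "real^3"
    assume X: "l \<in> Cplus \<and> X \<in> aa \<and> X$3 \<ge> X$1 \<and> X$1 \<ge> X$2 \<and> bet l \<le> alph l"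
    then have xp: "xplus X = vector [X$3, X$1, X$2]" by (intro xplus_cases(5)) (auto simp: aa_iff)
    interpret cp: chamber_point k l "xplus X" using chamber X by blast
    show "comparable k (dunkl_kernel k X l) (bnd (k+1) (k+1) k l (xplus X))"
      using cp.comparable_rotation_Q(1) X by (simp add: xp vector_eta)
  qed
  have c8: "asymp_on (\<lambda>(l,X). l \<in> Cplus \<and> X \<in> aa \<and> X$3 \<ge> X$1 \<and> X$1 \<ge> X$2
                 \<and> bet l \<ge> alph l \<and> alph l * alph (xplus X) \<ge> bet l * bet (xplus X))
      (\<lambda>(l,X). dunkl_kernel k X l) (\<lambda>(l,X). bnd k (k+1) (k+1) l (xplus X))"
  proof (rule asymp_onI[OF assms], unfold split_conv)
    fix l X :: "real^3"
    assume X: "l \<in> Cplus \<and> X \<in> aa \<and> X$3 \<ge> X$1 \<and> X$1 \<ge> X$2 \<and> bet l \<ge> alph l \<and> alph l * alph (xplus X) \<ge> bet l * bet (xplus X)"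
    then have xp: "xplus X = vector [X$3, X$1, X$2]" by (intro xplus_cases(5)) (auto simp: aa_iff)
    interpret cp: chamber_point k l "xplus X" using chamber X by blast
    show "comparable k (dunkl_kernel k X l) (bnd k (k+1) (k+1) l (xplus X))"
      using cp.comparable_rotation_Q(2)[unfolded cp.A_def cp.B_def] X by (simp add: xp vector_eta)
  qed
  have c9: "asymp_on (\<lambda>(l,X). l \<in> Cplus \<and> X \<in> aa \<and> X$3 \<ge> X$1 \<and> X$1 \<ge> X$2
                 \<and> bet l \<ge> alph l \<and> alph l * alph (xplus X) \<le> bet l * bet (xplus X))
      (\<lambda>(l,X). dunkl_kernel k X l) (\<lambda>(l,X). bnd (k+1) k (k+1) l (xplus X))"
  proof (rule asymp_onI[OF assms], unfold split_conv)
    fix l X :: "real^3"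
    assume X: "l \<in> Cplus \<and> X \<in> aa \<and> X$3 \<ge> X$1 \<and> X$1 \<ge> X$2 \<and> bet l \<ge> alph l \<and> alph l * alph (xplus X) \<le> bet l * bet (xplus X)"
    then have xp: "xplus X = vector [X$3, X$1, X$2]" by (intro xplus_cases(5)) (auto simp: aa_iff)
    interpret cp: chamber_point k l "xplus X" using chamber X by blast
    show "comparable k (dunkl_kernel k X l) (bnd (k+1) k (k+1) l (xplus X))"
      using cp.comparable_rotation_Q(3)[unfolded cp.A_def cp.B_def] X by (simp add: xp vector_eta)
  qed
  have c10: "asymp_on (\<lambda>(l,X). l \<in> Cplus \<and> X \<in> aa \<and> X$3 \<ge> X$2 \<and> X$2 \<ge> X$1)
      (\<lambda>(l,X). dunkl_kernel k X l) (\<lambda>(l,X). bnd k k (k+1) l (xplus X))"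
  proof (rule asymp_onI[OF assms], unfold split_conv)
    fix l X :: "real^3"
    assume X: "l \<in> Cplus \<and> X \<in> aa \<and> X$3 \<ge> X$2 \<and> X$2 \<ge> X$1"
    then have xp: "xplus X = vector [X$3, X$2, X$1]" by (intro xplus_cases(6)) (auto simp: aa_iff)
    interpret cp: chamber_point k l "xplus X" using chamber X by blast
    show "comparable k (dunkl_kernel k X l) (bnd k k (k+1) l (xplus X))"
      using cp.comparable_reflection(3) X by (simp add: xp vector_eta)
  qed
  show ?thesis
    by (intro conjI c1 c2 c3 c4 c5 c6 c7 c8 c9 c10)
qed

end
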